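(* Let $n\ge3$, $\mu\in\mathbb{C}$, and $\lambda\in\mathbb{C}^n$ with $\lambda_1-\lambda_2=\cdots=\lambda_{n-2}-\lambda_{n-1}=\mu$ and $\sigma:=\lambda_{n-1}-\lambda_n\notin\mathbb{N}$. Let $\Phi:M_\lambda\to\widetilde M$ be the $gl(n)$-module homomorphism with $\Phi(v_\lambda)=u_\lambda$, where $u_\lambda$ is the singular vector $$u_\lambda=(x_1\cdots x_n)^{\mu}\sum_{i_1,\dots,i_{n-1}\ge0}\frac{(-1)^{i_1+\cdots+i_{n-1}}\langle\mu\rangle_{i_{n-1}}}{i_1!\cdots i_{n-1}!\,\langle\sigma\rangle_{i_{n-1}}}E_{2,1}^{i_1}E_{3,2}^{i_2}\cdots E_{n,n-1}^{i_{n-1}}v_\lambda\,x_1^{i_1}x_2^{i_2-i_1}\cdots x_{n-1}^{i_{n-1}-i_{n-2}}x_n^{-i_{n-1}}.$$ Then the Etingof trace function of $\Phi$ is $$E(z_1,\dots,z_n)=\frac{\prod_{r=1}^nz_r^{\lambda_r+n-r}}{\prod_{1\le k<j\le n}(z_k-z_j)}\;\mathcal{X}_A(\mu+1,\dots,\mu+1,-\mu;-\sigma)\{\xi^A_{r_2,r_1}\},$$ where the first $n-1$ arguments equal $\mu+1$, $\tau_n=-\mu$, $\vartheta=-\sigma$, the variables are $z_{r_2,r_1}=\xi^A_{r_2,r_1}:=\prod_{s=r_1}^{r_2-1}\frac{z_{r_2}}{z_{r_2}-z_s}$ ($1\le r_1<r_2\le n$), and the right-hand side is expanded as $\prod_rz_r^{\lambda_r}$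 times a power series in the ratios $z_j/z_k$ ($j>k$), i.e. in the region $|z_1|>|z_2|>\cdots>|z_n|$.
   Context: $(c)_i=c(c+1)\cdots(c+i-1)$, $\langle c\rangle_i=c(c-1)\cdots(c-i+1)$. $M_\lambda$, $\widetilde M$: the Verma $gl(n)$-module with highest weight vector $v_\lambda$ ($E_{i,j}v_\lambda=0$ for $i<j$, $E_{k,k}v_\lambda=\lambda_kv_\lambda$) and the module of formal series $\sum_{\vec i\in\mathbb{Z}^n}v_{\vec i}x_1^{i_1+\mu}\cdots x_n^{i_n+\mu}$ ($v_{\vec i}\in M_\lambda$) with $E_{j_1,j_2}(v\,x^m)=E_{j_1,j_2}(v)x^m+v(x_{j_1}\partial_{x_{j_2}}-\mu\delta_{j_1,j_2})(x^m)$. Etingof trace: write $\Phi(w)=(x_1\cdots x_n)^\mu\sum_{\vec k\in\mathbb{Z}^n}\Phi_{\vec k}(w)x^{\vec k}$, $\Phi_{\vec k}\in\mathrm{End}(M_\lambda)$; then $E(z)=\sum_\nu\mathrm{tr}(\Phi_{\vec 0}|_{M_\lambda[\nu]})z_1^{\nu_1}\cdots z_n^{\nu_n}$ over weights $\nu$ ($E_{k,k}$ acting by $\nu_k$ on the weight space $M_\lambda[\nu]$). Hypergeometric function of type A: let $\Gamma_A=\bigoplus_{1\le j<i\le n}\mathbb{N}\epsilon_{i,j}$; for $\beta=\sum\beta_{i,j}\epsilon_{i,j}$ put $\beta_{\underline 1}=0$, $\beta_{\underline i}=\sum_{r=1}^{i-1}\beta_{i,r}$, $\beta_{\overline n}=0$,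 $\beta_{\overline j}=\sum_{s=j+1}^n\beta_{s,j}$, $\beta!=\prod\beta_{j,k}!$, $z^\beta=\prod z_{j,k}^{\beta_{j,k}}$. For $\vartheta\notin-\mathbb{N}$, $\mathcal{X}_A(\tau_1,\dots,\tau_n;\vartheta)\{z_{j,k}\}=\sum_{\beta\in\Gamma_A}\frac{\left[\prod_{s=1}^{n-1}(\tau_s-\beta_{\underline s})_{\beta_{\overline s}}\right](\tau_n)_{\beta_{\underline n}}}{\beta!\,(\vartheta)_{\beta_{\underline n}}}z^\beta$. *)

theory Defs
  imports Complex_Main
begin

section \<open>Formal power series in the variables q_1, ..., q_(n-1), q_i = z_(i+1)/z_i\<close>

text \<open>A formal power series is a coefficient function on exponent vectors (nat => nat);
  only exponent vectors supported in {1..n-1} occur.\<close>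

type_synonym mps = "(nat \<Rightarrow> nat) \<Rightarrow> complex"

definition mps_one :: mps where
  "mps_one = (\<lambda>m. if m = (\<lambda>_. 0) then 1 else 0)"

definition mps_monom :: "(nat \<Rightarrow> nat) \<Rightarrow> mps" where
  "mps_monom d = (\<lambda>m. if m = d then 1 else 0)"

definition mps_scale :: "complex \<Rightarrow> mps \<Rightarrow> mps" where
  "mps_scale c f = (\<lambda>m. c * f m)"

definition mps_mult :: "mps \<Rightarrow> mps \<Rightarrow> mps" where
  "mps_mult f g = (\<lambda>m. \<Sum>p\<in>{p. (\<lambda>i. fst p i + snd p i) = m}. f (fst p) * g (snd p))"

definition mps_prod :: "mps list \<Rightarrow> mps" where
  "mps_prod fs = foldr mps_mult fs mps_one"

definition mps_power :: "mps \<Rightarrow> nat \<Rightarrow> mps" where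
  "mps_power f k = (mps_mult f ^^ k) mps_one"

definition mps_sum :: "('i \<Rightarrow> mps) \<Rightarrow> 'i set \<Rightarrow> mps" where
  "mps_sum F I = (\<lambda>m. \<Sum>i\<in>{i\<in>I. F i m \<noteq> 0}. F i m)"

definition mps_geom :: "(nat \<Rightarrow> nat) \<Rightarrow> mps" where
  "mps_geom d = mps_sum (\<lambda>k::nat. mps_monom (\<lambda>i. k * d i)) UNIV"

text \<open>Exponent vector of z_j/z_k = q_k q_(k+1) ... q_(j-1), for k < j.\<close>
definition root :: "nat \<Rightarrow> nat \<Rightarrow> (nat \<Rightarrow> nat)" where
  "root j k = (\<lambda>i. if k \<le> i \<and> i < j then 1 else 0)"

definition pairs :: "nat \<Rightarrow> (nat \<times> nat) list" where
  "pairs n = concat (map (\<lambda>i. map (\<lambda>j. (i, j)) [1..<i]) [2..<Suc n])"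

definition GammaA :: "nat \<Rightarrow> (nat \<Rightarrow> nat \<Rightarrow> nat) set" where
  "GammaA n = {\<beta>. \<forall>i j. \<beta> i j \<noteq> 0 \<longrightarrow> 1 \<le> j \<and> j < i \<and> i \<le> n}"

definition beta_under :: "(nat \<Rightarrow> nat \<Rightarrow> nat) \<Rightarrow> nat \<Rightarrow> nat" where
  "beta_under \<beta> i = (\<Sum>r\<in>{1..<i}. \<beta> i r)"

definition beta_over :: "nat \<Rightarrow> (nat \<Rightarrow> nat \<Rightarrow> nat) \<Rightarrow> nat \<Rightarrow> nat" where
  "beta_over n \<beta> j = (\<Sum>s\<in>{j+1..n}. \<beta> s j)"

definition beta_fact :: "nat \<Rightarrow> (nat \<Rightarrow> nat \<Rightarrow> nat) \<Rightarrow> nat" where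
  "beta_fact n \<beta> = (\<Prod>i\<in>{1..n}. \<Prod>j\<in>{1..<i}. fact (\<beta> i j))"

definition coeffA :: "nat \<Rightarrow> (nat \<Rightarrow> complex) \<Rightarrow> complex \<Rightarrow> (nat \<Rightarrow> nat \<Rightarrow> nat) \<Rightarrow> complex" where
  "coeffA n \<tau> \<theta> \<beta> =
     (\<Prod>s\<in>{1..n-1}. pochhammer (\<tau> s - of_nat (beta_under \<beta> s)) (beta_over n \<beta> s))
     * pochhammer (\<tau> n) (beta_under \<beta> n)
     / (of_nat (beta_fact n \<beta>) * pochhammer \<theta> (beta_under \<beta> n))"

definition hyperA :: "nat \<Rightarrow> (nat \<Rightarrow> complex) \<Rightarrow> complex \<Rightarrow> (nat \<Rightarrow> nat \<Rightarrow> mps) \<Rightarrow> mps" where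
  "hyperA n \<tau> \<theta> zz = mps_sum
     (\<lambda>\<beta>. mps_scale (coeffA n \<tau> \<theta> \<beta>)
            (mps_prod (map (\<lambda>(j,k). mps_power (zz j k) (\<beta> j k)) (pairs n))))
     (GammaA n)"

text \<open>xi^A_(r2,r1) = prod_(s=r1)^(r2-1) z_r2/(z_r2 - z_s)
   = prod_s ( -(z_r2/z_s) / (1 - z_r2/z_s) ), expanded in the ratios z_r2/z_s.\<close>
definition xiA :: "nat \<Rightarrow> nat \<Rightarrow> mps" where
  "xiA r2 r1 = mps_prod (map (\<lambda>s. mps_mult (mps_scale (-1) (mps_monom (root r2 s)))
                                             (mps_geom (root r2 s))) [r1..<r2])"

text \<open>prod_r z_r^(n-r) / prod_(k<j) (z_k - z_j) = prod_(k<j) 1/(1 - z_j/z_k).\<close>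
definition vandermonde_factor :: "nat \<Rightarrow> mps" where
  "vandermonde_factor n = mps_prod (map (\<lambda>(j,k). mps_geom (root j k)) (pairs n))"

text \<open>The right-hand side divided by prod_r z_r^lambda_r, as a power series in the q_i.\<close>
definition rhs_series :: "nat \<Rightarrow> complex \<Rightarrow> complex \<Rightarrow> mps" where
  "rhs_series n \<mu> \<sigma> = mps_mult (vandermonde_factor n)
      (hyperA n (\<lambda>s. if s < n then \<mu> + 1 else - \<mu>) (- \<sigma>) xiA)"

definition falling :: "complex \<Rightarrow> nat \<Rightarrow> complex" where
  "falling c i = (\<Prod>j<i. c - of_nat j)"

definition pbw :: "nat \<Rightarrow> (nat \<Rightarrow> nat \<Rightarrow> 'v \<Rightarrow> 'v) \<Rightarrow> (nat \<Rightarrow> nat \<Rightarrow> nat) \<Rightarrow> 'v \<Rightarrow> 'v" where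
  "pbw n E \<beta> v = foldr (\<lambda>(i,j) w. (E i j ^^ \<beta> i j) w) (pairs n) v"

definition is_verma :: "nat \<Rightarrow> (nat \<Rightarrow> complex) \<Rightarrow> (complex \<Rightarrow> 'v::ab_group_add \<Rightarrow> 'v)
    \<Rightarrow> (nat \<Rightarrow> nat \<Rightarrow> 'v \<Rightarrow> 'v) \<Rightarrow> 'v \<Rightarrow> bool" where
  "is_verma n lam scale E v \<longleftrightarrow>
     vector_space scale \<and>
     (\<forall>i\<in>{1..n}. \<forall>j\<in>{1..n}. Vector_Spaces.linear scale scale (E i j)) \<and>
     (\<forall>i\<in>{1..n}. \<forall>j\<in>{1..n}. \<forall>k\<in>{1..n}. \<forall>l\<in>{1..n}. \<forall>w.
        E i j (E k l w) - E k l (E i j w) =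
          (if j = k then E i l w else 0) - (if l = i then E k j w else 0)) \<and>
     (\<forall>i\<in>{1..n}. \<forall>j\<in>{1..n}. i < j \<longrightarrow> E i j v = 0) \<and>
     (\<forall>k\<in>{1..n}. E k k v = scale (lam k) v) \<and>
     inj_on (\<lambda>\<beta>. pbw n E \<beta> v) (GammaA n) \<and>
     \<not> module.dependent scale ((\<lambda>\<beta>. pbw n E \<beta> v) ` GammaA n) \<and>
     module.span scale ((\<lambda>\<beta>. pbw n E \<beta> v) ` GammaA n) = UNIV"

text \<open>Action of E_(i,j) on the module of formal series sum_k f(k) (x_1...x_n)^mu x^k:
  E_(i,j)(w x^m) = E_(i,j)(w) x^m + w (x_i d/dx_j - mu delta_(i,j)) x^m.\<close>
definition tilde_action :: "(complex \<Rightarrow> 'v::ab_group_add \<Rightarrow> 'v) \<Rightarrow> (nat \<Rightarrow> nat \<Rightarrow> 'v \<Rightarrow> 'v)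
    \<Rightarrow> complex \<Rightarrow> nat \<Rightarrow> nat \<Rightarrow> ((nat \<Rightarrow> int) \<Rightarrow> 'v) \<Rightarrow> ((nat \<Rightarrow> int) \<Rightarrow> 'v)" where
  "tilde_action scale E \<mu> i j f = (\<lambda>k.
     (let k' = (\<lambda>r. k r + (if r = j then 1 else 0) - (if r = i then 1 else 0)) in
      E i j (f k) + scale (of_int (k' j) + \<mu>) (f k')
        - scale (if i = j then \<mu> else 0) (f k)))"

text \<open>The singular vector u_lambda: coefficient of (x_1...x_n)^mu x^k.\<close>
definition u_vec :: "nat \<Rightarrow> (complex \<Rightarrow> 'v::ab_group_add \<Rightarrow> 'v) \<Rightarrow> (nat \<Rightarrow> nat \<Rightarrow> 'v \<Rightarrow> 'v) \<Rightarrow> 'v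
    \<Rightarrow> complex \<Rightarrow> complex \<Rightarrow> (nat \<Rightarrow> int) \<Rightarrow> 'v" where
  "u_vec n scale E v \<mu> \<sigma> k =
     (if (\<forall>r. (r < 1 \<or> n < r) \<longrightarrow> k r = 0) \<and> (\<Sum>r\<in>{1..n}. k r) = 0
         \<and> (\<forall>m\<in>{1..<n}. (\<Sum>r\<in>{1..m}. k r) \<ge> 0)
      then (let i = (\<lambda>m. nat (\<Sum>r\<in>{1..m}. k r)) in
        scale ((-1) ^ (\<Sum>m\<in>{1..<n}. i m) * falling \<mu> (i (n-1))
               / (of_nat (\<Prod>m\<in>{1..<n}. fact (i m)) * falling \<sigma> (i (n-1))))
          (foldr (\<lambda>m w. (E (m+1) m ^^ i m) w) [1..<n] v))
      else 0)"

text \<open>tr(Phi_0 restricted to M_lambda[nu]), computed in the PBW basis of the weight space.\<close>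
definition etingof_coeff :: "nat \<Rightarrow> (complex \<Rightarrow> 'v::ab_group_add \<Rightarrow> 'v) \<Rightarrow> (nat \<Rightarrow> nat \<Rightarrow> 'v \<Rightarrow> 'v)
    \<Rightarrow> 'v \<Rightarrow> ('v \<Rightarrow> (nat \<Rightarrow> int) \<Rightarrow> 'v) \<Rightarrow> (nat \<Rightarrow> complex) \<Rightarrow> complex" where
  "etingof_coeff n scale E v \<Phi> \<nu> =
     (\<Sum>\<beta>\<in>{\<beta>\<in>GammaA n. \<forall>k\<in>{1..n}. E k k (pbw n E \<beta> v) = scale (\<nu> k) (pbw n E \<beta> v)}.
        module.representation scale ((\<lambda>\<beta>. pbw n E \<beta> v) ` GammaA n)
          (\<Phi> (pbw n E \<beta> v) (\<lambda>_. 0)) (pbw n E \<beta> v))"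

end

theory Submission
  imports Defs "HOL-Library.Function_Algebras"
begin

text \<open>
  As a module over the lowering operators the Verma module is \<open>U(\<nn>\<^sub>-)\<close>, which also carries right
  multiplications \<open>R\<^sub>e\<close>.  For a formal series \<open>u\<close> let \<open>T(u)\<close> be the weight-graded trace of
  \<open>X v \<mapsto> [x\<^sup>0] (X u)\<close>.  Cyclicity of the trace gives \<open>T(R\<^sub>e u) = q\<^sub>e T(e u)\<close>, where \<open>q\<^sub>e\<close> is the weight
  of the root vector \<open>e\<close>.  Apply this to a single term of \<open>u\<^sub>\<lambda>\<close> with coefficient monomial
  \<open>E\<^sub>2\<^sub>,\<^sub>1 \<dots> E\<^sub>m\<^sub>+\<^sub>1\<^sub>,\<^sub>m v\<close> and exponent \<open>a\<close>.  Peeling off the last factor \<open>E\<^sub>m\<^sub>+\<^sub>1\<^sub>,\<^sub>m\<close>, the commutators produce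
  \<open>E\<^sub>m\<^sub>+\<^sub>1\<^sub>,\<^sub>m\<^sub>-\<^sub>1, \<dots>, E\<^sub>m\<^sub>+\<^sub>1\<^sub>,\<^sub>k\<close>, each with a factor \<open>q/(1 - q)\<close>, until some \<open>E\<^sub>m\<^sub>+\<^sub>1\<^sub>,\<^sub>k\<close> is absorbed by
  \<open>x\<^sub>m\<^sub>+\<^sub>1 \<partial>\<^sub>k\<close> acting on \<open>x\<^sup>a\<close>.  The accumulated factor is \<open>\<plusminus>\<xi>\<close>, the derivatives give the Pochhammer
  symbols, and the recursion ends at the character of \<open>U(\<nn>\<^sub>-)\<close>, which is the Vandermonde factor.
\<close>

section \<open>The ring of power series\<close>

text \<open>The answer is hypergeometric because the sum over \<open>\<beta>\<close> of fixed weight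
  \<open>d = (i_1, ..., i_(n-1))\<close> obeys the same recursion as the traces. If \<open>m\<close>
  is the last place with \<open>d m \<noteq> 0\<close>, row \<open>m + 1\<close> is the last nonzero
  row of each such \<open>\<beta>\<close> and has sum \<open>d m\<close>. Marking a unit in that row
  multiplies the sum by \<open>d m\<close>; removing the unit at \<open>(m + 1, l)\<close> lowers
  \<open>d\<close> by a root. As rows are emptied from the last one on, a removal shortens just one
  Pochhammer symbol, by the factor \<open>a_l + \<mu>\<close> that the derivative in
  \<open>x_l\<close> produces. The commutator with \<open>E_(k,k-1)^(i_(k-1))\<close> may hit any of
  its \<open>i_(k-1)\<close> factors, so absorption at \<open>k\<close> carries
  \<open>i_(m-1) ... i_k\<close>; with \<open>i_m\<close> from the marking this is the quotient of
  the products \<open>i_1! ... i_(n-1)!\<close> before and after the step, so the factorials in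
  \<open>u\<close> cancel. What remains is a quotient of falling factorials of \<open>\<mu>\<close>
  and \<open>\<sigma>\<close>, which is one of rising factorials of \<open>-\<mu>\<close> and
  \<open>-\<sigma>\<close>. Both \<open>u\<close> and the hypergeometric sum are infinite; finite
  sums appear only after one coefficient has been fixed.\<close>

typedef ps = "{f :: mps. \<forall>m. f m \<noteq> 0 \<longrightarrow> finite {i. m i \<noteq> 0}}"
  morphisms ps_nth Abs_ps
  by (rule exI[of _ "\<lambda>_. 0"]) simp

setup_lifting type_definition_ps

lemma finite_le_fun:
  fixes m :: "nat \<Rightarrow> nat"
  assumes "finite {i. m i \<noteq> 0}"
  shows "finite {f. \<forall>i. f i \<le> m i}"
proof -
  let ?S = "{i. m i \<noteq> 0}"
  have "finite {f. \<forall>i. (i \<in> ?S \<longrightarrow> f i \<in> {..Max (m ` ?S)}) \<and> (i \<notin> ?S \<longrightarrow> f i = 0)}"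
    using assms by (intro finite_set_of_finite_funs) auto
  moreover have "{f. \<forall>i. f i \<le> m i} \<subseteq>
    {f. \<forall>i. (i \<in> ?S \<longrightarrow> f i \<in> {..Max (m ` ?S)}) \<and> (i \<notin> ?S \<longrightarrow> f i = 0)}"
  proof (intro subsetI CollectI allI)
    fix f :: "nat \<Rightarrow> nat" and i
    assume "f \<in> {f. \<forall>i. f i \<le> m i}"
    then have le: "f i \<le> m i" by simp
    have "f i \<le> Max (m ` ?S)" if "i \<in> ?S"
      using le that assms by (intro order.trans[OF le Max_ge]) auto
    then show "(i \<in> ?S \<longrightarrow> f i \<in> {..Max (m ` ?S)}) \<and> (i \<notin> ?S \<longrightarrow> f i = 0)"
      using le by simp
  qed
  ultimately show ?thesis
    by (rule finite_subset[rotated])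
qed

lemma finite_splits:
  fixes m :: "nat \<Rightarrow> nat"
  assumes "finite {i. m i \<noteq> 0}"
  shows "finite {p. (\<lambda>i. fst p i + snd p i) = m}"
proof (rule finite_subset)
  show "{p. (\<lambda>i. fst p i + snd p i) = m} \<subseteq> {f. \<forall>i. f i \<le> m i} \<times> {f. \<forall>i. f i \<le> m i}"
    by auto
qed (use finite_le_fun[OF assms] in simp)

lemma mps_mult_closed:
  assumes "\<forall>m. f m \<noteq> 0 \<longrightarrow> finite {i. m i \<noteq> 0}" "\<forall>m. g m \<noteq> 0 \<longrightarrow> finite {i. m i \<noteq> 0}"
    and "mps_mult f g m \<noteq> 0"
  shows "finite {i. m i \<noteq> 0}"
proof -
  from assms(3) obtain p where p: "(\<lambda>i. fst p i + snd p i) = m" "f (fst p) * g (snd p) \<noteq> 0"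
    unfolding mps_mult_def by (auto elim: sum.not_neutral_contains_not_neutral)
  then have "finite ({i. fst p i \<noteq> 0} \<union> {i. snd p i \<noteq> 0})"
    using assms by auto
  then show ?thesis
    by (rule finite_subset[rotated]) (use p in auto)
qed

lemma mps_mult_commute: "mps_mult f g = mps_mult g f"
  unfolding mps_mult_def
  by (rule ext, rule sum.reindex_bij_witness[where i = prod.swap and j = prod.swap])
    (auto simp: add.commute mult.commute)

lemma mps_mult_assoc_at:
  assumes "finite {i. m i \<noteq> 0}"
  shows "mps_mult (mps_mult f g) h m = mps_mult f (mps_mult g h) m"
proof -
  let ?S = "\<lambda>m :: nat \<Rightarrow> nat. {p. (\<lambda>i. fst p i + snd p i) = m}"
  have sub: "finite {i. k i \<noteq> 0}" if "\<And>i. k i \<le> m i" for k :: "nat \<Rightarrow> nat"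
    by (rule finite_subset[OF _ assms]) (use that in \<open>auto, metis le_zero_eq not_gr_zero\<close>)
  have fin1: "finite (?S (fst p))" if "p \<in> ?S m" for p
    using that by (intro finite_splits sub) auto
  have fin2: "finite (?S (snd p))" if "p \<in> ?S m" for p
    using that by (intro finite_splits sub) auto
  have "mps_mult (mps_mult f g) h m =
    (\<Sum>p\<in>?S m. \<Sum>r\<in>?S (fst p). f (fst r) * g (snd r) * h (snd p))"
    by (simp add: mps_mult_def sum_distrib_right)
  also have "\<dots> = (\<Sum>(p, r)\<in>Sigma (?S m) (\<lambda>p. ?S (fst p)). f (fst r) * g (snd r) * h (snd p))"
    using fin1 by (intro sum.Sigma finite_splits assms) auto
  also have "\<dots> = (\<Sum>(p, r)\<in>Sigma (?S m) (\<lambda>p. ?S (snd p)). f (fst p) * (g (fst r) * h (snd r)))"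
    by (rule sum.reindex_bij_witness[where
          i = "\<lambda>(p, r). ((\<lambda>i. fst p i + fst r i, snd r), (fst p, fst r))" and
          j = "\<lambda>(p, r). ((fst r, \<lambda>i. snd r i + snd p i), (snd r, snd p))"])
      (auto simp: algebra_simps)
  also have "\<dots> = (\<Sum>p\<in>?S m. \<Sum>r\<in>?S (snd p). f (fst p) * (g (fst r) * h (snd r)))"
    using fin2 by (intro sum.Sigma[symmetric] finite_splits assms) auto
  also have "\<dots> = mps_mult f (mps_mult g h) m"
    by (simp add: mps_mult_def sum_distrib_left)
  finally show ?thesis .
qed

lemma mps_mult_assoc:
  assumes "\<forall>m. f m \<noteq> 0 \<longrightarrow> finite {i. m i \<noteq> 0}" "\<forall>m. g m \<noteq> 0 \<longrightarrow> finite {i. m i \<noteq> 0}"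
    "\<forall>m. h m \<noteq> 0 \<longrightarrow> finite {i. m i \<noteq> 0}"
  shows "mps_mult (mps_mult f g) h = mps_mult f (mps_mult g h)"
proof
  fix m
  have "\<forall>m. mps_mult f g m \<noteq> 0 \<longrightarrow> finite {i. m i \<noteq> 0}"
    using mps_mult_closed[OF assms(1,2)] by blast
  moreover have "\<forall>m. mps_mult g h m \<noteq> 0 \<longrightarrow> finite {i. m i \<noteq> 0}"
    using mps_mult_closed[OF assms(2,3)] by blast
  ultimately show "mps_mult (mps_mult f g) h m = mps_mult f (mps_mult g h) m"
    using mps_mult_assoc_at[of m f g h] mps_mult_closed[OF _ assms(3), of "mps_mult f g" m]
      mps_mult_closed[OF assms(1), of "mps_mult g h" m]
    by (cases "finite {i. m i \<noteq> 0}") (blast, metis)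
qed

lemma mps_mult_monom_at:
  assumes "finite {i. m i \<noteq> 0}"
  shows "mps_mult (mps_monom d) f m = (if \<forall>i. d i \<le> m i then f (\<lambda>i. m i - d i) else 0)"
proof -
  let ?S = "{p. (\<lambda>i. fst p i + snd p i) = m}"
  have "mps_mult (mps_monom d) f m = (\<Sum>p\<in>?S. if fst p = d then f (snd p) else 0)"
    by (simp add: mps_mult_def mps_monom_def if_distrib[of "\<lambda>x. x * _"] cong: if_cong)
  also have "\<dots> = (\<Sum>p\<in>?S \<inter> {p. fst p = d}. f (snd p))"
    by (rule sum.inter_restrict[symmetric, where ?B = "{p. fst p = d}", simplified] )
      (use finite_splits[OF assms] in simp)
  also have "?S \<inter> {p. fst p = d} = (if \<forall>i. d i \<le> m i then {(d, \<lambda>i. m i - d i)} else {})"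
    by (auto simp: fun_eq_iff) (metis add_diff_cancel_left', metis le_add1)
  finally show ?thesis by (auto split: if_splits)
qed

lemma mps_one_eq_monom: "mps_one = mps_monom (\<lambda>_. 0)"
  by (simp add: mps_one_def mps_monom_def)

text \<open>The restriction to finitely supported exponents is what gives a ring: at an infinitely
  supported exponent the splittings form an infinite set, the sum in \<open>mps_mult\<close>
  defaults to 0, and \<open>mps_one\<close> would not be a unit.\<close>

instantiation ps :: comm_ring_1
begin

lift_definition zero_ps :: ps is "\<lambda>_. 0" by simp
lift_definition one_ps :: ps is mps_one by (simp add: mps_one_def split: if_splits)
lift_definition plus_ps :: "ps \<Rightarrow> ps \<Rightarrow> ps" is "\<lambda>f g m. f m + g m"
  by (metis add_cancel_left_left)
lift_definition minus_ps :: "ps \<Rightarrow> ps \<Rightarrow> ps" is "\<lambda>f g m. f m - g m"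
  by (metis diff_self)
lift_definition uminus_ps :: "ps \<Rightarrow> ps" is "\<lambda>f m. - f m" by simp
lift_definition times_ps :: "ps \<Rightarrow> ps \<Rightarrow> ps" is mps_mult
  using mps_mult_closed by blast

instance
proof
  fix a b c :: ps
  show "a * b * c = a * (b * c)" by transfer (rule mps_mult_assoc)
  show "a * b = b * a" by transfer (rule mps_mult_commute)
  show "1 * a = a"
  proof (transfer, rule ext)
    fix a :: mps and m
    assume a: "\<forall>m. a m \<noteq> 0 \<longrightarrow> finite {i. m i \<noteq> 0}"
    have one: "\<forall>m. mps_one m \<noteq> 0 \<longrightarrow> finite {i. m i \<noteq> 0}"
      by (simp add: mps_one_def)
    show "mps_mult mps_one a m = a m"
    proof (cases "finite {i. m i \<noteq> 0}")
      case True
      then show ?thesis by (simp add: mps_one_eq_monom mps_mult_monom_at)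
    next
      case False
      then show ?thesis using mps_mult_closed[OF one a, of m] a by metis
    qed
  qed
  show "(a + b) * c = a * c + b * c"
    by transfer (simp add: mps_mult_def sum.distrib distrib_right fun_eq_iff)
  show "(0 :: ps) \<noteq> 1" by transfer (auto simp: mps_one_def fun_eq_iff)
qed (transfer; simp add: algebra_simps fun_eq_iff)+

end

lemma ps_nth_infinite: "infinite {i. m i \<noteq> 0} \<Longrightarrow> ps_nth f m = 0"
  using ps_nth[of f] by auto

lemma ps_eqI: "(\<And>m. finite {i. m i \<noteq> 0} \<Longrightarrow> ps_nth f m = ps_nth g m) \<Longrightarrow> f = g"
  by (metis ext ps_nth_infinite ps_nth_inject)

lemma ps_nth_sum: "ps_nth (\<Sum>x\<in>A. f x) m = (\<Sum>x\<in>A. ps_nth (f x) m)"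
  by (induction A rule: infinite_finite_induct) (simp_all add: zero_ps.rep_eq plus_ps.rep_eq)

section \<open>Constants, monomials and geometric series in the ring\<close>

lift_definition ps_const :: "complex \<Rightarrow> ps" is "\<lambda>c. mps_scale c mps_one"
  by (simp add: mps_scale_def mps_one_def split: if_splits)

text \<open>Junk outside finitely supported exponents: there the monomial is set to 0.\<close>

lift_definition ps_monom :: "(nat \<Rightarrow> nat) \<Rightarrow> ps" is
  "\<lambda>d. if finite {i. d i \<noteq> 0} then mps_monom d else (\<lambda>_. 0)"
  by (auto simp: mps_monom_def split: if_splits)

lemma ps_nth_monom_mult:
  assumes "finite {i. d i \<noteq> 0}"
  shows "ps_nth (ps_monom d * f) m = (if \<forall>i. d i \<le> m i then ps_nth f (\<lambda>i. m i - d i) else 0)"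
proof (cases "finite {i. m i \<noteq> 0}")
  case True
  then show ?thesis using assms by (simp add: times_ps.rep_eq ps_monom.rep_eq mps_mult_monom_at)
next
  case False
  have "infinite {i. m i - d i \<noteq> 0}"
  proof
    assume "finite {i. m i - d i \<noteq> 0}"
    then have "finite ({i. m i - d i \<noteq> 0} \<union> {i. d i \<noteq> 0})" using assms by simp
    then have "finite {i. m i \<noteq> 0}" by (rule finite_subset[rotated]) auto
    then show False using False by simp
  qed
  then show ?thesis using False by (simp add: ps_nth_infinite)
qed

lemma ps_nth_const_mult: "ps_nth (ps_const c * f) m = c * ps_nth f m"
proof (cases "finite {i. m i \<noteq> 0}")
  case True
  have "mps_mult (mps_scale c mps_one) (ps_nth f) m = c * mps_mult mps_one (ps_nth f) m"
    by (simp add: mps_mult_def mps_scale_def sum_distrib_left mult.assoc)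
  then show ?thesis using True
    by (simp add: times_ps.rep_eq ps_const.rep_eq mps_one_eq_monom mps_mult_monom_at)
qed (simp add: ps_nth_infinite)

lemma ps_const_mult: "ps_const (a * b) = ps_const a * ps_const b"
  by (rule ps_eqI) (simp add: ps_nth_const_mult, simp add: ps_const.rep_eq mps_scale_def)

lemma ps_const_add: "ps_const (a + b) = ps_const a + ps_const b"
  by transfer (simp add: mps_scale_def distrib_right)

lemma ps_const_0 [simp]: "ps_const 0 = 0"
  by transfer (simp add: mps_scale_def)

lemma ps_const_1 [simp]: "ps_const 1 = 1"
  by transfer (simp add: mps_scale_def)

lemma ps_const_sum: "ps_const (\<Sum>x\<in>A. f x) = (\<Sum>x\<in>A. ps_const (f x))"
  by (induction A rule: infinite_finite_induct) (simp_all add: ps_const_add)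

lemma ps_const_minus_one_power: "ps_const ((-1) ^ k) = (-1) ^ k"
proof (induction k)
  case (Suc k)
  have "ps_const (-1) = -1"
    using ps_const_add[of "-1" 1] by (simp add: eq_neg_iff_add_eq_0)
  with Suc show ?case by (simp only: power_Suc ps_const_mult)
qed simp

lift_definition ps_geom :: "(nat \<Rightarrow> nat) \<Rightarrow> ps" is
  "\<lambda>d. if finite {i. d i \<noteq> 0} then mps_geom d else (\<lambda>_. 0)"
proof -
  fix d m :: "nat \<Rightarrow> nat"
  assume "(if finite {i. d i \<noteq> 0} then mps_geom d else (\<lambda>_. 0)) m \<noteq> 0"
  then have fin: "finite {i. d i \<noteq> 0}" and
    "(\<Sum>k | mps_monom (\<lambda>i. k * d i) m \<noteq> 0. mps_monom (\<lambda>i. k * d i) m) \<noteq> 0"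
    by (auto simp: mps_geom_def mps_sum_def split: if_splits)
  then obtain k where "mps_monom (\<lambda>i. k * d i) m \<noteq> 0"
    using sum.not_neutral_contains_not_neutral by blast
  then have "m = (\<lambda>i. k * d i)" by (auto simp: mps_monom_def split: if_splits)
  then show "finite {i. m i \<noteq> 0}"
    by (auto intro: finite_subset[OF _ fin])
qed

text \<open>A nonzero entry of \<open>d\<close> determines \<open>k\<close> from the exponent. For
  \<open>d = 0\<close> the coefficient at 0 would be a sum over infinitely many \<open>k\<close>,
  which defaults to 0.\<close>

lemma mps_geom_eq:
  assumes "d i \<noteq> 0"
  shows "mps_geom d m = (if \<exists>k. m = (\<lambda>i. k * d i) then 1 else 0)"
proof (cases "\<exists>k. m = (\<lambda>i. k * d i)")
  case True
  then obtain k where k: "m = (\<lambda>i. k * d i)" by blast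
  have uniq: "(m = (\<lambda>i. k' * d i)) = (k' = k)" for k'
    using assms k by (auto simp: fun_eq_iff)
  then show ?thesis using True by (simp add: mps_geom_def mps_sum_def mps_monom_def)
qed (simp add: mps_geom_def mps_sum_def mps_monom_def)

lemma ps_geom_unfold:
  assumes "d i \<noteq> 0" "finite {i. d i \<noteq> 0}"
  shows "ps_geom d = 1 + ps_monom d * ps_geom d"
proof (rule ps_eqI)
  fix m :: "nat \<Rightarrow> nat"
  have "(\<exists>k. m = (\<lambda>i. k * d i)) \<longleftrightarrow>
      m = (\<lambda>_. 0) \<or> (\<forall>i. d i \<le> m i) \<and> (\<exists>k. (\<lambda>i. m i - d i) = (\<lambda>i. k * d i))" (is "?L \<longleftrightarrow> ?R")
  proof
    assume ?L
    then obtain k where k: "m = (\<lambda>i. k * d i)" by blast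
    show ?R
    proof (cases k)
      case (Suc l)
      then have "(\<lambda>i. m i - d i) = (\<lambda>i. l * d i)" "\<forall>i. d i \<le> m i" using k by auto
      then show ?R by blast
    qed (use k in simp)
  next
    assume ?R
    then show ?L
    proof
      assume "m = (\<lambda>_. 0)"
      then have "m = (\<lambda>i. 0 * d i)" by simp
      then show ?L by blast
    next
      assume *: "(\<forall>i. d i \<le> m i) \<and> (\<exists>k. (\<lambda>i. m i - d i) = (\<lambda>i. k * d i))"
      then obtain k where "\<And>i. m i - d i = k * d i" by metis
      with * have "m = (\<lambda>i. Suc k * d i)"
        by (auto simp: fun_eq_iff) (metis le_add_diff_inverse)
      then show ?L by blast
    qed
  qed
  moreover have "m \<noteq> (\<lambda>_. 0)" if "\<forall>i. d i \<le> m i"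
    using that[rule_format, of i] assms(1) by (metis le_zero_eq)
  ultimately show "ps_nth (ps_geom d) m = ps_nth (1 + ps_monom d * ps_geom d) m"
    using assms
    by (auto simp: ps_geom.rep_eq plus_ps.rep_eq one_ps.rep_eq ps_nth_monom_mult mps_geom_eq[where d = d and i = i]
        mps_one_def)
qed

text \<open>\<open>1 - ps_monom d\<close> is invertible with inverse \<open>ps_geom d\<close>. Every
  geometric factor below arises by solving such a fixed-point equation, for traces as well as for
  counting PBW monomials.\<close>

lemma ps_geom_solve:
  assumes "d i \<noteq> 0" "finite {i. d i \<noteq> 0}" and "f = ps_monom d * f + g"
  shows "f = ps_geom d * g"
proof -
  have "ps_geom d - ps_monom d * ps_geom d = 1"
    using ps_geom_unfold[OF assms(1,2)] by (metis add_diff_cancel_right')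
  then have "ps_geom d * (1 - ps_monom d) = 1"
    by (simp add: right_diff_distrib mult.commute)
  moreover have "(1 - ps_monom d) * f = g"
  proof -
    have "(1 - ps_monom d) * f = f - ps_monom d * f" by (simp add: left_diff_distrib)
    moreover have "f - ps_monom d * f = g" using assms(3) by (metis add_diff_cancel_left')
    ultimately show ?thesis by simp
  qed
  then have "ps_geom d * g = ps_geom d * (1 - ps_monom d) * f" by (simp add: mult.assoc)
  ultimately show ?thesis by simp
qed

lemma mps_prod_eq_ps_nth: "mps_prod (map (\<lambda>x. ps_nth (f x)) xs) = ps_nth (prod_list (map f xs))"
  by (induction xs) (simp_all add: mps_prod_def one_ps.rep_eq times_ps.rep_eq)

lemma mps_power_eq_ps_nth: "mps_power (ps_nth f) k = ps_nth (f ^ k)"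
  by (induction k) (simp_all add: mps_power_def one_ps.rep_eq times_ps.rep_eq)

section \<open>Normal ordering of lowering operators\<close>

definition incr :: "nat \<Rightarrow> nat \<Rightarrow> (nat \<Rightarrow> nat \<Rightarrow> nat) \<Rightarrow> nat \<Rightarrow> nat \<Rightarrow> nat" where
  "incr i j \<beta> = \<beta>(i := (\<beta> i)(j := \<beta> i j + 1))"

text \<open>An entry 0 is left unchanged by the truncated subtraction; wherever this can occur
  below, the term carries that entry as a factor.\<close>

definition decr :: "nat \<Rightarrow> nat \<Rightarrow> (nat \<Rightarrow> nat \<Rightarrow> nat) \<Rightarrow> nat \<Rightarrow> nat \<Rightarrow> nat" where
  "decr i j \<beta> = \<beta>(i := (\<beta> i)(j := \<beta> i j - 1))"

lemma decr_incr [simp]: "decr i j (incr i j \<beta>) = \<beta>"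
  by (simp add: incr_def decr_def)

lemma incr_decr: "\<beta> i j \<noteq> 0 \<Longrightarrow> incr i j (decr i j \<beta>) = \<beta>"
  by (simp add: incr_def decr_def)

lemma funpow_commute_at:
  assumes "\<And>w. A (F w) = F (A w)"
  shows "A ((F ^^ c) w) = (F ^^ c) (A w)"
  by (induction c) (simp_all add: assms)

lemma foldr_funpow_commute:
  assumes "\<And>x w. x \<in> set xs \<Longrightarrow> A (F x w) = F x (A w)"
  shows "A (foldr (\<lambda>x. F x ^^ c x) xs w) = foldr (\<lambda>x. F x ^^ c x) xs (A w)"
  using assms by (induction xs) (simp_all add: funpow_commute_at[of A])

lemma foldr_funpow_cong:
  "(\<And>x. x \<in> set xs \<Longrightarrow> c x = c' x) \<Longrightarrow>
    foldr (\<lambda>x. F x ^^ c x) xs w = foldr (\<lambda>x. F x ^^ c' x) xs w"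
  by (induction xs) simp_all

lemma foldr_funpow_absorb:
  assumes "\<And>x y w. x \<in> set xs \<Longrightarrow> y \<in> set xs \<Longrightarrow> F x (F y w) = F y (F x w)"
    and "distinct xs" "x \<in> set xs"
  shows "F x (foldr (\<lambda>x. F x ^^ c x) xs w) = foldr (\<lambda>y. F y ^^ (c(x := c x + 1)) y) xs w"
  using assms
proof (induction xs)
  case (Cons y ys)
  show ?case
  proof (cases "x = y")
    case True
    with Cons.prems have "foldr (\<lambda>y. F y ^^ (c(x := c x + 1)) y) ys w = foldr (\<lambda>x. F x ^^ c x) ys w"
      by (intro foldr_funpow_cong) auto
    then show ?thesis using True by simp
  next
    case False
    with Cons show ?thesis by (simp add: funpow_commute_at[of "F x" "F y"])
  qed
qed simp

section \<open>Leibniz rules for products of powers of operators\<close>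

context vector_space
begin

lemma funpow_add_at:
  fixes F :: "'b \<Rightarrow> 'b"
  assumes "\<And>x y. F (x + y) = F x + F y"
  shows "(F ^^ c) (x + y) = (F ^^ c) x + (F ^^ c) y"
  by (induction c) (simp_all add: assms)

lemma funpow_scale_at:
  assumes "\<And>a x. F (scale a x) = scale a (F x)"
  shows "(F ^^ c) (scale a x) = scale a ((F ^^ c) x)"
  by (induction c) (simp_all add: assms)

lemma foldr_funpow_add:
  fixes F :: "'c \<Rightarrow> 'b \<Rightarrow> 'b"
  assumes "\<And>y a b. y \<in> set xs \<Longrightarrow> F y (a + b) = F y a + F y b"
  shows "foldr (\<lambda>x. F x ^^ c x) xs (a + b) = foldr (\<lambda>x. F x ^^ c x) xs a + foldr (\<lambda>x. F x ^^ c x) xs b"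
  using assms by (induction xs) (simp_all add: funpow_add_at)

lemma foldr_funpow_scale:
  assumes "\<And>y a b. y \<in> set xs \<Longrightarrow> F y (scale a b) = scale a (F y b)"
  shows "foldr (\<lambda>x. F x ^^ c x) xs (scale a b) = scale a (foldr (\<lambda>x. F x ^^ c x) xs b)"
  using assms by (induction xs) (simp_all add: funpow_scale_at)

lemma additive_sum_scale:
  assumes "\<And>x y. F (x + y) = F x + F y" "\<And>a x. F (scale a x) = scale a (F x)"
  shows "F (\<Sum>x\<in>I. scale (a x) (f x)) = (\<Sum>x\<in>I. scale (a x) (F (f x)))"
proof -
  have "F 0 = 0" using assms(1)[of 0 0] by simp
  then show ?thesis
    by (induction I rule: infinite_finite_induct) (simp_all add: assms)
qed

lemma funpow_derivation:
  assumes "\<And>w. A (F w) = F (A w) + B w" "\<And>w. B (F w) = F (B w)"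
    and "\<And>x y. F (x + y) = F x + F y" "\<And>a x. F (scale a x) = scale a (F x)"
  shows "A ((F ^^ c) w) = (F ^^ c) (A w) + scale (of_nat c) ((F ^^ (c - 1)) (B w))"
proof (induction c)
  case (Suc c)
  have "A ((F ^^ Suc c) w) = F ((F ^^ c) (A w)) + scale (of_nat c) (F ((F ^^ (c - 1)) (B w))) + (F ^^ c) (B w)"
    using Suc assms funpow_commute_at[of B F] by simp
  also have "scale (of_nat c) (F ((F ^^ (c - 1)) (B w))) = scale (of_nat c) ((F ^^ c) (B w))"
    by (cases c) simp_all
  finally show ?case by (simp add: scale_left_distrib add_ac)
qed simp

text \<open>Each commutator \<open>B x\<close> commutes with all the factors, so it moves to the
  right end at once and no second-order commutators arise.\<close>

lemma foldr_funpow_derivation: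
  assumes "\<And>y w. y \<in> set xs \<Longrightarrow> A (F y w) = F y (A w) + B y w"
    and "\<And>x y w. x \<in> set xs \<Longrightarrow> y \<in> set xs \<Longrightarrow> B x (F y w) = F y (B x w)"
    and "\<And>y a b. y \<in> set xs \<Longrightarrow> F y (a + b) = F y a + F y b"
    and "\<And>y a b. y \<in> set xs \<Longrightarrow> F y (scale a b) = scale a (F y b)"
    and "distinct xs"
  shows "A (foldr (\<lambda>x. F x ^^ c x) xs w) = foldr (\<lambda>x. F x ^^ c x) xs (A w) +
     (\<Sum>x\<in>set xs. scale (of_nat (c x)) (foldr (\<lambda>y. F y ^^ (c(x := c x - 1)) y) xs (B x w)))"
  using assms
proof (induction xs)
  case (Cons z xs)
  let ?f = "\<lambda>c w. foldr (\<lambda>x. F x ^^ c x) xs w"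
  let ?w = "?f c w"
  have "A (foldr (\<lambda>x. F x ^^ c x) (z # xs) w) =
      (F z ^^ c z) (A ?w) + scale (of_nat (c z)) ((F z ^^ (c z - 1)) (B z ?w))"
    using Cons.prems by (simp add: funpow_derivation[of A "F z" "B z"])
  also have "A ?w = ?f c (A w) + (\<Sum>x\<in>set xs. scale (of_nat (c x)) (?f (c(x := c x - 1)) (B x w)))"
    using Cons.prems by (intro Cons.IH) auto
  also have "(F z ^^ c z) \<dots> = (F z ^^ c z) (?f c (A w)) +
      (\<Sum>x\<in>set xs. scale (of_nat (c x)) ((F z ^^ c z) (?f (c(x := c x - 1)) (B x w))))"
    using Cons.prems by (simp add: funpow_add_at funpow_scale_at additive_sum_scale[of "F z ^^ c z"])
  also have "B z ?w = ?f c (B z w)"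
    using Cons.prems by (intro foldr_funpow_commute) auto
  also have "\<dots> = ?f (c(z := c z - 1)) (B z w)"
    using Cons.prems by (intro foldr_funpow_cong) auto
  also have "(\<Sum>x\<in>set xs. scale (of_nat (c x)) ((F z ^^ c z) (?f (c(x := c x - 1)) (B x w)))) =
     (\<Sum>x\<in>set xs. scale (of_nat (c x)) (foldr (\<lambda>y. F y ^^ (c(x := c x - 1)) y) (z # xs) (B x w)))"
    using Cons.prems by (intro sum.cong) auto
  finally show ?case using Cons.prems by (simp add: add_ac)
qed simp

end

text \<open>Lowering operators with the same first index commute, so only exchanges between
  different rows produce commutators. In \<open>pbw\<close>, row \<open>n\<close> stands rightmost
  and acts first.\<close>

definition pbw_row :: "(nat \<Rightarrow> nat \<Rightarrow> 'v \<Rightarrow> 'v) \<Rightarrow> (nat \<Rightarrow> nat \<Rightarrow> nat) \<Rightarrow> nat \<Rightarrow> 'v \<Rightarrow> 'v" where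
  "pbw_row E \<beta> r w = foldr (\<lambda>j. E r j ^^ \<beta> r j) [1..<r] w"

lemma pairs_0: "pairs 0 = []"
  by (simp add: pairs_def)

lemma pairs_Suc: "pairs (Suc m) = pairs m @ map (\<lambda>j. (Suc m, j)) [1..<Suc m]"
  by (cases "m = 0") (simp_all add: pairs_def)

lemma set_pairs: "set (pairs n) = {(i, j). 1 \<le> j \<and> j < i \<and> i \<le> n}"
  by (auto simp: pairs_def image_iff)

lemma distinct_pairs: "distinct (pairs n)"
  by (induction n) (auto simp: pairs_0 pairs_Suc distinct_map inj_on_def set_pairs)

lemma pbw_0: "pbw 0 E \<beta> w = w"
  by (simp add: pbw_def pairs_0)

lemma pbw_Suc: "pbw (Suc m) E \<beta> w = pbw m E \<beta> (pbw_row E \<beta> (Suc m) w)"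
  by (simp add: pbw_def pairs_Suc pbw_row_def foldr_map comp_def del: upt_Suc)

lemma pbw_row_cong:
  "(\<And>j. 1 \<le> j \<Longrightarrow> j < r \<Longrightarrow> \<beta> r j = \<beta>' r j) \<Longrightarrow> pbw_row E \<beta> r w = pbw_row E \<beta>' r w"
  unfolding pbw_row_def by (rule foldr_funpow_cong) simp

lemma pbw_cong:
  "(\<And>i j. 1 \<le> j \<Longrightarrow> j < i \<Longrightarrow> i \<le> m \<Longrightarrow> \<beta> i j = \<beta>' i j) \<Longrightarrow> pbw m E \<beta> w = pbw m E \<beta>' w"
proof (induction m arbitrary: w)
  case (Suc m)
  then have "pbw_row E \<beta> (Suc m) w = pbw_row E \<beta>' (Suc m) w"
    by (intro pbw_row_cong) auto
  with Suc show ?case by (simp add: pbw_Suc)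
qed (simp add: pbw_0)

lemma pbw_incr_above: "m < i \<Longrightarrow> pbw m E (incr i j \<beta>) w = pbw m E \<beta> w"
  by (rule pbw_cong) (auto simp: incr_def)

lemma pbw_decr_above: "m < i \<Longrightarrow> pbw m E (decr i j \<beta>) w = pbw m E \<beta> w"
  by (rule pbw_cong) (auto simp: decr_def)

lemma pbw_row_incr_other: "r \<noteq> i \<Longrightarrow> pbw_row E (incr i j \<beta>) r w = pbw_row E \<beta> r w"
  by (rule pbw_row_cong) (auto simp: incr_def)

lemma pbw_row_decr_other: "r \<noteq> i \<Longrightarrow> pbw_row E (decr i j \<beta>) r w = pbw_row E \<beta> r w"
  by (rule pbw_row_cong) (auto simp: decr_def)

text \<open>Only the relations among lowering operators are assumed, because normal ordering is
  needed twice: in the Verma module and, with the same coefficients, in the module of formal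
  series.\<close>

locale lowering = vector_space scale for scale :: "complex \<Rightarrow> 'w::ab_group_add \<Rightarrow> 'w" +
  fixes n :: nat and E :: "nat \<Rightarrow> nat \<Rightarrow> 'w \<Rightarrow> 'w"
  assumes E_add: "1 \<le> j \<Longrightarrow> j < i \<Longrightarrow> i \<le> n \<Longrightarrow> E i j (x + y) = E i j x + E i j y"
    and E_scale: "1 \<le> j \<Longrightarrow> j < i \<Longrightarrow> i \<le> n \<Longrightarrow> E i j (scale a x) = scale a (E i j x)"
    and E_comm: "1 \<le> j \<Longrightarrow> j < i \<Longrightarrow> i \<le> n \<Longrightarrow> 1 \<le> l \<Longrightarrow> l < k \<Longrightarrow> k \<le> n \<Longrightarrow>
      E i j (E k l w) - E k l (E i j w) = (if j = k then E i l w else 0) - (if l = i then E k j w else 0)"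
begin

lemma E_commute:
  assumes "1 \<le> j" "j < i" "i \<le> n" "1 \<le> l" "l < k" "k \<le> n" "j \<noteq> k" "l \<noteq> i"
  shows "E i j (E k l w) = E k l (E i j w)"
  using E_comm[of j i l k w] assms by simp

lemma row_add: "r \<le> n \<Longrightarrow> pbw_row E \<beta> r (x + y) = pbw_row E \<beta> r x + pbw_row E \<beta> r y"
  unfolding pbw_row_def by (rule foldr_funpow_add) (simp add: E_add)

lemma row_scale: "r \<le> n \<Longrightarrow> pbw_row E \<beta> r (scale a x) = scale a (pbw_row E \<beta> r x)"
  unfolding pbw_row_def by (rule foldr_funpow_scale) (simp add: E_scale)

lemma pbw_add: "m \<le> n \<Longrightarrow> pbw m E \<beta> (x + y) = pbw m E \<beta> x + pbw m E \<beta> y"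
  by (induction m arbitrary: x y) (simp_all add: pbw_0 pbw_Suc row_add)

lemma pbw_scale: "m \<le> n \<Longrightarrow> pbw m E \<beta> (scale a x) = scale a (pbw m E \<beta> x)"
  by (induction m arbitrary: x) (simp_all add: pbw_0 pbw_Suc row_scale)

lemma pbw_sum_scale:
  "m \<le> n \<Longrightarrow> pbw m E \<beta> (\<Sum>x\<in>I. scale (a x) (f x)) = (\<Sum>x\<in>I. scale (a x) (pbw m E \<beta> (f x)))"
  by (rule additive_sum_scale) (simp_all add: pbw_add pbw_scale)

lemma row_commute:
  assumes "1 \<le> j" "j < i" "i \<le> n" "r \<le> n" "r \<noteq> j" "r \<le> i"
  shows "E i j (pbw_row E \<beta> r w) = pbw_row E \<beta> r (E i j w)"
  unfolding pbw_row_def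
  by (rule foldr_funpow_commute) (use assms in \<open>auto intro!: E_commute\<close>)

lemma row_incr:
  assumes "1 \<le> j" "j < r" "r \<le> n"
  shows "E r j (pbw_row E \<beta> r w) = pbw_row E (incr r j \<beta>) r w"
proof -
  have "E r j (pbw_row E \<beta> r w) = foldr (\<lambda>y. E r y ^^ ((\<beta> r)(j := \<beta> r j + 1)) y) [1..<r] w"
    unfolding pbw_row_def
    by (rule foldr_funpow_absorb) (use assms in \<open>auto intro!: E_commute\<close>)
  then show ?thesis by (simp add: pbw_row_def incr_def)
qed

text \<open>\<open>[E_(i,j), E_(j,k)] = E_(i,k)\<close>, and \<open>E_(i,k)\<close> commutes with
  the whole row \<open>j\<close>.\<close>

lemma row_left:
  assumes "1 \<le> j" "j < i" "i \<le> n"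
  shows "E i j (pbw_row E \<beta> j w) = pbw_row E \<beta> j (E i j w) +
    (\<Sum>k\<in>{1..<j}. scale (of_nat (\<beta> j k)) (pbw_row E (decr j k \<beta>) j (E i k w)))"
proof -
  have "E i j (pbw_row E \<beta> j w) = pbw_row E \<beta> j (E i j w) +
    (\<Sum>k\<in>set [1..<j]. scale (of_nat (\<beta> j k))
      (foldr (\<lambda>y. E j y ^^ ((\<beta> j)(k := \<beta> j k - 1)) y) [1..<j] (E i k w)))"
    unfolding pbw_row_def
  proof (rule foldr_funpow_derivation)
    show "E i j (E j y w) = E j y (E i j w) + E i y w" if "y \<in> set [1..<j]" for y w
      using E_comm[of j i y j w] assms that by (simp add: algebra_simps)
  qed (use assms in \<open>auto intro!: E_commute simp: E_add E_scale\<close>)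
  then show ?thesis by (simp add: pbw_row_def decr_def)
qed

text \<open>\<open>[E_(r,i), E_(i,j)] = E_(r,j)\<close>: on its way to the left through row
  \<open>r\<close>, \<open>E_(i,j)\<close> can trade a factor \<open>E_(r,i)\<close> for
  \<open>E_(r,j)\<close>, which belongs to the same row.\<close>

lemma row_right:
  assumes "1 \<le> j" "j < i" "i < r" "r \<le> n"
  shows "pbw_row E \<beta> r (E i j w) = E i j (pbw_row E \<beta> r w) +
    scale (of_nat (\<beta> r i)) (pbw_row E (incr r j (decr r i \<beta>)) r w)"
proof -
  have neg: "E k l (- x) = - E k l x" if "1 \<le> l" "l < k" "k \<le> n" for k l x
    using E_scale[OF that, of "-1" x] by simp
  have zero: "E k l 0 = 0" if "1 \<le> l" "l < k" "k \<le> n" for k l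
    using E_scale[OF that, of 0 0] by simp
  have "E i j (pbw_row E \<beta> r w) = pbw_row E \<beta> r (E i j w) +
    (\<Sum>k\<in>set [1..<r]. scale (of_nat (\<beta> r k))
      (foldr (\<lambda>y. E r y ^^ ((\<beta> r)(k := \<beta> r k - 1)) y) [1..<r] (if k = i then - E r j w else 0)))"
    unfolding pbw_row_def
  proof (rule foldr_funpow_derivation)
    show "E i j (E r y w) = E r y (E i j w) + (if y = i then - E r j w else 0)" if "y \<in> set [1..<r]" for y w
      using E_comm[of j i y r w] assms that by (simp add: algebra_simps split: if_splits)
  qed (use assms in \<open>auto intro!: E_commute simp: E_add E_scale neg zero\<close>)
  also have "\<dots> = pbw_row E \<beta> r (E i j w) +
    (\<Sum>k\<in>set [1..<r]. if k = i then scale (of_nat (\<beta> r i)) (pbw_row E (decr r i \<beta>) r (- E r j w)) else 0)"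
  proof -
    have "pbw_row E \<gamma> r 0 = 0" for \<gamma>
      using row_scale[of r \<gamma> 0 0] assms by simp
    moreover have "foldr (\<lambda>y. E r y ^^ ((\<beta> r)(k := \<beta> r k - 1)) y) [1..<r] x = pbw_row E (decr r k \<beta>) r x" for k x
      by (simp add: pbw_row_def decr_def)
    ultimately show ?thesis
      by (intro arg_cong2[of _ _ _ _ "(+)"] sum.cong refl) auto
  qed
  also have "\<dots> = pbw_row E \<beta> r (E i j w) + scale (of_nat (\<beta> r i)) (pbw_row E (decr r i \<beta>) r (- E r j w))"
    using assms by (simp add: sum.delta)
  also have "pbw_row E (decr r i \<beta>) r (- E r j w) = - pbw_row E (incr r j (decr r i \<beta>)) r w"
    using row_scale[of r "decr r i \<beta>" "-1" "E r j w"] row_commute[of j r r "decr r i \<beta>" w]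
      row_incr[of j r "decr r i \<beta>" w] assms by simp
  finally show ?thesis by simp
qed

lemma pbw_left_below:
  assumes "1 \<le> j" "j < i" "i \<le> n" "m < j"
  shows "E i j (pbw m E \<beta> w) = pbw m E \<beta> (E i j w)"
  using \<open>m < j\<close>
proof (induction m arbitrary: w)
  case (Suc m)
  have "E i j (pbw_row E \<beta> (Suc m) w) = pbw_row E \<beta> (Suc m) (E i j w)"
    using assms Suc.prems by (intro row_commute) auto
  then show ?case using Suc by (simp add: pbw_Suc)
qed (simp add: pbw_0)

lemma pbw_left_between:
  assumes "1 \<le> j" "j < i" "i \<le> n" "j \<le> m" "m < i"
  shows "E i j (pbw m E \<beta> w) = pbw m E \<beta> (E i j w) +
    (\<Sum>k\<in>{1..<j}. scale (of_nat (\<beta> j k)) (pbw m E (decr j k \<beta>) (E i k w)))"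
  using \<open>j \<le> m\<close> \<open>m < i\<close>
proof (induction m arbitrary: w rule: nat_induct_at_least)
  case base
  obtain j' where j': "j = Suc j'" using assms by (cases j) auto
  then have j'_le: "j' \<le> n" using assms by simp
  have *: "pbw j' E (decr j k \<beta>) x = pbw j' E \<beta> x" for k x
    by (rule pbw_decr_above) (simp add: j')
  have "E i j (pbw j E \<beta> w) = pbw j' E \<beta> (E i j (pbw_row E \<beta> j w))"
    using assms j' by (simp add: pbw_Suc pbw_left_below)
  also have "\<dots> = pbw j' E \<beta> (pbw_row E \<beta> j (E i j w)) +
     (\<Sum>k\<in>{1..<j}. scale (of_nat (\<beta> j k)) (pbw j' E \<beta> (pbw_row E (decr j k \<beta>) j (E i k w))))"
    using assms j'_le by (simp add: row_left pbw_add pbw_sum_scale)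
  finally show ?case by (simp add: j' pbw_Suc * [unfolded j'])
next
  case (Suc m)
  have comm: "E i k (pbw_row E \<beta> (Suc m) w) = pbw_row E \<beta> (Suc m) (E i k w)" if "1 \<le> k" "k \<le> j" for k
    using assms Suc.prems Suc.hyps that by (intro row_commute) auto
  have "E i j (pbw (Suc m) E \<beta> w) = pbw m E \<beta> (E i j (pbw_row E \<beta> (Suc m) w)) +
    (\<Sum>k\<in>{1..<j}. scale (of_nat (\<beta> j k)) (pbw m E (decr j k \<beta>) (E i k (pbw_row E \<beta> (Suc m) w))))"
    using Suc by (simp add: pbw_Suc)
  then show ?case using Suc.hyps assms
    by (simp add: pbw_Suc comm pbw_row_decr_other)
qed

text \<open>Coming from the left, \<open>E_(i,j)\<close> meets a nontrivial commutator only in row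
  \<open>j\<close>. It and the resulting \<open>E_(i,k)\<close> then pass all rows up to
  \<open>i\<close> and are absorbed there.\<close>

lemma pbw_left_from:
  assumes "1 \<le> j" "j < i" "i \<le> n" "i \<le> m" "m \<le> n"
  shows "E i j (pbw m E \<beta> w) = pbw m E (incr i j \<beta>) w +
    (\<Sum>k\<in>{1..<j}. scale (of_nat (\<beta> j k)) (pbw m E (incr i k (decr j k \<beta>)) w))"
  using \<open>i \<le> m\<close> \<open>m \<le> n\<close>
proof (induction m arbitrary: w rule: nat_induct_at_least)
  case base
  obtain i' where i': "i = Suc i'" using assms by (cases i) auto
  have "E i j (pbw i E \<beta> w) = pbw i' E \<beta> (E i j (pbw_row E \<beta> i w)) +
    (\<Sum>k\<in>{1..<j}. scale (of_nat (\<beta> j k)) (pbw i' E (decr j k \<beta>) (E i k (pbw_row E \<beta> i w))))"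
    using assms i' by (simp add: pbw_Suc pbw_left_between)
  also have "\<dots> = pbw i E (incr i j \<beta>) w +
    (\<Sum>k\<in>{1..<j}. scale (of_nat (\<beta> j k)) (pbw i' E (decr j k \<beta>) (pbw_row E (incr i k \<beta>) i w)))"
    using assms i' by (simp add: row_incr pbw_Suc pbw_incr_above)
  also have "(\<Sum>k\<in>{1..<j}. scale (of_nat (\<beta> j k)) (pbw i' E (decr j k \<beta>) (pbw_row E (incr i k \<beta>) i w))) =
    (\<Sum>k\<in>{1..<j}. scale (of_nat (\<beta> j k)) (pbw i E (incr i k (decr j k \<beta>)) w))"
  proof (intro sum.cong refl)
    fix k assume "k \<in> {1..<j}"
    have "pbw_row E (incr i k (decr j k \<beta>)) i w = pbw_row E (incr i k \<beta>) i w"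
      by (rule pbw_row_cong) (use assms in \<open>auto simp: incr_def decr_def\<close>)
    then show "scale (of_nat (\<beta> j k)) (pbw i' E (decr j k \<beta>) (pbw_row E (incr i k \<beta>) i w)) =
        scale (of_nat (\<beta> j k)) (pbw i E (incr i k (decr j k \<beta>)) w)"
      by (simp add: i' pbw_Suc pbw_incr_above)
  qed
  finally show ?case .
next
  case (Suc m)
  then show ?case using assms by (simp add: pbw_Suc pbw_row_incr_other pbw_row_decr_other)
qed

lemma pbw_left:
  assumes "1 \<le> j" "j < i" "i \<le> n"
  shows "E i j (pbw n E \<beta> w) = pbw n E (incr i j \<beta>) w +
    (\<Sum>k\<in>{1..<j}. scale (of_nat (\<beta> j k)) (pbw n E (incr i k (decr j k \<beta>)) w))"
  using assms by (intro pbw_left_from) auto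

text \<open>Coming from the right, \<open>E_(i,j)\<close> crosses the rows \<open>r > i\<close>.
  Each commutator \<open>E_(r,j)\<close> stays in row \<open>r\<close>, and the operator itself ends
  in row \<open>i\<close>.\<close>

lemma pbw_right_from:
  assumes "1 \<le> j" "j < i" "i \<le> n" "i \<le> m" "m \<le> n"
  shows "pbw m E \<beta> (E i j w) = pbw m E (incr i j \<beta>) w +
    (\<Sum>r\<in>{i<..m}. scale (of_nat (\<beta> r i)) (pbw m E (incr r j (decr r i \<beta>)) w))"
  using \<open>i \<le> m\<close> \<open>m \<le> n\<close>
proof (induction m arbitrary: w rule: nat_induct_at_least)
  case base
  obtain i' where i': "i = Suc i'" using assms by (cases i) auto
  have "pbw_row E \<beta> i (E i j w) = pbw_row E (incr i j \<beta>) i w"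
    using assms by (simp add: row_commute[symmetric] row_incr)
  then show ?case by (simp add: i' pbw_Suc pbw_incr_above)
next
  case (Suc m)
  have set: "{i<..Suc m} = insert (Suc m) {i<..m}" using Suc.hyps by auto
  have "pbw (Suc m) E \<beta> (E i j w) = pbw m E \<beta> (E i j (pbw_row E \<beta> (Suc m) w)) +
    scale (of_nat (\<beta> (Suc m) i)) (pbw m E \<beta> (pbw_row E (incr (Suc m) j (decr (Suc m) i \<beta>)) (Suc m) w))"
    using assms Suc by (simp add: pbw_Suc row_right pbw_add pbw_scale)
  also have "pbw m E \<beta> (pbw_row E (incr (Suc m) j (decr (Suc m) i \<beta>)) (Suc m) w) =
      pbw (Suc m) E (incr (Suc m) j (decr (Suc m) i \<beta>)) w"
    by (simp add: pbw_Suc pbw_incr_above pbw_decr_above)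
  also have "pbw m E \<beta> (E i j (pbw_row E \<beta> (Suc m) w)) = pbw (Suc m) E (incr i j \<beta>) w +
    (\<Sum>r\<in>{i<..m}. scale (of_nat (\<beta> r i)) (pbw (Suc m) E (incr r j (decr r i \<beta>)) w))"
    using Suc by (simp add: pbw_Suc pbw_row_incr_other pbw_row_decr_other)
  finally show ?case by (simp add: set add_ac)
qed

lemma pbw_right:
  assumes "1 \<le> j" "j < i" "i \<le> n"
  shows "pbw n E \<beta> (E i j w) = pbw n E (incr i j \<beta>) w +
    (\<Sum>r\<in>{i<..n}. scale (of_nat (\<beta> r i)) (pbw n E (incr r j (decr r i \<beta>)) w))"
  using assms by (intro pbw_right_from) auto

end

section \<open>Weights of PBW monomials\<close>

text \<open>The amount by which the monomial lowers the weight, in coordinates with respect to the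
  simple roots; equivalently its exponent vector in \<open>q_1, ..., q_(n-1)\<close>.\<close>

definition wt :: "nat \<Rightarrow> (nat \<Rightarrow> nat \<Rightarrow> nat) \<Rightarrow> nat \<Rightarrow> nat" where
  "wt n \<beta> m = (\<Sum>p\<in>set (pairs n). \<beta> (fst p) (snd p) * root (fst p) (snd p) m)"

text \<open>The Kostant partitions of \<open>d\<close>; they index the PBW basis of one weight
  space.\<close>

definition GammaW :: "nat \<Rightarrow> (nat \<Rightarrow> nat) \<Rightarrow> (nat \<Rightarrow> nat \<Rightarrow> nat) set" where
  "GammaW n d = {\<beta> \<in> GammaA n. wt n \<beta> = d}"

lemma incr_apply: "incr i j \<beta> r k = \<beta> r k + (if (r, k) = (i, j) then 1 else 0)"
  by (simp add: incr_def)

lemma finite_root: "finite {m. root i j m \<noteq> 0}"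
  by (rule finite_subset[of _ "{..<i}"]) (auto simp: root_def)

lemma root_nonzero: "j < i \<Longrightarrow> root i j j \<noteq> 0"
  by (simp add: root_def)

lemma root_split: "j \<le> i \<Longrightarrow> i \<le> r \<Longrightarrow> root r j m = root r i m + root i j m"
  by (auto simp: root_def)

lemma wt_incr:
  assumes "1 \<le> j" "j < i" "i \<le> n"
  shows "wt n (incr i j \<beta>) m = wt n \<beta> m + root i j m"
proof -
  have mem: "(i, j) \<in> set (pairs n)" using assms by (simp add: set_pairs)
  have "wt n (incr i j \<beta>) m =
    (\<Sum>p\<in>set (pairs n). \<beta> (fst p) (snd p) * root (fst p) (snd p) m + (if p = (i, j) then root i j m else 0))"
    unfolding wt_def by (rule sum.cong) (auto simp: incr_apply)
  also have "\<dots> = wt n \<beta> m + root i j m"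
    using mem by (simp add: sum.distrib sum.delta wt_def)
  finally show ?thesis .
qed

lemma wt_decr:
  assumes "1 \<le> j" "j < i" "i \<le> n" "\<beta> i j \<noteq> 0"
  shows "wt n \<beta> m = wt n (decr i j \<beta>) m + root i j m"
  using wt_incr[of j i n "decr i j \<beta>" m] incr_decr[of \<beta> i j] assms by simp

lemma GammaA_incr: "\<beta> \<in> GammaA n \<Longrightarrow> 1 \<le> j \<Longrightarrow> j < i \<Longrightarrow> i \<le> n \<Longrightarrow> incr i j \<beta> \<in> GammaA n"
  unfolding GammaA_def incr_apply by (simp split: if_splits)

lemma decr_le: "decr i j \<beta> r k \<le> \<beta> r k"
  by (simp add: decr_def)

lemma GammaA_decr: "\<beta> \<in> GammaA n \<Longrightarrow> decr i j \<beta> \<in> GammaA n"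
  unfolding GammaA_def mem_Collect_eq by (metis decr_le le_zero_eq)

lemma wt_outside: "wt n \<beta> m \<noteq> 0 \<Longrightarrow> 1 \<le> m \<and> m < n"
  unfolding wt_def by (erule sum.not_neutral_contains_not_neutral) (auto simp: set_pairs root_def split: if_splits)

lemma finite_wt_support: "finite {m. wt n \<beta> m \<noteq> 0}"
  by (rule finite_subset[of _ "{..<n}"]) (use wt_outside in auto)

lemma le_wt:
  assumes "\<beta> \<in> GammaA n"
  shows "\<beta> i j \<le> wt n \<beta> j"
proof (cases "\<beta> i j = 0")
  case False
  then have ij: "1 \<le> j" "j < i" "i \<le> n" using assms by (auto simp: GammaA_def)
  have "\<beta> (fst (i, j)) (snd (i, j)) * root (fst (i, j)) (snd (i, j)) j \<le> wt n \<beta> j"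
    unfolding wt_def
  proof (rule member_le_sum)
    show "(i, j) \<in> set (pairs n)" using ij by (simp add: set_pairs)
  qed simp_all
  then show ?thesis using ij by (simp add: root_def)
qed simp

lemma finite_Gamma_wt_le: "finite {\<beta> \<in> GammaA n. \<forall>m. wt n \<beta> m \<le> d m}"
proof -
  let ?N = "Max (d ` {..n})"
  let ?F = "{f. \<forall>p. (p \<in> set (pairs n) \<longrightarrow> f p \<in> {..?N}) \<and> (p \<notin> set (pairs n) \<longrightarrow> f p = 0)}"
  have "finite ?F" by (rule finite_set_of_finite_funs) auto
  moreover have "{\<beta> \<in> GammaA n. \<forall>m. wt n \<beta> m \<le> d m} \<subseteq> curry ` ?F"
  proof
    fix \<beta> assume \<beta>: "\<beta> \<in> {\<beta> \<in> GammaA n. \<forall>m. wt n \<beta> m \<le> d m}"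
    have "\<beta> i j \<le> ?N" if "(i, j) \<in> set (pairs n)" for i j
    proof -
      have "\<beta> i j \<le> wt n \<beta> j" using \<beta> by (intro le_wt) simp
      also have "\<dots> \<le> d j" using \<beta> by simp
      also have "d j \<le> ?N" using that by (intro Max_ge) (auto simp: set_pairs)
      finally show ?thesis .
    qed
    moreover have "\<beta> i j = 0" if "(i, j) \<notin> set (pairs n)" for i j
      using that \<beta> by (auto simp: set_pairs GammaA_def)
    ultimately have "case_prod \<beta> \<in> ?F" by auto
    then show "\<beta> \<in> curry ` ?F" by (rule image_eqI[rotated]) simp
  qed
  ultimately show ?thesis using finite_surj by blast
qed

lemma finite_GammaW: "finite (GammaW n d)"
  by (rule finite_subset[OF _ finite_Gamma_wt_le[of n d]]) (auto simp: GammaW_def)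

lemma GammaW_infinite: "infinite {m. d m \<noteq> 0} \<Longrightarrow> GammaW n d = {}"
  using finite_wt_support by (auto simp: GammaW_def)

lemma GammaW_incr:
  assumes "\<beta> \<in> GammaA n" "1 \<le> j" "j < i" "i \<le> n"
  shows "incr i j \<beta> \<in> GammaW n (\<lambda>m. wt n \<beta> m + root i j m)"
  using assms by (auto simp: GammaW_def GammaA_incr wt_incr)

lemma GammaW_move:
  assumes "\<beta> \<in> GammaA n" "1 \<le> j" "j < i" "i < r" "r \<le> n" "\<beta> r i \<noteq> 0"
  shows "incr r j (decr r i \<beta>) \<in> GammaW n (\<lambda>m. wt n \<beta> m + root i j m)"
  using assms wt_decr[of i r n \<beta>] root_split[of j i r]
  by (auto simp: GammaW_def GammaA_incr GammaA_decr wt_incr)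

section \<open>Right multiplication as a matrix\<close>

text \<open>Structure constants of right multiplication by \<open>E_(i,j)\<close> in the PBW basis
  of the enveloping algebra of the lowering operators. They do not depend on the module: cyclicity
  of the trace uses the same numbers in the Verma module and on formal series.\<close>

definition rmat :: "nat \<Rightarrow> nat \<Rightarrow> nat \<Rightarrow> (nat \<Rightarrow> nat \<Rightarrow> nat) \<Rightarrow> (nat \<Rightarrow> nat \<Rightarrow> nat) \<Rightarrow> complex" where
  "rmat n i j \<beta> \<delta> = (if \<delta> = incr i j \<beta> then 1 else 0) +
     (\<Sum>r\<in>{i<..n}. if \<delta> = incr r j (decr r i \<beta>) then of_nat (\<beta> r i) else 0)"

lemma rmat_nonzero:
  assumes "\<beta> \<in> GammaA n" "1 \<le> j" "j < i" "i \<le> n" "rmat n i j \<beta> \<delta> \<noteq> 0"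
  shows "\<delta> \<in> GammaW n (\<lambda>m. wt n \<beta> m + root i j m)"
proof (cases "\<delta> = incr i j \<beta>")
  case True
  then show ?thesis using GammaW_incr assms by simp
next
  case False
  then obtain r where "r \<in> {i<..n}" "(if \<delta> = incr r j (decr r i \<beta>) then complex_of_nat (\<beta> r i) else 0) \<noteq> 0"
    using assms(5) by (auto simp: rmat_def elim: sum.not_neutral_contains_not_neutral)
  then show ?thesis using GammaW_move[of \<beta> n j i r] assms by (auto split: if_splits)
qed

context lowering
begin

lemma pbw_right_rmat:
  assumes "\<beta> \<in> GammaA n" "1 \<le> j" "j < i" "i \<le> n"
  shows "pbw n E \<beta> (E i j w) =
    (\<Sum>\<delta>\<in>GammaW n (\<lambda>m. wt n \<beta> m + root i j m). scale (rmat n i j \<beta> \<delta>) (pbw n E \<delta> w))"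
proof -
  let ?D = "GammaW n (\<lambda>m. wt n \<beta> m + root i j m)"
  have delta: "(\<Sum>\<delta>\<in>?D. scale (if \<delta> = x then c else 0) (pbw n E \<delta> w)) = scale c (pbw n E x w)"
    if "c \<noteq> 0 \<Longrightarrow> x \<in> ?D" for x c
  proof -
    have "(\<Sum>\<delta>\<in>?D. scale (if \<delta> = x then c else 0) (pbw n E \<delta> w)) =
        (\<Sum>\<delta>\<in>?D. if \<delta> = x then scale c (pbw n E x w) else 0)"
      by (rule sum.cong) auto
    then show ?thesis using that by (cases "c = 0") (auto simp: sum.delta finite_GammaW)
  qed
  have "(\<Sum>\<delta>\<in>?D. scale (rmat n i j \<beta> \<delta>) (pbw n E \<delta> w)) =
    (\<Sum>\<delta>\<in>?D. scale (if \<delta> = incr i j \<beta> then 1 else 0) (pbw n E \<delta> w)) +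
    (\<Sum>\<delta>\<in>?D. \<Sum>r\<in>{i<..n}. scale (if \<delta> = incr r j (decr r i \<beta>) then of_nat (\<beta> r i) else 0) (pbw n E \<delta> w))"
    by (simp add: rmat_def scale_left_distrib scale_sum_left sum.distrib)
  also have "(\<Sum>\<delta>\<in>?D. \<Sum>r\<in>{i<..n}. scale (if \<delta> = incr r j (decr r i \<beta>) then of_nat (\<beta> r i) else 0) (pbw n E \<delta> w))
    = (\<Sum>r\<in>{i<..n}. \<Sum>\<delta>\<in>?D. scale (if \<delta> = incr r j (decr r i \<beta>) then of_nat (\<beta> r i) else 0) (pbw n E \<delta> w))"
    by (rule sum.swap)
  also have "\<dots> = (\<Sum>r\<in>{i<..n}. scale (of_nat (\<beta> r i)) (pbw n E (incr r j (decr r i \<beta>)) w))"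
    using GammaW_move[of \<beta> n j i] assms by (intro sum.cong delta refl) auto
  also have "(\<Sum>\<delta>\<in>?D. scale (if \<delta> = incr i j \<beta> then 1 else 0) (pbw n E \<delta> w)) = pbw n E (incr i j \<beta>) w"
    using delta[of 1 "incr i j \<beta>"] GammaW_incr assms by simp
  finally show ?thesis using pbw_right[of j i \<beta> w] assms by simp
qed

end

section \<open>The action on formal series\<close>

lemma pbw_hom:
  assumes "\<And>i j w. 1 \<le> j \<Longrightarrow> j < i \<Longrightarrow> i \<le> m \<Longrightarrow> A (E i j w) = F i j (A w)"
  shows "A (pbw m E \<beta> w) = pbw m F \<beta> (A w)"
proof -
  have pow: "A ((E i j ^^ c) w) = (F i j ^^ c) (A w)" if "1 \<le> j" "j < i" "i \<le> m" for i j c w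
    using that by (induction c) (simp_all add: assms)
  have "set xs \<subseteq> set (pairs m) \<Longrightarrow>
    A (foldr (\<lambda>(i, j) w. (E i j ^^ \<beta> i j) w) xs w) = foldr (\<lambda>(i, j) w. (F i j ^^ \<beta> i j) w) xs (A w)" for xs
    by (induction xs) (auto simp: set_pairs pow)
  then show ?thesis by (simp add: pbw_def)
qed

text \<open>The exponent that \<open>x_i d/dx_j\<close> carries to \<open>k\<close>; in the other
  direction, \<open>x_i d/dx_j\<close> carries \<open>a\<close> to
  \<open>shift j i a\<close>.\<close>

definition shift :: "nat \<Rightarrow> nat \<Rightarrow> (nat \<Rightarrow> int) \<Rightarrow> nat \<Rightarrow> int" where
  "shift i j k = (\<lambda>r. k r + (if r = j then 1 else 0) - (if r = i then 1 else 0))"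

lemma shift_shift: "shift i j (shift j i a) = a"
  by (rule ext) (simp add: shift_def)

lemma shift_eq_iff: "shift i j k = a \<longleftrightarrow> k = shift j i a"
  by (metis shift_shift)

lemma tilde_action_lower:
  assumes "vector_space scale" "i \<noteq> j"
  shows "tilde_action scale E \<mu> i j f k = E i j (f k) + scale (of_int (k j) + 1 + \<mu>) (f (shift i j k))"
proof -
  interpret vector_space scale by fact
  show ?thesis using assms by (simp add: tilde_action_def shift_def Let_def)
qed

definition fun_scale :: "('a \<Rightarrow> 'v \<Rightarrow> 'v) \<Rightarrow> 'a \<Rightarrow> ('k \<Rightarrow> 'v) \<Rightarrow> 'k \<Rightarrow> 'v" where
  "fun_scale scale c f = (\<lambda>k. scale c (f k))"

lemma (in vector_space) fun_scale_vector_space: "vector_space (fun_scale scale)"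
  by unfold_locales (auto simp: fun_scale_def fun_eq_iff algebra_simps)

context lowering
begin

lemma tilde_lowering: "lowering (fun_scale scale) n (tilde_action scale E \<mu>)"
proof -
  interpret f: vector_space "fun_scale scale" by (rule fun_scale_vector_space)
  have vs: "vector_space scale" by unfold_locales
  show ?thesis
  proof
    fix i j k l :: nat and x y w :: "(nat \<Rightarrow> int) \<Rightarrow> 'w" and a :: complex
    assume ij: "1 \<le> j" "j < i" "i \<le> n"
    then have t: "tilde_action scale E \<mu> i j f p = E i j (f p) + scale (of_int (p j) + 1 + \<mu>) (f (shift i j p))"
      for f p by (intro tilde_action_lower[OF vs]) auto
    show "tilde_action scale E \<mu> i j (x + y) = tilde_action scale E \<mu> i j x + tilde_action scale E \<mu> i j y"
      using ij by (auto simp: fun_eq_iff t E_add scale_right_distrib)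
    show "tilde_action scale E \<mu> i j (fun_scale scale a x) = fun_scale scale a (tilde_action scale E \<mu> i j x)"
      using ij by (auto simp: fun_eq_iff t E_scale scale_right_distrib fun_scale_def mult.commute)
    assume kl: "1 \<le> l" "l < k" "k \<le> n"
    then have t': "tilde_action scale E \<mu> k l f p = E k l (f p) + scale (of_int (p l) + 1 + \<mu>) (f (shift k l p))"
      for f p by (intro tilde_action_lower[OF vs]) auto
    show "tilde_action scale E \<mu> i j (tilde_action scale E \<mu> k l w) -
        tilde_action scale E \<mu> k l (tilde_action scale E \<mu> i j w) =
        (if j = k then tilde_action scale E \<mu> i l w else 0) -
        (if l = i then tilde_action scale E \<mu> k j w else 0)"
    proof
      fix p
      let ?A = "of_int (p j) + 1 + \<mu>" and ?B = "of_int (p l) + 1 + \<mu>"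
      let ?q = "shift k l (shift i j p)"
      have q: "shift i j (shift k l p) = ?q" by (auto simp: shift_def fun_eq_iff)
      \<comment> \<open>The mixed terms, with one operator on the Verma factor and the other on the
        monomial, cancel. The two pure commutators remain.\<close>
      have "(tilde_action scale E \<mu> i j (tilde_action scale E \<mu> k l w) -
        tilde_action scale E \<mu> k l (tilde_action scale E \<mu> i j w)) p =
        (E i j (E k l (w p)) - E k l (E i j (w p))) +
        scale (?A * (of_int (shift i j p l) + 1 + \<mu>) - ?B * (of_int (shift k l p j) + 1 + \<mu>)) (w ?q)"
        using ij kl by (simp add: t t' E_add E_scale scale_right_distrib q scale_left_diff_distrib)
      also have "?A * (of_int (shift i j p l) + 1 + \<mu>) - ?B * (of_int (shift k l p j) + 1 + \<mu>) =
          (if j = k then ?B else 0) - (if l = i then ?A else 0)"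
        using ij kl by (auto simp: shift_def algebra_simps)
      also have "scale ((if j = k then ?B else 0) - (if l = i then ?A else 0)) (w ?q) =
         (if j = k then scale ?B (w ?q) else 0) - (if l = i then scale ?A (w ?q) else 0)"
        by (simp add: scale_left_diff_distrib)
      also have "E i j (E k l (w p)) - E k l (E i j (w p)) =
          (if j = k then E i l (w p) else 0) - (if l = i then E k j (w p) else 0)"
        using ij kl by (intro E_comm)
      also have "?q = shift i l p" if "j = k"
        using that ij by (auto simp: shift_def fun_eq_iff)
      moreover have "?q = shift k j p" if "l = i"
        using that ij by (auto simp: shift_def fun_eq_iff)
      moreover have "tilde_action scale E \<mu> i l w p = E i l (w p) + scale ?B (w (shift i l p))" if "j = k"
        using that ij kl by (intro tilde_action_lower[OF vs]) auto
      moreover have "tilde_action scale E \<mu> k j w p = E k j (w p) + scale ?A (w (shift k j p))" if "l = i"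
        using that ij kl by (intro tilde_action_lower[OF vs]) auto
      ultimately show "(tilde_action scale E \<mu> i j (tilde_action scale E \<mu> k l w) -
        tilde_action scale E \<mu> k l (tilde_action scale E \<mu> i j w)) p =
        ((if j = k then tilde_action scale E \<mu> i l w else 0) -
        (if l = i then tilde_action scale E \<mu> k j w else 0)) p"
        using ij kl by (cases "j = k"; cases "l = i") simp_all
    qed
  qed
qed

text \<open>This permits replacing the infinite series \<open>u\<close> by a finite sum of its terms
  when one coefficient of the trace is computed.\<close>

lemma tilde_pbw_local:
  "\<exists>K. finite K \<and> (\<forall>u u'. (\<forall>k\<in>K. u k = u' k) \<longrightarrow>
     pbw n (tilde_action scale E \<mu>) \<beta> u c = pbw n (tilde_action scale E \<mu>) \<beta> u' c)"
proof -
  have vs: "vector_space scale" by unfold_locales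
  let ?loc = "\<lambda>A. \<forall>c. \<exists>K. finite K \<and> (\<forall>u u'. (\<forall>k\<in>K. u k = u' k) \<longrightarrow> A u c = A u' c)"
  have id: "?loc (\<lambda>u. u)"
    by (intro allI exI[of _ "{_}"]) auto
  have comp: "?loc (\<lambda>u. A (B u))" if A: "?loc A" and B: "?loc B"
    for A B :: "((nat \<Rightarrow> int) \<Rightarrow> 'w) \<Rightarrow> (nat \<Rightarrow> int) \<Rightarrow> 'w"
  proof
    fix c
    obtain K where K: "finite K" "\<And>u u'. (\<And>k. k \<in> K \<Longrightarrow> u k = u' k) \<Longrightarrow> A u c = A u' c"
      using A by metis
    obtain L where L: "\<And>c. finite (L c)" "\<And>c u u'. (\<And>k. k \<in> L c \<Longrightarrow> u k = u' k) \<Longrightarrow> B u c = B u' c"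
      using B by metis
    show "\<exists>K. finite K \<and> (\<forall>u u'. (\<forall>k\<in>K. u k = u' k) \<longrightarrow> A (B u) c = A (B u') c)"
    proof (intro exI[of _ "\<Union>c\<in>K. L c"] conjI allI impI)
      show "finite (\<Union>c\<in>K. L c)" using K(1) L(1) by blast
      fix u u' :: "(nat \<Rightarrow> int) \<Rightarrow> 'w"
      assume "\<forall>k\<in>\<Union>c\<in>K. L c. u k = u' k"
      then have "B u k = B u' k" if "k \<in> K" for k
        using that by (intro L(2)) blast
      then show "A (B u) c = A (B u') c" by (rule K(2))
    qed
  qed
  have step: "?loc (tilde_action scale E \<mu> i j)" if "i \<noteq> j" for i j
  proof
    fix c
    show "\<exists>K. finite K \<and> (\<forall>u u'. (\<forall>k\<in>K. u k = u' k) \<longrightarrow>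
        tilde_action scale E \<mu> i j u c = tilde_action scale E \<mu> i j u' c)"
      using that by (intro exI[of _ "{c, shift i j c}"]) (simp add: tilde_action_lower[OF vs])
  qed
  have pow: "?loc (\<lambda>u. (tilde_action scale E \<mu> i j ^^ m) u)" if "i \<noteq> j" for i j m
  proof (induction m)
    case 0
    show ?case using id by simp
  next
    case (Suc m)
    show ?case using comp[OF step[OF that] Suc] by simp
  qed
  have "set xs \<subseteq> set (pairs n) \<Longrightarrow>
    ?loc (\<lambda>u. foldr (\<lambda>(i, j) w. (tilde_action scale E \<mu> i j ^^ \<beta> i j) w) xs u)" for xs
  proof (induction xs)
    case Nil
    show ?case using id by simp
  next
    case (Cons p xs)
    obtain i j where p: "p = (i, j)" by (cases p)
    have "i \<noteq> j" using Cons.prems p by (auto simp: set_pairs)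
    from comp[OF pow[OF this, of "\<beta> i j"] Cons.IH] Cons.prems show ?case by (simp add: p)
  qed
  then show ?thesis by (simp add: pbw_def)
qed

text \<open>Lowering operators strictly raise the degree where \<open>x\<^sub>r\<close> has degree \<open>r\<close>, so the part of
  \<open>u\<close> of positive degree never contributes to the coefficient of \<open>x\<^sup>0\<close>.\<close>

lemma tilde_pbw_at_zero:
  assumes "\<And>k. (\<Sum>r\<in>{1..n}. int r * k r) < 0 \<Longrightarrow> u k = 0"
  shows "pbw n (tilde_action scale E \<mu>) \<beta> u (\<lambda>_. 0) = pbw n E \<beta> (u (\<lambda>_. 0))"
proof -
  have vs: "vector_space scale" by unfold_locales
  let ?h = "\<lambda>k. \<Sum>r\<in>{1..n}. int r * k r"
  let ?P = "\<lambda>u. \<forall>k. ?h k < 0 \<longrightarrow> u k = (0 :: 'w)"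
  have h: "?h (shift i j k) = ?h k + int j - int i" if "1 \<le> j" "j < i" "i \<le> n" for i j k
  proof -
    have "?h (shift i j k) = (\<Sum>r\<in>{1..n}. int r * k r + (if r = j then int j else 0) - (if r = i then int i else 0))"
      by (rule sum.cong) (auto simp: shift_def algebra_simps)
    then show ?thesis using that by (simp add: sum.distrib sum_subtractf sum.delta)
  qed
  have z: "E i j 0 = 0" if "1 \<le> j" "j < i" "i \<le> n" for i j
    using E_scale[OF that, of 0 0] by simp
  have step: "?P (tilde_action scale E \<mu> i j u) \<and>
      tilde_action scale E \<mu> i j u (\<lambda>_. 0) = E i j (u (\<lambda>_. 0))"
    if "1 \<le> j" "j < i" "i \<le> n" "?P u" for i j u
  proof -
    have "u (shift i j (\<lambda>_. 0)) = 0"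
      using that h[of j i "\<lambda>_. 0"] by simp
    moreover have "u (shift i j k) = 0" if "?h k < 0" for k
      using \<open>?P u\<close> h[OF \<open>1 \<le> j\<close> \<open>j < i\<close> \<open>i \<le> n\<close>, of k] that \<open>j < i\<close> by simp
    ultimately show ?thesis
      using that by (simp add: tilde_action_lower[OF vs] z)
  qed
  have pow: "?P ((tilde_action scale E \<mu> i j ^^ c) u) \<and>
      (tilde_action scale E \<mu> i j ^^ c) u (\<lambda>_. 0) = (E i j ^^ c) (u (\<lambda>_. 0))"
    if "1 \<le> j" "j < i" "i \<le> n" "?P u" for i j u c
  proof (induction c)
    case (Suc c)
    then show ?case using step[OF that(1-3)] by simp
  qed (use that in simp)
  let ?f = "\<lambda>xs. foldr (\<lambda>(i, j) w. (tilde_action scale E \<mu> i j ^^ \<beta> i j) w) xs u"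
  have "set xs \<subseteq> set (pairs n) \<Longrightarrow> ?P (?f xs) \<and>
    ?f xs (\<lambda>_. 0) = foldr (\<lambda>(i, j) w. (E i j ^^ \<beta> i j) w) xs (u (\<lambda>_. 0))" for xs
  proof (induction xs)
    case Nil
    show ?case using assms by simp
  next
    case (Cons p xs)
    obtain i j where p: "p = (i, j)" by (cases p)
    have "1 \<le> j" "j < i" "i \<le> n" using Cons.prems p by (auto simp: set_pairs)
    from pow[OF this, of "?f xs" "\<beta> i j"] Cons show ?case by (simp add: p)
  qed
  from this[of "pairs n"] show ?thesis by (simp add: pbw_def)
qed

end

section \<open>Traces on the Verma module\<close>

definition sgl :: "'v::zero \<Rightarrow> (nat \<Rightarrow> int) \<Rightarrow> (nat \<Rightarrow> int) \<Rightarrow> 'v" where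
  "sgl y a = (\<lambda>k. if k = a then y else 0)"

lemma sum_fun_apply: "(\<Sum>x\<in>A. f x) k = (\<Sum>x\<in>A. f x k)"
  by (induction A rule: infinite_finite_induct) simp_all

locale verma =
  fixes n :: nat and lam :: "nat \<Rightarrow> complex" and scale :: "complex \<Rightarrow> 'v::ab_group_add \<Rightarrow> 'v"
    and E :: "nat \<Rightarrow> nat \<Rightarrow> 'v \<Rightarrow> 'v" and v :: 'v and \<mu> :: complex
  assumes verma: "is_verma n lam scale E v"

sublocale verma \<subseteq> lowering scale n E
proof -
  interpret vector_space scale using verma by (simp add: is_verma_def)
  show "lowering scale n E"
  proof
    fix i j k l :: nat and x y w a
    assume ij: "1 \<le> j" "j < i" "i \<le> n"
    then have "Vector_Spaces.linear scale scale (E i j)"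
      using verma by (auto simp: is_verma_def)
    then show "E i j (x + y) = E i j x + E i j y" "E i j (scale a x) = scale a (E i j x)"
      by (simp_all add: Vector_Spaces.linear_iff)
    assume kl: "1 \<le> l" "l < k" "k \<le> n"
    show "E i j (E k l w) - E k l (E i j w) = (if j = k then E i l w else 0) - (if l = i then E k j w else 0)"
      using verma ij kl unfolding is_verma_def by simp
  qed
qed

context verma
begin

abbreviation bas :: "(nat \<Rightarrow> nat \<Rightarrow> nat) \<Rightarrow> 'v" where
  "bas \<beta> \<equiv> pbw n E \<beta> v"

abbreviation tE :: "nat \<Rightarrow> nat \<Rightarrow> ((nat \<Rightarrow> int) \<Rightarrow> 'v) \<Rightarrow> (nat \<Rightarrow> int) \<Rightarrow> 'v" where
  "tE \<equiv> tilde_action scale E \<mu>"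

definition cf :: "'v \<Rightarrow> (nat \<Rightarrow> nat \<Rightarrow> nat) \<Rightarrow> complex" where
  "cf w \<beta> = representation (bas ` GammaA n) w (bas \<beta>)"

lemma inj_bas: "inj_on bas (GammaA n)"
  using verma by (simp add: is_verma_def)

lemma indep_bas: "independent (bas ` GammaA n)"
  using verma by (simp add: is_verma_def)

lemma span_bas: "span (bas ` GammaA n) = UNIV"
  using verma by (simp add: is_verma_def)

lemma cf_add: "cf (x + y) \<beta> = cf x \<beta> + cf y \<beta>"
  by (simp add: cf_def representation_add indep_bas span_bas)

lemma cf_scale: "cf (scale a x) \<beta> = a * cf x \<beta>"
  by (simp add: cf_def representation_scale indep_bas span_bas)

lemma cf_zero: "cf 0 \<beta> = 0"
  by (simp add: cf_def representation_zero)

lemma cf_sum: "cf (\<Sum>x\<in>I. f x) \<beta> = (\<Sum>x\<in>I. cf (f x) \<beta>)"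
  by (induction I rule: infinite_finite_induct) (simp_all add: cf_zero cf_add)

lemma cf_bas:
  "\<beta> \<in> GammaA n \<Longrightarrow> \<gamma> \<in> GammaA n \<Longrightarrow> cf (bas \<beta>) \<gamma> = (if \<gamma> = \<beta> then 1 else 0)"
  using inj_bas by (auto simp: cf_def representation_basis indep_bas dest: inj_onD)

lemma finite_cf: "finite {\<beta> \<in> GammaA n. cf w \<beta> \<noteq> 0}"
proof (rule finite_imageD)
  show "finite (bas ` {\<beta> \<in> GammaA n. cf w \<beta> \<noteq> 0})"
    by (rule finite_subset[OF _ finite_representation[of "bas ` GammaA n" w]]) (auto simp: cf_def)
  show "inj_on bas {\<beta> \<in> GammaA n. cf w \<beta> \<noteq> 0}"
    by (rule inj_on_subset[OF inj_bas]) auto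
qed

lemma cf_expand: "w = (\<Sum>\<beta>\<in>{\<beta> \<in> GammaA n. cf w \<beta> \<noteq> 0}. scale (cf w \<beta>) (bas \<beta>))"
proof -
  let ?B = "bas ` GammaA n"
  have "w = (\<Sum>b | representation ?B w b \<noteq> 0. scale (representation ?B w b) b)"
    by (simp add: sum_nonzero_representation_eq indep_bas span_bas)
  also have "{b. representation ?B w b \<noteq> 0} = bas ` {\<beta> \<in> GammaA n. cf w \<beta> \<noteq> 0}"
    using representation_ne_zero[of ?B w] by (auto simp: cf_def)
  also have "(\<Sum>b\<in>\<dots>. scale (representation ?B w b) b) =
      (\<Sum>\<beta>\<in>{\<beta> \<in> GammaA n. cf w \<beta> \<noteq> 0}. scale (cf w \<beta>) (bas \<beta>))"
    by (subst sum.reindex) (auto intro: inj_on_subset[OF inj_bas] simp: cf_def)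
  finally show ?thesis .
qed

lemma E_diag_bas:
  assumes "k \<in> {1..n}"
  shows "E k k (bas \<beta>) = scale (lam k + of_nat (wt n \<beta> (k - 1)) - of_nat (wt n \<beta> k)) (bas \<beta>)"
proof -
  let ?c = "\<lambda>i j. (if k = i then 1 else 0) - (if k = j then 1 else 0) :: complex"
  have step: "E k k (E i j w) = scale (c + ?c i j) (E i j w)"
    if ij: "1 \<le> j" "j < i" "i \<le> n" and w: "E k k w = scale c w" for i j c w
  proof -
    have "E k k (E i j w) - E i j (E k k w) = (if k = i then E k j w else 0) - (if j = k then E i k w else 0)"
      using verma assms ij unfolding is_verma_def by simp
    also have "\<dots> = scale (?c i j) (E i j w)" using ij by (auto simp: algebra_simps)
    finally show ?thesis using ij by (simp add: w E_scale algebra_simps)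
  qed
  have pow: "E k k ((E i j ^^ m) w) = scale (c + of_nat m * ?c i j) ((E i j ^^ m) w)"
    if ij: "1 \<le> j" "j < i" "i \<le> n" and w: "E k k w = scale c w" for i j c m w
  proof (induction m)
    case (Suc m)
    from step[OF ij Suc] show ?case by (simp only: funpow.simps comp_apply) (simp add: algebra_simps)
  qed (simp add: w)
  have "set xs \<subseteq> set (pairs n) \<Longrightarrow> E k k (foldr (\<lambda>(i, j) w. (E i j ^^ \<beta> i j) w) xs v) =
     scale (lam k + (\<Sum>p\<leftarrow>xs. of_nat (\<beta> (fst p) (snd p)) * ?c (fst p) (snd p)))
       (foldr (\<lambda>(i, j) w. (E i j ^^ \<beta> i j) w) xs v)" for xs
  proof (induction xs)
    case Nil
    show ?case using verma assms by (simp add: is_verma_def)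
  next
    case (Cons p xs)
    obtain i j where p: "p = (i, j)" by (cases p)
    have "1 \<le> j" "j < i" "i \<le> n" using Cons.prems p by (auto simp: set_pairs)
    from pow[OF this Cons.IH, of "\<beta> i j"] Cons.prems show ?case by (simp add: p algebra_simps)
  qed
  from this[of "pairs n"] have "E k k (bas \<beta>) =
     scale (lam k + (\<Sum>p\<leftarrow>pairs n. of_nat (\<beta> (fst p) (snd p)) * ?c (fst p) (snd p))) (bas \<beta>)"
    by (simp add: pbw_def)
  also have "(\<Sum>p\<leftarrow>pairs n. of_nat (\<beta> (fst p) (snd p)) * ?c (fst p) (snd p)) =
      (\<Sum>p\<in>set (pairs n). of_nat (\<beta> (fst p) (snd p)) * ?c (fst p) (snd p))"
    by (rule sum_list_distinct_conv_sum_set[OF distinct_pairs])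
  \<comment> \<open>\<open>root i j\<close> is the indicator of \<open>{j..<i}\<close>, so its value
    at \<open>k - 1\<close> minus its value at \<open>k\<close> is 1 for \<open>k = i\<close>, -1
    for \<open>k = j\<close> and 0 otherwise. Place 0 has value 0 because
    \<open>j \<ge> 1\<close>.\<close>
  also have "\<dots> = (\<Sum>p\<in>set (pairs n). of_nat (\<beta> (fst p) (snd p) * root (fst p) (snd p) (k - 1)) -
      of_nat (\<beta> (fst p) (snd p) * root (fst p) (snd p) k))"
    by (rule sum.cong) (use assms in \<open>auto simp: set_pairs root_def\<close>)
  also have "\<dots> = of_nat (wt n \<beta> (k - 1)) - of_nat (wt n \<beta> k)"
    by (simp add: sum_subtractf wt_def)
  finally show ?thesis by (simp add: algebra_simps)
qed

lemma bas_nonzero: "\<beta> \<in> GammaA n \<Longrightarrow> bas \<beta> \<noteq> 0"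
  using indep_bas dependent_zero by force

text \<open>Admitting an arbitrary \<open>u\<close>, which need not come from a
  \<open>gl(n)\<close>-homomorphism, makes the trace linear in \<open>u\<close>; the singular vector
  can then be treated term by term.\<close>

definition trace :: "((nat \<Rightarrow> int) \<Rightarrow> 'v) \<Rightarrow> (nat \<Rightarrow> nat) \<Rightarrow> complex" where
  "trace u d = (\<Sum>\<beta>\<in>GammaW n d. cf (pbw n tE \<beta> u (\<lambda>_. 0)) \<beta>)"

definition trace_ps :: "((nat \<Rightarrow> int) \<Rightarrow> 'v) \<Rightarrow> ps" where
  "trace_ps u = Abs_ps (trace u)"

lemma trace_ps_nth: "ps_nth (trace_ps u) = trace u"
  unfolding trace_ps_def
proof (rule Abs_ps_inverse, intro CollectI allI impI)
  fix m assume "trace u m \<noteq> 0"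
  then have "GammaW n m \<noteq> {}" by (auto simp: trace_def)
  then show "finite {i. m i \<noteq> 0}" using GammaW_infinite by blast
qed

sublocale tilde: lowering "fun_scale scale" n tE
  by (rule tilde_lowering)

lemma trace_ps_add: "trace_ps (u + u') = trace_ps u + trace_ps u'"
  by (rule ps_eqI)
    (simp add: plus_ps.rep_eq trace_ps_nth trace_def tilde.pbw_add cf_add sum.distrib)

lemma trace_ps_scale: "trace_ps (fun_scale scale a u) = ps_const a * trace_ps u"
  by (rule ps_eqI)
    (simp add: ps_nth_const_mult trace_ps_nth trace_def tilde.pbw_scale cf_scale sum_distrib_left,
      simp add: fun_scale_def cf_scale)

lemma trace_ps_zero: "trace_ps 0 = 0"
  using trace_ps_add[of 0 0] by simp

lemma trace_ps_sum: "trace_ps (\<Sum>x\<in>I. f x) = (\<Sum>x\<in>I. trace_ps (f x))"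
  by (induction I rule: infinite_finite_induct)
    (simp_all only: not_False_eq_True sum.infinite sum.empty sum.insert trace_ps_zero trace_ps_add)

lemma sgl_add: "sgl (x + y :: 'v) a = sgl x a + sgl y a"
  by (auto simp: sgl_def fun_eq_iff)

lemma sgl_zero: "sgl (0 :: 'v) a = 0"
  by (auto simp: sgl_def fun_eq_iff)

lemma sgl_sum: "sgl (\<Sum>x\<in>I. f x :: 'v) a = (\<Sum>x\<in>I. sgl (f x) a)"
  by (induction I rule: infinite_finite_induct)
    (simp_all only: not_False_eq_True sum.infinite sum.empty sum.insert sgl_zero sgl_add)

lemma sgl_scale: "sgl (scale c y) a = fun_scale scale c (sgl y a)"
  by (auto simp: sgl_def fun_scale_def)

lemma tE_sgl:
  assumes "1 \<le> j" "j < i" "i \<le> n"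
  shows "tE i j (sgl y a) = sgl (E i j y) a + fun_scale scale (of_int (a j) + \<mu>) (sgl y (shift j i a))"
proof
  fix k
  have vs: "vector_space scale" by unfold_locales
  have "E i j 0 = 0" using E_scale[OF assms, of 0 0] by simp
  moreover have "shift i j k j = k j + 1" using assms by (simp add: shift_def)
  moreover have "shift i j k = a \<longleftrightarrow> k = shift j i a" by (rule shift_eq_iff)
  moreover have "shift i j (shift j i a) = a" by (rule shift_shift)
  ultimately show "tE i j (sgl y a) k =
      (sgl (E i j y) a + fun_scale scale (of_int (a j) + \<mu>) (sgl y (shift j i a))) k"
    using assms tilde_action_lower[OF vs, of i j E \<mu> "sgl y a" k]
    by (auto simp: sgl_def fun_scale_def add.commute)
qed

text \<open>The PBW monomials applied to \<open>v\<close> form a basis, so \<open>R\<close> may be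
  prescribed on them. It commutes with left multiplications because \<open>pbw_left\<close> has the
  same coefficients whether the monomials act on \<open>v\<close> or on
  \<open>E i j v\<close>.\<close>

lemma right_mult_exists:
  assumes "1 \<le> j" "j < i" "i \<le> n"
  obtains R where "Vector_Spaces.linear scale scale R"
    and "\<And>\<gamma>. \<gamma> \<in> GammaA n \<Longrightarrow> R (bas \<gamma>) = pbw n E \<gamma> (E i j v)"
    and "\<And>k l w. 1 \<le> l \<Longrightarrow> l < k \<Longrightarrow> k \<le> n \<Longrightarrow> R (E k l w) = E k l (R w)"
proof -
  interpret vp: vector_space_pair scale scale by unfold_locales
  obtain R where lin: "Vector_Spaces.linear scale scale R"
    and R': "\<And>x. x \<in> bas ` GammaA n \<Longrightarrow> R x = pbw n E (the_inv_into (GammaA n) bas x) (E i j v)"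
    using vp.linear_independent_extend[OF indep_bas,
        of "\<lambda>x. pbw n E (the_inv_into (GammaA n) bas x) (E i j v)"] by blast
  have R: "R (bas \<gamma>) = pbw n E \<gamma> (E i j v)" if "\<gamma> \<in> GammaA n" for \<gamma>
    using R'[of "bas \<gamma>"] that by (simp add: the_inv_into_f_f[OF inj_bas])
  have add: "R (x + y) = R x + R y" and scl: "R (scale a x) = scale a (R x)" for x y a
    using lin by (simp_all add: Vector_Spaces.linear_iff)
  have "R (E k l w) = E k l (R w)" if kl: "1 \<le> l" "l < k" "k \<le> n" for k l w
  proof (rule vp.linear_eq_on[of _ _ w "bas ` GammaA n"])
    show "Vector_Spaces.linear scale scale (\<lambda>w. R (E k l w))"
      "Vector_Spaces.linear scale scale (\<lambda>w. E k l (R w))"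
      using kl by (simp_all add: Vector_Spaces.linear_iff E_add E_scale add scl vector_space_axioms)
    show "w \<in> span (bas ` GammaA n)" by (simp add: span_bas)
    fix x assume "x \<in> bas ` GammaA n"
    then obtain \<gamma> where \<gamma>: "\<gamma> \<in> GammaA n" "x = bas \<gamma>" by blast
    have "R (E k l x) = pbw n E (incr k l \<gamma>) (E i j v) +
      (\<Sum>m\<in>{1..<l}. scale (of_nat (\<gamma> l m)) (R (bas (incr k m (decr l m \<gamma>)))))"
      using \<gamma> kl by (simp add: pbw_left add additive_sum_scale[OF add scl] R GammaA_incr)
    also have "\<dots> = pbw n E (incr k l \<gamma>) (E i j v) +
      (\<Sum>m\<in>{1..<l}. scale (of_nat (\<gamma> l m)) (pbw n E (incr k m (decr l m \<gamma>)) (E i j v)))"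
      using \<gamma> kl by (intro arg_cong2[of _ _ _ _ "(+)"] sum.cong refl) (simp add: R GammaA_incr GammaA_decr)
    also have "\<dots> = E k l (R x)"
      using \<gamma> kl by (simp add: R pbw_left)
    finally show "R (E k l x) = E k l (R x)" .
  qed
  with lin R show thesis using that by blast
qed

text \<open>\<open>R\<close> is homogeneous and \<open>u \<mapsto> pbw u\<close> turns right multiplication of the argument by
  \<open>E\<^sub>i\<^sub>,\<^sub>j\<close> into the action on \<open>u\<close>, so this is \<open>tr (R B) = tr (B R)\<close>.\<close>

lemma trace_cyclic:
  assumes ij: "1 \<le> j" "j < i" "i \<le> n"
    and lin: "Vector_Spaces.linear scale scale R"
    and R: "\<And>\<gamma>. \<gamma> \<in> GammaA n \<Longrightarrow> R (bas \<gamma>) = pbw n E \<gamma> (E i j v)"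
    and comm: "\<And>k l w. 1 \<le> l \<Longrightarrow> l < k \<Longrightarrow> k \<le> n \<Longrightarrow> R (E k l w) = E k l (R w)"
  shows "trace_ps (\<lambda>k. R (u k)) = ps_monom (root i j) * trace_ps (tE i j u)"
proof (rule ps_eqI)
  fix d :: "nat \<Rightarrow> nat"
  assume "finite {m. d m \<noteq> 0}"
  have vs: "vector_space scale" by unfold_locales
  have add: "R (x + y) = R x + R y" and scl: "R (scale a x) = scale a (R x)" for x y a
    using lin by (simp_all add: Vector_Spaces.linear_iff)
  define x where "x \<beta> = pbw n tE \<beta> u (\<lambda>_. 0)" for \<beta>
  \<comment> \<open>Applied coefficientwise, \<open>R\<close> also commutes with the lowering
    operators on series, whose second part only shifts and scales coefficients.\<close>
  have "(\<lambda>k. R (pbw n tE \<beta> u k)) = pbw n tE \<beta> (\<lambda>k. R (u k))" for \<beta>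
    by (rule pbw_hom[of n "\<lambda>u k. R (u k)"])
      (simp add: fun_eq_iff tilde_action_lower[OF vs] add scl comm)
  then have Rx: "pbw n tE \<beta> (\<lambda>k. R (u k)) (\<lambda>_. 0) = R (x \<beta>)" for \<beta>
    by (metis x_def)
  have cf_right: "cf (pbw n E \<gamma> (E i j v)) \<beta> = rmat n i j \<gamma> \<beta>"
    if "\<gamma> \<in> GammaA n" "\<beta> \<in> GammaA n" for \<beta> \<gamma>
  proof -
    let ?D = "GammaW n (\<lambda>m. wt n \<gamma> m + root i j m)"
    have "cf (pbw n E \<gamma> (E i j v)) \<beta> = (\<Sum>\<delta>\<in>?D. if \<beta> = \<delta> then rmat n i j \<gamma> \<delta> else 0)"
      using that ij by (auto simp: pbw_right_rmat cf_sum cf_scale cf_bas GammaW_def intro!: sum.cong)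
    also have "\<dots> = rmat n i j \<gamma> \<beta>"
      using rmat_nonzero[of \<gamma> n j i \<beta>] that ij by (auto simp: sum.delta' finite_GammaW)
    finally show ?thesis .
  qed
  have cfR: "cf (R w) \<beta> = (\<Sum>\<gamma>\<in>{\<gamma> \<in> GammaA n. cf w \<gamma> \<noteq> 0}. cf w \<gamma> * rmat n i j \<gamma> \<beta>)"
    if "\<beta> \<in> GammaA n" for w \<beta>
  proof -
    have "R w = (\<Sum>\<gamma>\<in>{\<gamma> \<in> GammaA n. cf w \<gamma> \<noteq> 0}. scale (cf w \<gamma>) (pbw n E \<gamma> (E i j v)))"
      by (subst cf_expand) (simp add: additive_sum_scale[OF add scl] R)
    then show ?thesis using that by (simp add: cf_sum cf_scale cf_right)
  qed
  have lhs: "trace (\<lambda>k. R (u k)) d =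
      (\<Sum>\<beta>\<in>GammaW n d. \<Sum>\<gamma>\<in>{\<gamma> \<in> GammaA n. cf (x \<beta>) \<gamma> \<noteq> 0}. cf (x \<beta>) \<gamma> * rmat n i j \<gamma> \<beta>)"
    unfolding trace_def by (rule sum.cong) (auto simp: Rx cfR GammaW_def)
  show "ps_nth (trace_ps (\<lambda>k. R (u k))) d = ps_nth (ps_monom (root i j) * trace_ps (tE i j u)) d"
  proof (cases "\<forall>m. root i j m \<le> d m")
    case True
    let ?d = "\<lambda>m. d m - root i j m"
    have GammaW_sub: "\<gamma> \<in> GammaA n" if "\<gamma> \<in> GammaW n e" for \<gamma> e
      using that by (simp add: GammaW_def)
    have d: "(\<lambda>m. wt n \<gamma> m + root i j m) = d \<longleftrightarrow> wt n \<gamma> = ?d" for \<gamma>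
    proof
      assume "wt n \<gamma> = ?d"
      then show "(\<lambda>m. wt n \<gamma> m + root i j m) = d" using True by simp
    qed auto
    have "trace (\<lambda>k. R (u k)) d = (\<Sum>\<beta>\<in>GammaW n d. \<Sum>\<gamma>\<in>GammaW n ?d. cf (x \<beta>) \<gamma> * rmat n i j \<gamma> \<beta>)"
      unfolding lhs
    \<comment> \<open>\<open>rmat\<close> is homogeneous: only \<open>\<gamma>\<close> of weight
      \<open>d\<close> minus the root can reach a \<open>\<beta>\<close> of weight
      \<open>d\<close>.\<close>
    proof (rule sum.cong[OF refl], rule sum.mono_neutral_cong)
      fix \<beta> \<gamma> assume \<beta>: "\<beta> \<in> GammaW n d" and \<gamma>: "\<gamma> \<in> {\<gamma> \<in> GammaA n. cf (x \<beta>) \<gamma> \<noteq> 0} - GammaW n ?d"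
      show "cf (x \<beta>) \<gamma> * rmat n i j \<gamma> \<beta> = 0"
      proof (rule ccontr)
        assume "\<not> ?thesis"
        then have "\<beta> \<in> GammaW n (\<lambda>m. wt n \<gamma> m + root i j m)"
          using \<gamma> ij by (intro rmat_nonzero) auto
        then have "(\<lambda>m. wt n \<gamma> m + root i j m) = d" using \<beta> by (simp add: GammaW_def)
        then show False using \<gamma> by (auto simp: d GammaW_def)
      qed
    qed (use GammaW_sub in \<open>auto simp: finite_cf finite_GammaW\<close>)
    also have "\<dots> = (\<Sum>\<gamma>\<in>GammaW n ?d. \<Sum>\<beta>\<in>GammaW n d. cf (x \<beta>) \<gamma> * rmat n i j \<gamma> \<beta>)"
      by (rule sum.swap)
    also have "\<dots> = trace (tE i j u) ?d"
      unfolding trace_def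
    proof (rule sum.cong[OF refl])
      fix \<gamma> assume \<gamma>: "\<gamma> \<in> GammaW n ?d"
      then have "(\<lambda>m. wt n \<gamma> m + root i j m) = d" unfolding d by (simp add: GammaW_def)
      \<comment> \<open>Here the matrix that described \<open>R\<close> on the Verma module
        describes right multiplication on formal series.\<close>
      then have "pbw n tE \<gamma> (tE i j u) = (\<Sum>\<beta>\<in>GammaW n d. fun_scale scale (rmat n i j \<gamma> \<beta>) (pbw n tE \<beta> u))"
        using tilde.pbw_right_rmat[of \<gamma> j i u] \<gamma> ij by (simp add: GammaW_def)
      then have "pbw n tE \<gamma> (tE i j u) (\<lambda>_. 0) = (\<Sum>\<beta>\<in>GammaW n d. scale (rmat n i j \<gamma> \<beta>) (x \<beta>))"
        by (simp add: sum_fun_apply fun_scale_def x_def)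
      then show "(\<Sum>\<beta>\<in>GammaW n d. cf (x \<beta>) \<gamma> * rmat n i j \<gamma> \<beta>) = cf (pbw n tE \<gamma> (tE i j u) (\<lambda>_. 0)) \<gamma>"
        by (simp add: cf_sum cf_scale mult.commute)
    qed
    finally show ?thesis using True by (simp add: ps_nth_monom_mult[OF finite_root] trace_ps_nth)
  next
    case False
    have "rmat n i j \<gamma> \<beta> = 0" if "\<gamma> \<in> GammaA n" "\<beta> \<in> GammaW n d" for \<beta> \<gamma>
    proof (rule ccontr)
      assume "\<not> ?thesis"
      then have "\<beta> \<in> GammaW n (\<lambda>m. wt n \<gamma> m + root i j m)"
        using that ij by (intro rmat_nonzero) auto
      then have "d = (\<lambda>m. wt n \<gamma> m + root i j m)" using that by (simp add: GammaW_def)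
      then show False using False by simp
    qed
    then have "trace (\<lambda>k. R (u k)) d = 0" unfolding lhs by (intro sum.neutral) auto
    then show ?thesis using False by (auto simp add: ps_nth_monom_mult[OF finite_root] trace_ps_nth)
  qed
qed

definition btr :: "(nat \<Rightarrow> nat \<Rightarrow> nat) \<Rightarrow> (nat \<Rightarrow> int) \<Rightarrow> ps" where
  "btr \<beta> a = trace_ps (sgl (bas \<beta>) a)"

text \<open>An empty column \<open>i\<close> makes the product of \<open>\<beta>\<close> with
  \<open>E_(i,j)\<close> on the right the single PBW monomial \<open>incr i j \<beta>\<close>.
  Normal ordering of \<open>E_(i,j)\<close> on the left gives this same monomial plus commutators,
  so its trace occurs on both sides of the cyclicity relation; solving for it yields
  \<open>q/(1 - q)\<close>.\<close>

lemma btr_incr: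
  assumes ij: "1 \<le> j" "j < i" "i \<le> n" and \<beta>: "\<beta> \<in> GammaA n"
    and top: "\<And>r. i < r \<Longrightarrow> \<beta> r i = 0"
  shows "btr (incr i j \<beta>) a = ps_geom (root i j) * ps_monom (root i j) *
    ((\<Sum>k\<in>{1..<j}. ps_const (of_nat (\<beta> j k)) * btr (incr i k (decr j k \<beta>)) a) +
     ps_const (of_int (a j) + \<mu>) * btr \<beta> (shift j i a))"
proof -
  obtain R where lin: "Vector_Spaces.linear scale scale R"
    and R: "\<And>\<gamma>. \<gamma> \<in> GammaA n \<Longrightarrow> R (bas \<gamma>) = pbw n E \<gamma> (E i j v)"
    and comm: "\<And>k l w. 1 \<le> l \<Longrightarrow> l < k \<Longrightarrow> k \<le> n \<Longrightarrow> R (E k l w) = E k l (R w)"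
    using right_mult_exists[OF ij] by metis
  have "R 0 = 0" using lin by (simp add: Vector_Spaces.linear_iff) (metis scale_zero_left)
  moreover have "R (bas \<beta>) = bas (incr i j \<beta>)"
    using pbw_right[OF ij, of \<beta> v] R[OF \<beta>] top by simp
  ultimately have "(\<lambda>k. R (sgl (bas \<beta>) a k)) = sgl (bas (incr i j \<beta>)) a"
    by (auto simp: sgl_def)
  then have "btr (incr i j \<beta>) a = ps_monom (root i j) * trace_ps (tE i j (sgl (bas \<beta>) a))"
    using trace_cyclic[OF ij lin R comm, of "sgl (bas \<beta>) a"] by (simp add: btr_def)
  also have "trace_ps (tE i j (sgl (bas \<beta>) a)) = btr (incr i j \<beta>) a +
    ((\<Sum>k\<in>{1..<j}. ps_const (of_nat (\<beta> j k)) * btr (incr i k (decr j k \<beta>)) a) +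
     ps_const (of_int (a j) + \<mu>) * btr \<beta> (shift j i a))"
    using ij by (simp add: tE_sgl pbw_left sgl_add sgl_sum sgl_scale trace_ps_add trace_ps_sum trace_ps_scale
        btr_def add.assoc)
  finally have "btr (incr i j \<beta>) a = ps_geom (root i j) * (ps_monom (root i j) *
    ((\<Sum>k\<in>{1..<j}. ps_const (of_nat (\<beta> j k)) * btr (incr i k (decr j k \<beta>)) a) +
     ps_const (of_int (a j) + \<mu>) * btr \<beta> (shift j i a)))"
    unfolding distrib_left[of "ps_monom (root i j)" "btr (incr i j \<beta>) a"]
    by (rule ps_geom_solve[OF root_nonzero[OF ij(2)] finite_root])
  then show ?thesis by (simp add: mult.assoc)
qed

end

section \<open>The Vandermonde factor counts PBW monomials\<close>

definition vander :: "nat \<Rightarrow> ps" where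
  "vander n = (\<Prod>p\<in>set (pairs n). ps_geom (root (fst p) (snd p)))"

lemma ps_nth_geom_root: "ps_nth (ps_geom (root j k)) = mps_geom (root j k)"
  by (simp only: ps_geom.rep_eq finite_root if_True)

lemma vandermonde_factor_eq: "vandermonde_factor n = ps_nth (vander n)"
proof -
  have "vandermonde_factor n = mps_prod (map (\<lambda>p. ps_nth (ps_geom (root (fst p) (snd p)))) (pairs n))"
    unfolding vandermonde_factor_def by (simp add: ps_nth_geom_root case_prod_unfold)
  then show ?thesis
    by (simp only: mps_prod_eq_ps_nth vander_def prod.distinct_set_conv_list[OF distinct_pairs])
qed

definition GammaS :: "nat \<Rightarrow> (nat \<times> nat) set \<Rightarrow> (nat \<Rightarrow> nat) \<Rightarrow> (nat \<Rightarrow> nat \<Rightarrow> nat) set" where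
  "GammaS n S d = {\<beta>. (\<forall>i j. \<beta> i j \<noteq> 0 \<longrightarrow> (i, j) \<in> S) \<and> wt n \<beta> = d}"

lemma GammaS_pairs: "GammaS n (set (pairs n)) d = GammaW n d"
  by (simp add: GammaS_def GammaW_def GammaA_def set_pairs)

lemma finite_GammaS: "S \<subseteq> set (pairs n) \<Longrightarrow> finite (GammaS n S d)"
  by (rule finite_subset[OF _ finite_GammaW[of n d]]) (auto simp: GammaS_pairs[symmetric] GammaS_def)

text \<open>Either the entry at \<open>(i, j)\<close> vanishes or one unit can be removed from it.
  Keeping \<open>(i, j)\<close> admissible after the removal gives a fixed-point equation for the
  generating series.\<close>

lemma GammaS_insert:
  assumes S: "(i, j) \<notin> S" and ij: "1 \<le> j" "j < i" "i \<le> n"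
  shows "GammaS n (insert (i, j) S) d = GammaS n S d \<union>
    (if \<forall>m. root i j m \<le> d m then incr i j ` GammaS n (insert (i, j) S) (\<lambda>m. d m - root i j m) else {})"
    (is "?L = ?A \<union> ?B")
proof (intro equalityI subsetI)
  fix \<beta> assume \<beta>: "\<beta> \<in> ?L"
  show "\<beta> \<in> ?A \<union> ?B"
  proof (cases "\<beta> i j = 0")
    case True
    have "(a, b) \<in> S" if "\<beta> a b \<noteq> 0" for a b
    proof -
      have "(a, b) \<in> insert (i, j) S" using \<beta> that unfolding GammaS_def by blast
      moreover have "(a, b) \<noteq> (i, j)" using that True by auto
      ultimately show ?thesis by blast
    qed
    then show ?thesis using \<beta> by (simp add: GammaS_def)
  next
    case False
    have wt: "d m = wt n (decr i j \<beta>) m + root i j m" for m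
      using wt_decr[of j i n \<beta> m, OF ij False] \<beta> by (auto simp: GammaS_def)
    have "(a, b) \<in> insert (i, j) S" if "decr i j \<beta> a b \<noteq> 0" for a b
      using that \<beta> decr_le[of i j \<beta> a b] by (auto simp: GammaS_def)
    then have "decr i j \<beta> \<in> GammaS n (insert (i, j) S) (\<lambda>m. d m - root i j m)"
      by (auto simp: GammaS_def wt)
    then show ?thesis using wt incr_decr[of \<beta> i j, OF False] by (auto intro!: image_eqI[of \<beta> _ "decr i j \<beta>"])
  qed
next
  fix \<beta> assume "\<beta> \<in> ?A \<union> ?B"
  then show "\<beta> \<in> ?L"
  proof
    assume "\<beta> \<in> ?B"
    then obtain \<gamma> where le: "\<forall>m. root i j m \<le> d m" and \<beta>: "\<beta> = incr i j \<gamma>"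
      and \<gamma>: "\<gamma> \<in> GammaS n (insert (i, j) S) (\<lambda>m. d m - root i j m)"
      by (auto split: if_splits)
    have "wt n \<beta> = d"
      using le \<gamma> by (simp add: fun_eq_iff \<beta> wt_incr[OF ij] GammaS_def)
    moreover have "(a, b) \<in> insert (i, j) S" if "\<beta> a b \<noteq> 0" for a b
      using that \<gamma> by (auto simp: GammaS_def \<beta> incr_apply split: if_splits)
    ultimately show ?thesis by (simp add: GammaS_def)
  qed (auto simp: GammaS_def)
qed

lemma inj_incr: "inj_on (incr i j) A"
  by (metis decr_incr inj_onI)

lemma wt_zero: "wt n (\<lambda>_ _. 0) = (\<lambda>_. 0)"
  by (simp add: wt_def fun_eq_iff)

text \<open>Kostant's partition function: the generating series \<open>W\<close> for the roots in
  \<open>insert p S\<close> satisfies \<open>W = q W + W_S\<close>, whose solution is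
  \<open>W_S\<close> times a geometric series.\<close>

lemma prod_geom_nth:
  assumes "S \<subseteq> set (pairs n)"
  shows "ps_nth (\<Prod>p\<in>S. ps_geom (root (fst p) (snd p))) d = of_nat (card (GammaS n S d))"
proof -
  have "finite S" using assms finite_subset by blast
  then show ?thesis using assms
  proof (induction S arbitrary: d)
    case empty
    have "(\<forall>i j. \<beta> i j = 0) \<longleftrightarrow> \<beta> = (\<lambda>_ _. 0)" for \<beta> :: "nat \<Rightarrow> nat \<Rightarrow> nat"
      by (simp add: fun_eq_iff)
    then have "GammaS n {} d = (if d = (\<lambda>_. 0) then {\<lambda>_ _. 0} else {})"
      by (auto simp: GammaS_def wt_zero)
    then show ?case by (simp add: one_ps.rep_eq mps_one_def)
  next
    case (insert p S)
    obtain i j where p: "p = (i, j)" by (cases p)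
    have ij: "1 \<le> j" "j < i" "i \<le> n" using insert.prems by (auto simp: p set_pairs)
    have notin: "(i, j) \<notin> S" using insert.hyps p by simp
    let ?c = "\<lambda>d. of_nat (card (GammaS n (insert p S) d)) :: complex"
    define W where "W = Abs_ps ?c"
    have W: "ps_nth W = ?c"
      unfolding W_def
    proof (rule Abs_ps_inverse, intro CollectI allI impI)
      fix m assume "?c m \<noteq> 0"
      then have "GammaS n (insert p S) m \<noteq> {}" by auto
      then show "finite {i. m i \<noteq> 0}" using finite_wt_support by (auto simp: GammaS_def)
    qed
    have card: "card (GammaS n (insert p S) d) = card (GammaS n S d) +
       (if \<forall>m. root i j m \<le> d m then card (GammaS n (insert p S) (\<lambda>m. d m - root i j m)) else 0)" for d
    proof -
      let ?B = "if \<forall>m. root i j m \<le> d m then incr i j ` GammaS n (insert (i, j) S) (\<lambda>m. d m - root i j m) else {}"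
      have "\<beta> i j = 0" if "\<beta> \<in> GammaS n S d" for \<beta>
        using that notin by (auto simp: GammaS_def)
      moreover have "\<beta> i j \<noteq> 0" if "\<beta> \<in> ?B" for \<beta>
        using that by (auto simp: incr_def split: if_splits)
      ultimately have "GammaS n S d \<inter> ?B = {}" by blast
      moreover have "finite (GammaS n S d)" "finite ?B"
        using insert.prems p finite_GammaS by auto
      ultimately have "card (GammaS n S d \<union> ?B) = card (GammaS n S d) + card ?B"
        by (intro card_Un_disjoint)
      also have "card ?B = (if \<forall>m. root i j m \<le> d m then card (GammaS n (insert p S) (\<lambda>m. d m - root i j m)) else 0)"
        by (simp add: card_image inj_incr p)
      finally show ?thesis using GammaS_insert[OF notin ij, of d] by (simp add: p)
    qed
    have "W = ps_monom (root i j) * W + (\<Prod>p\<in>S. ps_geom (root (fst p) (snd p)))"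
    proof (rule ps_eqI)
      fix d
      show "ps_nth W d = ps_nth (ps_monom (root i j) * W + (\<Prod>p\<in>S. ps_geom (root (fst p) (snd p)))) d"
        using insert.IH[of d] insert.prems card[of d]
        by (simp add: plus_ps.rep_eq ps_nth_monom_mult[OF finite_root] W)
    qed
    then have "W = ps_geom (root i j) * (\<Prod>p\<in>S. ps_geom (root (fst p) (snd p)))"
      by (rule ps_geom_solve[OF root_nonzero[OF ij(2)] finite_root])
    then show ?case using insert.hyps W by (simp add: p)
  qed
qed

lemma vander_nth: "ps_nth (vander n) d = of_nat (card (GammaW n d))"
  unfolding vander_def prod_geom_nth[OF order.refl] GammaS_pairs ..

section \<open>The hypergeometric sum in a fixed weight\<close>

text \<open>The product of the factors \<open>q/(1 - q)\<close> collected while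
  \<open>E_(r,r-1)\<close> is traded down to \<open>E_(r,k)\<close> and absorbed there; up to sign
  it is the variable \<open>xi\<close> of the hypergeometric function.\<close>

definition path_factor :: "nat \<Rightarrow> nat \<Rightarrow> ps" where
  "path_factor r k = (\<Prod>s\<in>{k..<r}. ps_geom (root r s) * ps_monom (root r s))"

lemma path_factor_step:
  "k < r \<Longrightarrow> path_factor r k = ps_geom (root r k) * ps_monom (root r k) * path_factor r (Suc k)"
  by (simp add: path_factor_def prod.atLeast_Suc_lessThan)

definition path_prod :: "nat \<Rightarrow> (nat \<Rightarrow> nat \<Rightarrow> nat) \<Rightarrow> ps" where
  "path_prod n \<beta> = (\<Prod>p\<in>set (pairs n). path_factor (fst p) (snd p) ^ \<beta> (fst p) (snd p))"

text \<open>The factors of \<open>coeffA\<close> with index \<open>n\<close> depend on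
  \<open>\<beta>\<close> only through its weight, so they are left out here and restored in
  \<open>u_coeff_hyper_term\<close>.\<close>

definition poch_prod :: "nat \<Rightarrow> complex \<Rightarrow> (nat \<Rightarrow> nat \<Rightarrow> nat) \<Rightarrow> complex" where
  "poch_prod n \<mu> \<beta> = (\<Prod>s\<in>{1..n-1}. pochhammer (\<mu> + 1 - of_nat (beta_under \<beta> s)) (beta_over n \<beta> s))"

definition hyper_term :: "nat \<Rightarrow> complex \<Rightarrow> (nat \<Rightarrow> nat \<Rightarrow> nat) \<Rightarrow> ps" where
  "hyper_term n \<mu> \<beta> = ps_const (poch_prod n \<mu> \<beta> / of_nat (beta_fact n \<beta>)) * path_prod n \<beta>"

definition hyper_weight :: "nat \<Rightarrow> complex \<Rightarrow> (nat \<Rightarrow> nat) \<Rightarrow> ps" where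
  "hyper_weight n \<mu> d = (\<Sum>\<beta>\<in>GammaW n d. hyper_term n \<mu> \<beta>)"

text \<open>Exponents of \<open>x\<close> in the term of \<open>u\<^sub>\<lambda>\<close> indexed by \<open>d = (i\<^sub>1, \<dots>, i\<^sub>n\<^sub>-\<^sub>1)\<close>; needs \<open>d 0 = d n = 0\<close>.\<close>

definition expo :: "nat \<Rightarrow> (nat \<Rightarrow> nat) \<Rightarrow> nat \<Rightarrow> int" where
  "expo n d r = (if 1 \<le> r \<and> r \<le> n then int (d r) - int (d (r - 1)) else 0)"

lemma beta_fact_pairs: "beta_fact n \<beta> = (\<Prod>p\<in>set (pairs n). fact (\<beta> (fst p) (snd p)))"
proof -
  have "set (pairs n) = Sigma {1..n} (\<lambda>i. {1..<i})" by (auto simp: set_pairs)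
  then show ?thesis by (simp add: beta_fact_def prod.Sigma case_prod_beta)
qed

lemma prod_pairs_incr:
  fixes f :: "nat \<times> nat \<Rightarrow> nat \<Rightarrow> 'a::comm_monoid_mult"
  assumes "1 \<le> j" "j < i" "i \<le> n" and "f (i, j) (Suc (\<beta> i j)) = c * f (i, j) (\<beta> i j)"
  shows "(\<Prod>p\<in>set (pairs n). f p (incr i j \<beta> (fst p) (snd p))) = c * (\<Prod>p\<in>set (pairs n). f p (\<beta> (fst p) (snd p)))"
proof -
  have mem: "(i, j) \<in> set (pairs n)" using assms by (simp add: set_pairs)
  have "(\<Prod>p\<in>set (pairs n) - {(i, j)}. f p (incr i j \<beta> (fst p) (snd p))) =
      (\<Prod>p\<in>set (pairs n) - {(i, j)}. f p (\<beta> (fst p) (snd p)))"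
    by (rule prod.cong) (auto simp: incr_apply)
  then show ?thesis using assms(4)
    by (simp add: prod.remove[OF _ mem] incr_apply mult.assoc)
qed

lemma beta_fact_incr:
  assumes "1 \<le> j" "j < i" "i \<le> n"
  shows "beta_fact n (incr i j \<beta>) = Suc (\<beta> i j) * beta_fact n \<beta>"
  unfolding beta_fact_pairs
  by (rule prod_pairs_incr[where f = "\<lambda>_. fact", OF assms]) simp

lemma path_prod_incr:
  assumes "1 \<le> j" "j < i" "i \<le> n"
  shows "path_prod n (incr i j \<beta>) = path_factor i j * path_prod n \<beta>"
  unfolding path_prod_def
  by (rule prod_pairs_incr[where f = "\<lambda>p k. path_factor (fst p) (snd p) ^ k", OF assms]) simp

lemma beta_over_incr:
  assumes "j < i" "i \<le> n"
  shows "beta_over n (incr i j \<beta>) s = beta_over n \<beta> s + (if s = j then 1 else 0)"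
  using assms by (auto simp: beta_over_def incr_apply sum.distrib)

lemma beta_under_incr:
  assumes "1 \<le> j" "j < i"
  shows "beta_under (incr i j \<beta>) s = beta_under \<beta> s + (if s = i then 1 else 0)"
  using assms by (auto simp: beta_under_def incr_apply sum.distrib)

text \<open>A unit at \<open>(i, k)\<close> counts +1 for \<open>s = k\<close> and -1 for
  \<open>s = i\<close> on both sides. By this the sums in the Pochhammer symbols are tied to the
  exponents of \<open>x\<close>.\<close>

lemma beta_over_minus_under:
  assumes "s \<in> {1..n}"
  shows "int (beta_over n \<beta> s) - int (beta_under \<beta> s) = int (wt n \<beta> s) - int (wt n \<beta> (s - 1))"
proof -
  let ?P = "set (pairs n)" and ?b = "\<lambda>p. int (\<beta> (fst p) (snd p))"
  have "int (wt n \<beta> s) - int (wt n \<beta> (s - 1)) =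
    (\<Sum>p\<in>?P. (if snd p = s then ?b p else 0) - (if fst p = s then ?b p else 0))"
    unfolding wt_def of_nat_sum sum_subtractf[symmetric]
    by (rule sum.cong) (use assms in \<open>auto simp: set_pairs root_def\<close>)
  also have "\<dots> = (\<Sum>p\<in>{p\<in>?P. snd p = s}. ?b p) - (\<Sum>p\<in>{p\<in>?P. fst p = s}. ?b p)"
    by (simp only: sum_subtractf sum.inter_filter[OF finite_set])
  also have "(\<Sum>p\<in>{p\<in>?P. snd p = s}. ?b p) = (\<Sum>r\<in>{s+1..n}. int (\<beta> r s))"
    by (rule sum.reindex_bij_witness[where i = "\<lambda>r. (r, s)" and j = fst])
      (use assms in \<open>auto simp: set_pairs\<close>)
  also have "(\<Sum>p\<in>{p\<in>?P. fst p = s}. ?b p) = (\<Sum>k\<in>{1..<s}. int (\<beta> s k))"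
    by (rule sum.reindex_bij_witness[where i = "\<lambda>k. (s, k)" and j = snd])
      (use assms in \<open>auto simp: set_pairs\<close>)
  finally show ?thesis by (simp add: beta_over_def beta_under_def)
qed

text \<open>Since column \<open>i\<close> is empty, the symbol at \<open>s = i\<close> has length 0
  and its changed base has no effect. Only the symbol at \<open>j\<close> changes, by one further
  factor.\<close>

lemma poch_prod_incr:
  assumes ij: "1 \<le> j" "j < i" "i \<le> n" and top: "\<And>r. i < r \<Longrightarrow> \<gamma> r i = 0"
    and d: "wt n (incr i j \<gamma>) = d"
  shows "poch_prod n \<mu> (incr i j \<gamma>) = (of_int (expo n d j) + \<mu>) * poch_prod n \<mu> \<gamma>"
proof -
  let ?f = "\<lambda>\<beta> s. pochhammer (\<mu> + 1 - of_nat (beta_under \<beta> s)) (beta_over n \<beta> s) :: complex"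
  have j: "j \<in> {1..n-1}" using ij by auto
  have over_i: "beta_over n \<gamma> i = 0" using top by (simp add: beta_over_def)
  have rest: "?f (incr i j \<gamma>) s = ?f \<gamma> s" if "s \<noteq> j" for s
    using that ij over_i by (cases "s = i") (simp_all add: beta_over_incr beta_under_incr)
  \<comment> \<open>The exponent belongs to the enlarged \<open>incr i j \<gamma>\<close>, whose
    column sum at \<open>j\<close> is one larger. This 1 is the origin of the parameter
    \<open>\<mu> + 1\<close>.\<close>
  have "expo n d j = int (beta_over n \<gamma> j) + 1 - int (beta_under \<gamma> j)"
    using beta_over_minus_under[of j n "incr i j \<gamma>"] ij d
    by (simp add: expo_def beta_over_incr beta_under_incr)
  then have expo: "of_int (expo n d j) + \<mu> = \<mu> + 1 - of_nat (beta_under \<gamma> j) + of_nat (beta_over n \<gamma> j)"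
    by simp
  have "?f (incr i j \<gamma>) j = (of_int (expo n d j) + \<mu>) * ?f \<gamma> j"
    unfolding expo using ij by (simp add: beta_over_incr beta_under_incr pochhammer_Suc mult.commute)
  moreover have "prod (?f (incr i j \<gamma>)) ({1..n-1} - {j}) = prod (?f \<gamma>) ({1..n-1} - {j})"
    by (rule prod.cong) (use rest in auto)
  ultimately show ?thesis
    unfolding poch_prod_def prod.remove[OF finite_atLeastAtMost j] by (simp only: mult.assoc)
qed

lemma hyper_term_incr:
  assumes ij: "1 \<le> j" "j < i" "i \<le> n" and top: "\<And>r. i < r \<Longrightarrow> \<gamma> r i = 0"
    and d: "wt n (incr i j \<gamma>) = d"
  shows "ps_const (of_nat (incr i j \<gamma> i j)) * hyper_term n \<mu> (incr i j \<gamma>) =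
    ps_const (of_int (expo n d j) + \<mu>) * path_factor i j * hyper_term n \<mu> \<gamma>"
proof -
  let ?c = "of_int (expo n d j) + \<mu>"
  have "ps_const (of_nat (incr i j \<gamma> i j)) * hyper_term n \<mu> (incr i j \<gamma>) =
      ps_const (of_nat (Suc (\<gamma> i j)) * (?c * poch_prod n \<mu> \<gamma> / of_nat (Suc (\<gamma> i j) * beta_fact n \<gamma>))) *
      (path_factor i j * path_prod n \<gamma>)"
    using poch_prod_incr[OF ij top d, of \<mu>] beta_fact_incr[OF ij, of \<gamma>] path_prod_incr[OF ij, of \<gamma>]
    by (simp only: hyper_term_def ps_const_mult mult.assoc) (simp add: incr_apply)
  also have "of_nat (Suc (\<gamma> i j)) * (?c * poch_prod n \<mu> \<gamma> / of_nat (Suc (\<gamma> i j) * beta_fact n \<gamma>)) =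
      ?c * (poch_prod n \<mu> \<gamma> / of_nat (beta_fact n \<gamma>))"
    by (simp only: of_nat_mult) (simp del: of_nat_Suc)
  finally show ?thesis by (simp only: hyper_term_def ps_const_mult mult_ac)
qed

text \<open>The last place of \<open>root r k\<close> is \<open>r - 1\<close>: a weight ending at or
  before \<open>m\<close> excludes rows beyond \<open>m + 1\<close>, and row \<open>m + 1\<close>
  alone reaches place \<open>m\<close>.\<close>

lemma wt_top:
  assumes \<beta>: "\<beta> \<in> GammaA n" and m: "m < n" and top: "\<And>s. m < s \<Longrightarrow> wt n \<beta> s = 0"
  shows "\<And>r k. Suc m < r \<Longrightarrow> \<beta> r k = 0" and "wt n \<beta> m = (\<Sum>l\<in>{1..m}. \<beta> (Suc m) l)"
proof -
  show zero: "\<beta> r k = 0" if "Suc m < r" for r k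
  proof (rule ccontr)
    assume nz: "\<beta> r k \<noteq> 0"
    then have rk: "1 \<le> k" "k < r" "r \<le> n" using \<beta> by (auto simp: GammaA_def)
    then have "root r k (r - 1) = 1" by (auto simp: root_def)
    then have "wt n \<beta> (r - 1) \<noteq> 0" using wt_decr[of k r n \<beta> "r - 1", OF rk nz] by simp
    moreover have "wt n \<beta> (r - 1) = 0" by (rule top) (use that in linarith)
    ultimately show False by simp
  qed
  have "wt n \<beta> m = (\<Sum>p\<in>{p\<in>set (pairs n). fst p = Suc m}. \<beta> (fst p) (snd p))"
    unfolding wt_def
  proof (rule sum.mono_neutral_cong_right)
    show "\<forall>p\<in>set (pairs n) - {p \<in> set (pairs n). fst p = Suc m}. \<beta> (fst p) (snd p) * root (fst p) (snd p) m = 0"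
    proof
      fix p assume "p \<in> set (pairs n) - {p \<in> set (pairs n). fst p = Suc m}"
      then have "fst p \<noteq> Suc m" by simp
      then consider "Suc m < fst p" | "fst p \<le> m" by linarith
      then show "\<beta> (fst p) (snd p) * root (fst p) (snd p) m = 0"
        by cases (auto simp: zero root_def)
    qed
  qed (simp, auto simp: set_pairs root_def)
  also have "\<dots> = (\<Sum>l\<in>{1..m}. \<beta> (Suc m) l)"
    by (rule sum.reindex_bij_witness[where i = "\<lambda>k. (Suc m, k)" and j = snd])
      (use m in \<open>auto simp: set_pairs\<close>)
  finally show "wt n \<beta> m = (\<Sum>l\<in>{1..m}. \<beta> (Suc m) l)" .
qed

text \<open>The guard keeps the truncated subtraction honest: if the root does not fit into
  \<open>d\<close>, no \<open>\<beta>\<close> of weight \<open>d\<close> has a unit at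
  \<open>(m + 1, l)\<close>.\<close>

definition hyper_step :: "nat \<Rightarrow> complex \<Rightarrow> (nat \<Rightarrow> nat) \<Rightarrow> nat \<Rightarrow> nat \<Rightarrow> ps" where
  "hyper_step n \<mu> d m l = (if \<forall>s. root (Suc m) l s \<le> d s
     then ps_const (of_int (expo n d l) + \<mu>) * path_factor (Suc m) l *
       hyper_weight n \<mu> (\<lambda>s. d s - root (Suc m) l s)
     else 0)"

text \<open>Double counting of the \<open>\<beta>\<close> with a marked unit in row
  \<open>m + 1\<close>, whose sum is \<open>d m\<close>. The multiplicity of the marked entry
  cancels against its factorial.\<close>

lemma hyper_weight_rec:
  assumes m: "1 \<le> m" "m < n" and top: "\<And>s. m < s \<Longrightarrow> d s = 0"
  shows "ps_const (of_nat (d m)) * hyper_weight n \<mu> d = (\<Sum>l\<in>{1..m}. hyper_step n \<mu> d m l)"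
proof -
  have \<beta>: "\<beta> \<in> GammaA n" "wt n \<beta> = d" if "\<beta> \<in> GammaW n d" for \<beta>
    using that by (auto simp: GammaW_def)
  have zero: "\<beta> r k = 0" if "\<beta> \<in> GammaW n d" "Suc m < r" for \<beta> r k
    using wt_top(1)[OF \<beta>(1)[OF that(1)] m(2), of r k] \<beta>[OF that(1)] top that(2) by simp
  have sum: "d m = (\<Sum>l\<in>{1..m}. \<beta> (Suc m) l)" if "\<beta> \<in> GammaW n d" for \<beta>
    using wt_top(2)[OF \<beta>(1)[OF that(1)] m(2)] \<beta>[OF that(1)] top by simp
  have "ps_const (of_nat (d m)) * hyper_weight n \<mu> d =
      (\<Sum>\<beta>\<in>GammaW n d. \<Sum>l\<in>{1..m}. ps_const (of_nat (\<beta> (Suc m) l)) * hyper_term n \<mu> \<beta>)"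
    unfolding hyper_weight_def sum_distrib_left
  proof (rule sum.cong[OF refl])
    fix \<beta> assume "\<beta> \<in> GammaW n d"
    then have "ps_const (of_nat (d m)) = (\<Sum>l\<in>{1..m}. ps_const (of_nat (\<beta> (Suc m) l)))"
      by (subst sum) (simp_all add: ps_const_sum)
    then show "ps_const (of_nat (d m)) * hyper_term n \<mu> \<beta> =
        (\<Sum>l\<in>{1..m}. ps_const (of_nat (\<beta> (Suc m) l)) * hyper_term n \<mu> \<beta>)"
      by (simp add: sum_distrib_right)
  qed
  also have "\<dots> = (\<Sum>l\<in>{1..m}. \<Sum>\<beta>\<in>GammaW n d. ps_const (of_nat (\<beta> (Suc m) l)) * hyper_term n \<mu> \<beta>)"
    by (rule sum.swap)
  also have "\<dots> = (\<Sum>l\<in>{1..m}. hyper_step n \<mu> d m l)"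
  proof (rule sum.cong[OF refl])
    fix l assume "l \<in> {1..m}"
    then have l: "1 \<le> l" "l < Suc m" "Suc m \<le> n" using m by auto
    let ?r = "root (Suc m) l"
    have dec: "d s = wt n (decr (Suc m) l \<beta>) s + ?r s" if "\<beta> \<in> GammaW n d" "\<beta> (Suc m) l \<noteq> 0" for \<beta> s
      using wt_decr[of l "Suc m" n \<beta> s, OF l] that \<beta> by simp
    show "(\<Sum>\<beta>\<in>GammaW n d. ps_const (of_nat (\<beta> (Suc m) l)) * hyper_term n \<mu> \<beta>) = hyper_step n \<mu> d m l"
    proof (cases "\<forall>s. ?r s \<le> d s")
      case False
      have "ps_const (of_nat (\<beta> (Suc m) l)) * hyper_term n \<mu> \<beta> = 0" if "\<beta> \<in> GammaW n d" for \<beta>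
      proof -
        have "\<beta> (Suc m) l = 0" using dec[OF that] False by (metis le_add2)
        then show ?thesis by simp
      qed
      then show ?thesis using False by (auto simp: hyper_step_def intro!: sum.neutral)
    next
      case True
      have "(\<Sum>\<beta>\<in>GammaW n d. ps_const (of_nat (\<beta> (Suc m) l)) * hyper_term n \<mu> \<beta>) =
         (\<Sum>\<beta>\<in>{\<beta> \<in> GammaW n d. \<beta> (Suc m) l \<noteq> 0}. ps_const (of_nat (\<beta> (Suc m) l)) * hyper_term n \<mu> \<beta>)"
        by (rule sum.mono_neutral_right) (auto simp: finite_GammaW)
      also have "\<dots> = (\<Sum>\<gamma>\<in>GammaW n (\<lambda>s. d s - ?r s).
          ps_const (of_int (expo n d l) + \<mu>) * path_factor (Suc m) l * hyper_term n \<mu> \<gamma>)"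
      proof (rule sum.reindex_bij_witness[where i = "incr (Suc m) l" and j = "decr (Suc m) l"])
        fix \<beta> assume "\<beta> \<in> {\<beta> \<in> GammaW n d. \<beta> (Suc m) l \<noteq> 0}"
        then have b: "\<beta> \<in> GammaW n d" "\<beta> (Suc m) l \<noteq> 0" by auto
        show id: "incr (Suc m) l (decr (Suc m) l \<beta>) = \<beta>" using b by (simp add: incr_decr)
        show "decr (Suc m) l \<beta> \<in> GammaW n (\<lambda>s. d s - ?r s)"
          using b dec[OF b] \<beta>(1)[OF b(1)] by (simp add: GammaW_def GammaA_decr)
        have "decr (Suc m) l \<beta> r (Suc m) = 0" if "Suc m < r" for r
          using zero[OF b(1) that, of "Suc m"] decr_le[of "Suc m" l \<beta> r "Suc m"] by simp
        from hyper_term_incr[where \<gamma> = "decr (Suc m) l \<beta>" and d = d and \<mu> = \<mu>, OF l this] id \<beta>(2)[OF b(1)]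
        show "ps_const (of_int (expo n d l) + \<mu>) * path_factor (Suc m) l * hyper_term n \<mu> (decr (Suc m) l \<beta>) =
            ps_const (of_nat (\<beta> (Suc m) l)) * hyper_term n \<mu> \<beta>" by simp
      next
        fix \<gamma> assume \<gamma>: "\<gamma> \<in> GammaW n (\<lambda>s. d s - ?r s)"
        show "decr (Suc m) l (incr (Suc m) l \<gamma>) = \<gamma>" by simp
        have "wt n (incr (Suc m) l \<gamma>) = d"
          using \<gamma> True wt_incr[OF l, of \<gamma>] by (simp add: GammaW_def fun_eq_iff)
        then show "incr (Suc m) l \<gamma> \<in> {\<beta> \<in> GammaW n d. \<beta> (Suc m) l \<noteq> 0}"
          using \<gamma> l by (simp add: GammaW_def GammaA_incr incr_apply)
      qed
      also have "\<dots> = hyper_step n \<mu> d m l"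
        using True by (simp add: hyper_step_def hyper_weight_def sum_distrib_left)
      finally show ?thesis .
    qed
  qed
  finally show ?thesis .
qed

lemma GammaW_zero: "GammaW n (\<lambda>_. 0) = {\<lambda>_ _. 0}"
proof -
  have "\<beta> = (\<lambda>_ _. 0)" if "\<beta> \<in> GammaW n (\<lambda>_. 0)" for \<beta>
    using that le_wt[of \<beta> n] by (auto simp: GammaW_def fun_eq_iff)
  moreover have "(\<lambda>_ _. 0) \<in> GammaW n (\<lambda>_. 0)"
    by (simp add: GammaW_def GammaA_def wt_zero)
  ultimately show ?thesis by blast
qed

lemma hyper_weight_zero: "hyper_weight n \<mu> (\<lambda>_. 0) = 1"
  by (simp add: hyper_weight_def GammaW_zero hyper_term_def poch_prod_def beta_fact_def path_prod_def
      beta_over_def)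

section \<open>The trace of a single term of the singular vector\<close>

text \<open>The PBW index of \<open>E_(2,1)^(d 1) ... E_(n,n-1)^(d (n-1))\<close>; the monomials of
  the singular vector are already in PBW order.\<close>

definition diag :: "nat \<Rightarrow> (nat \<Rightarrow> nat) \<Rightarrow> nat \<Rightarrow> nat \<Rightarrow> nat" where
  "diag n d r k = (if r = Suc k \<and> 1 \<le> k \<and> k < n then d k else 0)"

lemma GammaA_diag: "diag n d \<in> GammaA n"
  by (auto simp: diag_def GammaA_def)

lemma expo_step:
  assumes "1 \<le> k" "k \<le> m" "m < n" "\<forall>s. root (Suc m) k s \<le> d s"
  shows "shift k (Suc m) (expo n d) = expo n (\<lambda>s. d s - root (Suc m) k s)"
proof
  fix r
  have "int (d s - root (Suc m) k s) = int (d s) - int (root (Suc m) k s)" for s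
    using assms(4) by (simp add: of_nat_diff)
  then show "shift k (Suc m) (expo n d) r = expo n (\<lambda>s. d s - root (Suc m) k s) r"
    using assms(1-3) by (auto simp: shift_def expo_def root_def)
qed

lemma prod_fact_step:
  assumes "1 \<le> k" "k \<le> m" "m < n" "\<And>s. s \<in> {k..m} \<Longrightarrow> d s \<noteq> 0"
  shows "(\<Prod>s\<in>{k..m}. d s) * (\<Prod>s\<in>{1..<n}. fact (d s - root (Suc m) k s)) = (\<Prod>s\<in>{1..<n}. fact (d s) :: nat)"
proof -
  have "(\<Prod>s\<in>{k..m}. d s) = (\<Prod>s\<in>{1..<n}. if s \<in> {k..m} then d s else 1)"
    using assms(1-3) by (subst prod.inter_restrict[symmetric]) (auto intro!: prod.cong)
  moreover have "(if s \<in> {k..m} then d s else 1) * fact (d s - root (Suc m) k s) = (fact (d s) :: nat)" for s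
    using assms(4)[of s] by (cases "d s") (auto simp: root_def)
  ultimately show ?thesis by (simp add: prod.distrib[symmetric] cong: prod.cong)
qed

context verma
begin

lemma bas_zero: "bas (\<lambda>_ _. 0) = v"
proof -
  have "foldr (\<lambda>(i, j) w. (E i j ^^ 0) w) xs v = v" for xs :: "(nat \<times> nat) list"
    by (induction xs) auto
  then show ?thesis by (simp add: pbw_def)
qed

text \<open>At exponent 0 the derivative part never returns to \<open>x^0\<close>, so the map is the
  identity and its graded trace is the character.\<close>

lemma btr_zero: "btr (\<lambda>_ _. 0) (\<lambda>_. 0) = vander n"
proof (rule ps_eqI)
  fix d
  have "cf (pbw n tE \<beta> (sgl v (\<lambda>_. 0)) (\<lambda>_. 0)) \<beta> = 1" if "\<beta> \<in> GammaW n d" for \<beta>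
  proof -
    have "pbw n tE \<beta> (sgl v (\<lambda>_. 0)) (\<lambda>_. 0) = bas \<beta>"
      by (subst tilde_pbw_at_zero) (auto simp: sgl_def)
    then show ?thesis using that by (simp add: cf_bas GammaW_def)
  qed
  then show "ps_nth (btr (\<lambda>_ _. 0) (\<lambda>_. 0)) d = ps_nth (vander n) d"
    by (simp add: btr_def bas_zero trace_ps_nth trace_def vander_nth)
qed

text \<open>Row \<open>k\<close> of a diagonal index has its only possible entry at
  \<open>k - 1\<close>. Hence the commutator sum of \<open>btr_incr\<close> has at most one term, in
  which \<open>E_(m+1,k)\<close> becomes \<open>E_(m+1,k-1)\<close> at the cost of one factor
  \<open>E_(k,k-1)\<close>.\<close>

lemma btr_diag_rec:
  assumes m: "m < n" and top: "\<And>s. m < s \<Longrightarrow> d s = 0"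
    and k: "1 \<le> k" "k \<le> m" and le: "\<forall>s. root (Suc m) k s \<le> d s"
  shows "btr (incr (Suc m) k (diag n (\<lambda>s. d s - root (Suc m) k s))) (expo n d) =
    ps_geom (root (Suc m) k) * ps_monom (root (Suc m) k) *
    ((if k = 1 then 0 else ps_const (of_nat (d (k - 1))) *
        btr (incr (Suc m) (k - 1) (diag n (\<lambda>s. d s - root (Suc m) (k - 1) s))) (expo n d)) +
     ps_const (of_int (expo n d k) + \<mu>) *
        btr (diag n (\<lambda>s. d s - root (Suc m) k s)) (expo n (\<lambda>s. d s - root (Suc m) k s)))"
proof -
  let ?D = "\<lambda>k. diag n (\<lambda>s. d s - root (Suc m) k s)"
  have "(\<Sum>l\<in>{1..<k}. ps_const (of_nat (?D k k l)) * btr (incr (Suc m) l (decr k l (?D k))) (expo n d)) =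
    (if k = 1 then 0 else ps_const (of_nat (d (k - 1))) * btr (incr (Suc m) (k - 1) (?D (k - 1))) (expo n d))"
  proof (cases "k = 1")
    case False
    then obtain k' where k': "k = Suc k'" "1 \<le> k'" using k by (cases k) auto
    have D: "?D k k l = (if l = k' then d k' else 0)" if "l \<in> {1..<k}" for l
      using that k k' m by (auto simp: diag_def root_def)
    have dec: "decr k k' (?D k) = ?D k'"
      using k k' m by (auto simp: fun_eq_iff decr_def diag_def root_def)
    have "(\<Sum>l\<in>{1..<k}. ps_const (of_nat (?D k k l)) * btr (incr (Suc m) l (decr k l (?D k))) (expo n d)) =
      (\<Sum>l\<in>{1..<k}. if l = k' then ps_const (of_nat (d k')) * btr (incr (Suc m) k' (?D k')) (expo n d) else 0)"
      by (rule sum.cong) (auto simp: D dec)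
    also have "\<dots> = ps_const (of_nat (d k')) * btr (incr (Suc m) k' (?D k')) (expo n d)"
      by (subst sum.delta) (use k' in auto)
    finally show ?thesis using k' by simp
  qed simp
  moreover have "?D k r (Suc m) = 0" if "Suc m < r" for r
    using top[of "Suc m"] by (simp add: diag_def)
  ultimately show ?thesis
    using btr_incr[of k "Suc m" "?D k" "expo n d"] k m expo_step[OF k m le] by (simp add: GammaA_diag)
qed

text \<open>The left side carries what has accumulated when \<open>E_(m+1,m)\<close> has been traded
  down to \<open>E_(m+1,k)\<close>: the path weight and the multiplicities. The induction goes
  upwards because the trace at \<open>k\<close> reduces to that at \<open>k - 1\<close>; at
  \<open>k = m\<close> the path weight is 1.\<close>

lemma btr_diag_step:
  assumes m: "m < n" and top: "\<And>s. m < s \<Longrightarrow> d s = 0"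
    and IH: "\<And>k. 1 \<le> k \<Longrightarrow> k \<le> m \<Longrightarrow> \<forall>s. root (Suc m) k s \<le> d s \<Longrightarrow>
      btr (diag n (\<lambda>s. d s - root (Suc m) k s)) (expo n (\<lambda>s. d s - root (Suc m) k s)) =
      ps_const (of_nat (\<Prod>s\<in>{1..<n}. fact (d s - root (Suc m) k s))) * vander n *
        hyper_weight n \<mu> (\<lambda>s. d s - root (Suc m) k s)"
    and k: "1 \<le> k" "k \<le> m" "\<forall>s\<in>{k..m}. d s \<noteq> 0"
  shows "path_factor (Suc m) (Suc k) * ps_const (of_nat (\<Prod>s\<in>{k..m}. d s)) *
      btr (incr (Suc m) k (diag n (\<lambda>s. d s - root (Suc m) k s))) (expo n d) =
    ps_const (of_nat (\<Prod>s\<in>{1..<n}. fact (d s))) * vander n * (\<Sum>l\<in>{1..k}. hyper_step n \<mu> d m l)"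
  using k
proof (induction k)
  case (Suc k')
  define k where "k = Suc k'"
  have k: "1 \<le> k" "k \<le> m" "\<forall>s\<in>{k..m}. d s \<noteq> 0" using Suc.prems by (auto simp: k_def)
  let ?B = "\<lambda>k. btr (incr (Suc m) k (diag n (\<lambda>s. d s - root (Suc m) k s))) (expo n d)"
  let ?c = "\<lambda>k. \<Prod>s\<in>{k..m}. d s"
  let ?F = "ps_const (of_nat (\<Prod>s\<in>{1..<n}. fact (d s)))"
  let ?Fk = "\<Prod>s\<in>{1..<n}. fact (d s - root (Suc m) k s)"
  let ?Gk = "hyper_weight n \<mu> (\<lambda>s. d s - root (Suc m) k s)"
  have le: "\<forall>s. root (Suc m) k s \<le> d s"
  proof
    fix s show "root (Suc m) k s \<le> d s" using k(3) by (cases "s \<in> {k..m}") (auto simp: root_def Suc_le_eq)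
  qed
  have "?c k * ?Fk = (\<Prod>s\<in>{1..<n}. fact (d s))"
    using k m by (intro prod_fact_step) auto
  then have F: "?F = ps_const (of_nat (?c k)) * ps_const (of_nat ?Fk)"
    by (simp only: ps_const_mult[symmetric] of_nat_mult[symmetric])
  have step: "hyper_step n \<mu> d m k = ps_const (of_int (expo n d k) + \<mu>) * path_factor (Suc m) k * ?Gk"
    using le by (simp add: hyper_step_def)
  let ?R = "path_factor (Suc m) k * ps_const (of_nat (?c k)) *
    (if k = 1 then 0 else ps_const (of_nat (d (k - 1))) * ?B (k - 1))"
  have "path_factor (Suc m) (Suc k) * ps_const (of_nat (?c k)) * ?B k =
     ?R + ?F * vander n * hyper_step n \<mu> d m k"
    using btr_diag_rec[OF m top k(1,2) le] IH[OF k(1,2) le] path_factor_step[of k "Suc m"] k(2) F step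
    by (simp only: less_Suc_eq_le distrib_left mult_ac)
  moreover have "?R = ?F * vander n * (\<Sum>l\<in>{1..k'}. hyper_step n \<mu> d m l)"
  proof (cases "k = 1")
    case True
    then show ?thesis by (simp add: k_def)
  next
    case False
    show ?thesis
    proof (cases "d k' = 0")
      \<comment> \<open>No factor \<open>E_(k,k-1)\<close> is present, so the path stops.
        Correspondingly, each root with \<open>l \<le> k'\<close> passes through place
        \<open>k'\<close>, does not fit into \<open>d\<close>, and has step 0.\<close>
      case True
      have "hyper_step n \<mu> d m l = 0" if "l \<in> {1..k'}" for l
      proof -
        have "\<not> root (Suc m) l k' \<le> d k'" using that k True by (simp add: root_def k_def)
        then show ?thesis unfolding hyper_step_def by (meson)
      qed
      then have "(\<Sum>l\<in>{1..k'}. hyper_step n \<mu> d m l) = 0" by (intro sum.neutral) auto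
      then show ?thesis using True by (simp add: k_def)
    next
      case nz: False
      have set: "{k'..m} = insert k' {k..m}" using k by (auto simp: k_def)
      have "\<forall>s\<in>{k'..m}. d s \<noteq> 0" using k(3) nz by (simp add: set)
      moreover have "?c k' = d k' * ?c k" unfolding set by (simp add: k_def)
      ultimately have "path_factor (Suc m) k * ps_const (of_nat (d k' * ?c k)) * ?B k' =
          ?F * vander n * (\<Sum>l\<in>{1..k'}. hyper_step n \<mu> d m l)"
        using Suc.IH False k(2) by (simp add: k_def)
      then show ?thesis using False by (simp add: k_def ps_const_mult mult_ac)
    qed
  qed
  ultimately show ?case by (simp add: k_def distrib_left)
qed simp

lemma btr_diag:
  assumes "\<And>s. d s \<noteq> 0 \<Longrightarrow> 1 \<le> s \<and> s < n"
  shows "btr (diag n d) (expo n d) =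
    ps_const (of_nat (\<Prod>s\<in>{1..<n}. fact (d s))) * vander n * hyper_weight n \<mu> d"
  using assms
proof (induction "sum d {1..<n}" arbitrary: d rule: less_induct)
  case less
  show ?case
  proof (cases "d = (\<lambda>_. 0)")
    case True
    have "diag n (\<lambda>_. 0) = (\<lambda>_ _. 0)" "expo n (\<lambda>_. 0) = (\<lambda>_. 0)"
      by (auto simp: diag_def expo_def fun_eq_iff)
    then show ?thesis by (simp add: True btr_zero hyper_weight_zero)
  next
    case False
    let ?S = "{s. d s \<noteq> 0}"
    define m where "m = Max ?S"
    have fin: "finite ?S" by (rule finite_subset[of _ "{..<n}"]) (use less.prems in auto)
    have "?S \<noteq> {}" using False by (auto simp: fun_eq_iff)
    then have dm: "d m \<noteq> 0" using Max_in[OF fin] by (simp add: m_def)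
    have top: "d s = 0" if "m < s" for s
      using Max_ge[OF fin, of s] that by (auto simp: m_def)
    have m: "1 \<le> m" "m < n" using less.prems[OF dm] by auto
    have IH: "btr (diag n (\<lambda>s. d s - root (Suc m) k s)) (expo n (\<lambda>s. d s - root (Suc m) k s)) =
      ps_const (of_nat (\<Prod>s\<in>{1..<n}. fact (d s - root (Suc m) k s))) * vander n *
        hyper_weight n \<mu> (\<lambda>s. d s - root (Suc m) k s)" if k: "1 \<le> k" "k \<le> m" for k
    proof (rule less.hyps)
      show "(\<Sum>s\<in>{1..<n}. d s - root (Suc m) k s) < sum d {1..<n}"
      proof (rule sum_strict_mono_ex1)
        show "\<exists>s\<in>{1..<n}. d s - root (Suc m) k s < d s"
          using m k dm by (intro bexI[of _ m]) (auto simp: root_def)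
      qed auto
      show "1 \<le> s \<and> s < n" if "d s - root (Suc m) k s \<noteq> 0" for s
        using less.prems[of s] that by auto
    qed
    have rec: "ps_const (of_nat (d m)) * hyper_weight n \<mu> d = (\<Sum>l\<in>{1..m}. hyper_step n \<mu> d m l)"
      by (rule hyper_weight_rec) (use m top in auto)
    have "diag n d = incr (Suc m) m (diag n (\<lambda>s. d s - root (Suc m) m s))"
      using m dm by (auto simp: fun_eq_iff diag_def incr_apply root_def)
    then have "ps_const (of_nat (d m)) * btr (diag n d) (expo n d) =
        ps_const (of_nat (\<Prod>s\<in>{1..<n}. fact (d s))) * vander n * (\<Sum>l\<in>{1..m}. hyper_step n \<mu> d m l)"
      using btr_diag_step[of m d m, OF m(2) top IH m(1)] dm by (simp add: path_factor_def)
    also have "\<dots> = ps_const (of_nat (d m)) *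
        (ps_const (of_nat (\<Prod>s\<in>{1..<n}. fact (d s))) * vander n * hyper_weight n \<mu> d)"
      unfolding rec[symmetric] by (simp only: mult_ac)
    \<comment> \<open>\<open>ps\<close> is only known to be a commutative ring, so
      \<open>d m\<close> is cancelled by means of its constant inverse.\<close>
    finally have "ps_const (1 / of_nat (d m)) * ps_const (of_nat (d m)) * btr (diag n d) (expo n d) =
        ps_const (1 / of_nat (d m)) * ps_const (of_nat (d m)) *
        (ps_const (of_nat (\<Prod>s\<in>{1..<n}. fact (d s))) * vander n * hyper_weight n \<mu> d)"
      by (simp only: mult.assoc)
    then show ?thesis using dm by (simp add: ps_const_mult[symmetric])
  qed
qed

end

section \<open>The hypergeometric function as a power series\<close>

text \<open>Needed to see that only finitely many \<open>\<beta>\<close> contribute to a given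
  coefficient of the hypergeometric series.\<close>

definition ord_ge :: "(nat \<Rightarrow> nat) \<Rightarrow> ps \<Rightarrow> bool" where
  "ord_ge a f \<longleftrightarrow> (\<forall>m. ps_nth f m \<noteq> 0 \<longrightarrow> (\<forall>s. a s \<le> m s))"

lemma ord_ge_zero: "ord_ge (\<lambda>_. 0) f"
  by (simp add: ord_ge_def)

lemma ord_ge_mult:
  assumes "ord_ge a f" "ord_ge b g"
  shows "ord_ge (\<lambda>s. a s + b s) (f * g)"
  unfolding ord_ge_def
proof (intro allI impI)
  fix m s
  assume "ps_nth (f * g) m \<noteq> 0"
  then obtain p where "(\<lambda>i. fst p i + snd p i) = m" "ps_nth f (fst p) * ps_nth g (snd p) \<noteq> 0"
    unfolding times_ps.rep_eq mps_mult_def by (auto elim: sum.not_neutral_contains_not_neutral)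
  then show "a s + b s \<le> m s"
    using assms by (auto simp: ord_ge_def intro: add_mono)
qed

lemma ord_ge_power: "ord_ge a f \<Longrightarrow> ord_ge (\<lambda>s. k * a s) (f ^ k)"
  by (induction k) (auto simp: ord_ge_zero dest: ord_ge_mult)

lemma ord_ge_prod:
  "(\<And>p. p \<in> A \<Longrightarrow> ord_ge (a p) (f p)) \<Longrightarrow> ord_ge (\<lambda>s. \<Sum>p\<in>A. a p s) (\<Prod>p\<in>A. f p)"
  by (induction A rule: infinite_finite_induct) (simp_all add: ord_ge_zero ord_ge_mult)

lemma ord_ge_monom: "ord_ge a (ps_monom a)"
  by (auto simp: ord_ge_def ps_monom.rep_eq mps_monom_def split: if_splits)

lemma ord_ge_monom_mult: "ord_ge a (ps_monom a * f)"
  using ord_ge_mult[OF ord_ge_monom ord_ge_zero, of a f] by simp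

definition xi :: "nat \<Rightarrow> nat \<Rightarrow> ps" where
  "xi r k = (\<Prod>s\<in>{k..<r}. - ps_monom (root r s) * ps_geom (root r s))"

definition xi_prod :: "nat \<Rightarrow> (nat \<Rightarrow> nat \<Rightarrow> nat) \<Rightarrow> ps" where
  "xi_prod n \<beta> = (\<Prod>p\<in>set (pairs n). xi (fst p) (snd p) ^ \<beta> (fst p) (snd p))"

lemma xiA_eq: "xiA r k = ps_nth (xi r k)"
proof -
  have "mps_mult (mps_scale (-1) (mps_monom (root r s))) (mps_geom (root r s)) =
      ps_nth (- ps_monom (root r s) * ps_geom (root r s))" for s
  proof -
    have "mps_scale (-1) (mps_monom (root r s)) = ps_nth (- ps_monom (root r s))"
      unfolding uminus_ps.rep_eq ps_monom.rep_eq by (simp only: finite_root if_True) (simp add: mps_scale_def)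
    then show ?thesis by (simp only: times_ps.rep_eq ps_nth_geom_root)
  qed
  then have "xiA r k = ps_nth (prod_list (map (\<lambda>s. - ps_monom (root r s) * ps_geom (root r s)) [k..<r]))"
    unfolding xiA_def by (simp only: mps_prod_eq_ps_nth)
  also have "prod_list (map (\<lambda>s. - ps_monom (root r s) * ps_geom (root r s)) [k..<r]) = xi r k"
    unfolding xi_def
    by (subst prod.distinct_set_conv_list[symmetric, OF distinct_upt]) simp
  finally show ?thesis .
qed

lemma mps_prod_xiA:
  "mps_prod (map (\<lambda>(j, k). mps_power (xiA j k) (\<beta> j k)) (pairs n)) = ps_nth (xi_prod n \<beta>)"
proof -
  have "mps_prod (map (\<lambda>(j, k). mps_power (xiA j k) (\<beta> j k)) (pairs n)) =
      mps_prod (map (\<lambda>p. ps_nth (xi (fst p) (snd p) ^ \<beta> (fst p) (snd p))) (pairs n))"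
    by (simp add: xiA_eq mps_power_eq_ps_nth case_prod_unfold)
  then show ?thesis
    by (simp only: mps_prod_eq_ps_nth xi_prod_def prod.distinct_set_conv_list[OF distinct_pairs])
qed

lemma ord_ge_xi:
  assumes "k < r"
  shows "ord_ge (root r k) (xi r k)"
proof -
  have "{k..<r} = insert k {Suc k..<r}" using assms by auto
  then have "xi r k = ps_monom (root r k) * (- ps_geom (root r k) *
      (\<Prod>s\<in>{Suc k..<r}. - ps_monom (root r s) * ps_geom (root r s)))"
    by (simp add: xi_def)
  then show ?thesis by (simp only: ord_ge_monom_mult)
qed

lemma ord_ge_xi_prod: "ord_ge (wt n \<beta>) (xi_prod n \<beta>)"
proof -
  have "ord_ge (\<lambda>s. \<Sum>p\<in>set (pairs n). \<beta> (fst p) (snd p) * root (fst p) (snd p) s) (xi_prod n \<beta>)"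
    unfolding xi_prod_def
    by (intro ord_ge_prod ord_ge_power ord_ge_xi) (auto simp: set_pairs)
  moreover have "(\<lambda>s. \<Sum>p\<in>set (pairs n). \<beta> (fst p) (snd p) * root (fst p) (snd p) s) = wt n \<beta>"
    by (simp add: wt_def fun_eq_iff)
  ultimately show ?thesis by simp
qed

lemma xi_eq_path_factor: "xi r k = (-1) ^ (r - k) * path_factor r k"
proof -
  have "xi r k = (\<Prod>s\<in>{k..<r}. (-1) * (ps_geom (root r s) * ps_monom (root r s)))"
    unfolding xi_def by (rule prod.cong) (simp_all add: mult_ac)
  then show ?thesis unfolding prod.distrib path_factor_def by simp
qed

text \<open>Each \<open>xi r k\<close> has \<open>r - k\<close> signs, which is the number of simple
  roots in \<open>root r k\<close>. The total sign therefore depends on the weight alone and is the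
  sign in the singular vector.\<close>

lemma xi_prod_eq_path_prod: "xi_prod n \<beta> = (-1) ^ (\<Sum>s\<in>{1..<n}. wt n \<beta> s) * path_prod n \<beta>"
proof -
  have "xi_prod n \<beta> = (\<Prod>p\<in>set (pairs n). (-1) ^ ((fst p - snd p) * \<beta> (fst p) (snd p)) *
      path_factor (fst p) (snd p) ^ \<beta> (fst p) (snd p))"
    unfolding xi_prod_def by (simp add: xi_eq_path_factor power_mult_distrib power_mult)
  also have "\<dots> = (-1) ^ (\<Sum>p\<in>set (pairs n). (fst p - snd p) * \<beta> (fst p) (snd p)) * path_prod n \<beta>"
    by (simp add: prod.distrib power_sum path_prod_def)
  also have "(\<Sum>p\<in>set (pairs n). (fst p - snd p) * \<beta> (fst p) (snd p)) = (\<Sum>s\<in>{1..<n}. wt n \<beta> s)"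
  proof -
    have "fst p - snd p = (\<Sum>s\<in>{1..<n}. root (fst p) (snd p) s)" if "p \<in> set (pairs n)" for p
    proof -
      have "(\<Sum>s\<in>{1..<n}. root (fst p) (snd p) s) = card ({1..<n} \<inter> {snd p..<fst p})"
        by (simp add: root_def sum.If_cases Collect_conj_eq[symmetric] atLeastLessThan_def
            atLeast_def lessThan_def)
      also have "{1..<n} \<inter> {snd p..<fst p} = {snd p..<fst p}" using that by (auto simp: set_pairs)
      finally show ?thesis by simp
    qed
    then have "(\<Sum>p\<in>set (pairs n). (fst p - snd p) * \<beta> (fst p) (snd p)) =
        (\<Sum>p\<in>set (pairs n). \<Sum>s\<in>{1..<n}. \<beta> (fst p) (snd p) * root (fst p) (snd p) s)"
      by (intro sum.cong) (simp_all add: sum_distrib_left[symmetric] mult.commute)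
    also have "\<dots> = (\<Sum>s\<in>{1..<n}. wt n \<beta> s)"
      unfolding wt_def by (rule sum.swap)
    finally show ?thesis .
  qed
  finally show ?thesis .
qed

text \<open>By the order bound, coefficients up to \<open>d\<close> see only \<open>\<beta>\<close>
  of weight at most \<open>d\<close>. \<open>B\<close> may be larger, since truncating the singular
  vector brings in further weights.\<close>

lemma rhs_series_eq:
  assumes B: "finite B" "B \<subseteq> GammaA n" "{\<beta> \<in> GammaA n. \<forall>s. wt n \<beta> s \<le> d s} \<subseteq> B"
  shows "rhs_series n \<mu> \<sigma> d = ps_nth (vander n *
    (\<Sum>\<beta>\<in>B. ps_const (coeffA n (\<lambda>s. if s < n then \<mu> + 1 else - \<mu>) (- \<sigma>) \<beta>) * xi_prod n \<beta>)) d"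
proof -
  let ?c = "coeffA n (\<lambda>s. if s < n then \<mu> + 1 else - \<mu>) (- \<sigma>)"
  let ?H = "\<Sum>\<beta>\<in>B. ps_const (?c \<beta>) * xi_prod n \<beta>"
  have "hyperA n (\<lambda>s. if s < n then \<mu> + 1 else - \<mu>) (- \<sigma>) xiA m = ps_nth ?H m" if le: "\<forall>s. m s \<le> d s" for m
  proof -
    have "hyperA n (\<lambda>s. if s < n then \<mu> + 1 else - \<mu>) (- \<sigma>) xiA m =
        (\<Sum>\<beta>\<in>{\<beta> \<in> GammaA n. ?c \<beta> * ps_nth (xi_prod n \<beta>) m \<noteq> 0}. ?c \<beta> * ps_nth (xi_prod n \<beta>) m)"
      by (simp add: hyperA_def mps_sum_def mps_scale_def mps_prod_xiA)
    also have "\<dots> = (\<Sum>\<beta>\<in>B. ?c \<beta> * ps_nth (xi_prod n \<beta>) m)"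
    proof (rule sum.mono_neutral_left)
      show "{\<beta> \<in> GammaA n. ?c \<beta> * ps_nth (xi_prod n \<beta>) m \<noteq> 0} \<subseteq> B"
      proof
        fix \<beta> assume \<beta>: "\<beta> \<in> {\<beta> \<in> GammaA n. ?c \<beta> * ps_nth (xi_prod n \<beta>) m \<noteq> 0}"
        then have "\<forall>s. wt n \<beta> s \<le> m s" using ord_ge_xi_prod[of n \<beta>] by (simp add: ord_ge_def)
        then have "\<forall>s. wt n \<beta> s \<le> d s" using le order.trans by blast
        then show "\<beta> \<in> B" using \<beta> B(3) by blast
      qed
    qed (use B in auto)
    also have "\<dots> = ps_nth ?H m" by (simp add: ps_nth_sum ps_nth_const_mult)
    finally show ?thesis .
  qed
  then show ?thesis
    unfolding rhs_series_def vandermonde_factor_eq times_ps.rep_eq mps_mult_def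
    by (intro sum.cong refl) auto
qed

section \<open>Matching the coefficients of the singular vector with those of the hypergeometric
  function\<close>

lemma falling_eq: "falling c k = (-1) ^ k * pochhammer (- c) k"
  by (induction k) (simp_all add: falling_def pochhammer_Suc algebra_simps)

definition u_coeff :: "nat \<Rightarrow> complex \<Rightarrow> complex \<Rightarrow> (nat \<Rightarrow> nat) \<Rightarrow> complex" where
  "u_coeff n \<mu> \<sigma> d = (-1) ^ (\<Sum>s\<in>{1..<n}. d s) * falling \<mu> (d (n - 1))
     / (of_nat (\<Prod>s\<in>{1..<n}. fact (d s)) * falling \<sigma> (d (n - 1)))"

text \<open>Row \<open>n\<close> of \<open>\<beta>\<close> has sum \<open>d (n - 1)\<close>, so the
  quotient of falling factorials in \<open>u\<close> is the missing index-\<open>n\<close> factor of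
  \<open>coeffA\<close>; the signs of the two falling factorials cancel.\<close>

lemma u_coeff_hyper_term:
  assumes n: "1 \<le> n" and \<beta>: "\<beta> \<in> GammaW n d"
  shows "ps_const (u_coeff n \<mu> \<sigma> d) * ps_const (of_nat (\<Prod>s\<in>{1..<n}. fact (d s))) * hyper_term n \<mu> \<beta> =
    ps_const (coeffA n (\<lambda>s. if s < n then \<mu> + 1 else - \<mu>) (- \<sigma>) \<beta>) * xi_prod n \<beta>"
proof -
  let ?k = "d (n - 1)"
  let ?q = "pochhammer (- \<mu>) ?k / pochhammer (- \<sigma>) ?k"
  have wt: "wt n \<beta> = d" "\<beta> \<in> GammaA n" using \<beta> by (auto simp: GammaW_def)
  have "wt n \<beta> (n - 1) = (\<Sum>l\<in>{1..n-1}. \<beta> (Suc (n - 1)) l)"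
    using n wt_outside[of n \<beta>] by (intro wt_top(2) wt) fastforce+
  also have "\<dots> = beta_under \<beta> n"
    unfolding beta_under_def by (rule sum.cong) (use n in auto)
  finally have under: "beta_under \<beta> n = ?k" by (simp add: wt)
  have "falling \<mu> ?k / falling \<sigma> ?k = ?q" by (simp add: falling_eq)
  moreover have "(\<Prod>s\<in>{1..<n}. fact (d s)) \<noteq> (0 :: nat)" by (simp add: prod_zero_iff)
  moreover have "x * a / (F * b) * F = x * (a / b)" if "F \<noteq> 0" for x a b F :: complex
    using that by simp
  ultimately have u: "u_coeff n \<mu> \<sigma> d * of_nat (\<Prod>s\<in>{1..<n}. fact (d s)) = (-1) ^ (\<Sum>s\<in>{1..<n}. d s) * ?q"
    unfolding u_coeff_def by (metis of_nat_eq_0_iff)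
  have "coeffA n (\<lambda>s. if s < n then \<mu> + 1 else - \<mu>) (- \<sigma>) \<beta> = poch_prod n \<mu> \<beta> / of_nat (beta_fact n \<beta>) * ?q"
  proof -
    have "(\<Prod>s\<in>{1..n-1}. pochhammer ((if s < n then \<mu> + 1 else - \<mu>) - of_nat (beta_under \<beta> s)) (beta_over n \<beta> s)) =
        poch_prod n \<mu> \<beta>"
      unfolding poch_prod_def by (rule prod.cong) auto
    then show ?thesis by (simp add: coeffA_def under)
  qed
  then show ?thesis
    unfolding ps_const_mult[symmetric] u xi_prod_eq_path_prod hyper_term_def
    by (simp only: ps_const_mult ps_const_minus_one_power wt mult_ac)
qed

section \<open>The trace of the singular vector\<close>

definition idx :: "nat \<Rightarrow> (nat \<Rightarrow> int) \<Rightarrow> nat \<Rightarrow> nat" where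
  "idx n k m = (if 1 \<le> m \<and> m < n then nat (\<Sum>r\<in>{1..m}. k r) else 0)"

lemma sum_expo:
  assumes "d 0 = 0" "m \<le> n"
  shows "(\<Sum>r\<in>{1..m}. expo n d r) = int (d m)"
  using assms(2) by (induction m) (simp_all add: assms(1) expo_def)

lemma idx_expo:
  assumes "\<And>s. d s \<noteq> 0 \<Longrightarrow> 1 \<le> s \<and> s < n"
  shows "idx n (expo n d) = d"
proof
  fix m
  have "d 0 = 0" using assms[of 0] by auto
  then show "idx n (expo n d) m = d m"
    using assms[of m] sum_expo[of d m n] by (auto simp: idx_def)
qed

lemma pbw_diag: "m \<le> n \<Longrightarrow> pbw m E (diag n d) w = foldr (\<lambda>s w. (E (s + 1) s ^^ d s) w) [1..<m] w"
proof (induction m arbitrary: w)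
  case (Suc m)
  show ?case
  proof (cases "m = 0")
    case True
    then show ?thesis by (simp add: pbw_Suc pbw_0 pbw_row_def)
  next
    case False
    have "foldr (\<lambda>j. E (Suc m) j ^^ diag n d (Suc m) j) xs w = w" if "set xs \<subseteq> {1..<m}" for xs w
      using that by (induction xs) (auto simp: diag_def)
    then have "pbw_row E (diag n d) (Suc m) w = (E (Suc m) m ^^ d m) w"
      using False Suc.prems by (simp add: pbw_row_def diag_def)
    then show ?thesis using Suc False by (simp add: pbw_Suc)
  qed
qed (simp add: pbw_0)

lemma u_vec_expo:
  assumes "1 \<le> n" "\<And>s. d s \<noteq> 0 \<Longrightarrow> 1 \<le> s \<and> s < n"
  shows "u_vec n scale E v \<mu> \<sigma> (expo n d) = scale (u_coeff n \<mu> \<sigma> d) (pbw n E (diag n d) v)"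
proof -
  have d0: "d 0 = 0" "d n = 0" using assms(2)[of 0] assms(2)[of n] by auto
  let ?i = "\<lambda>m. nat (\<Sum>r\<in>{1..m}. expo n d r)"
  have i: "?i m = d m" if "m \<le> n" for m
    using sum_expo[of d m n, OF d0(1) that] by simp
  have cond: "(\<forall>r. (r < 1 \<or> n < r) \<longrightarrow> expo n d r = 0) \<and> (\<Sum>r\<in>{1..n}. expo n d r) = 0
         \<and> (\<forall>m\<in>{1..<n}. (\<Sum>r\<in>{1..m}. expo n d r) \<ge> 0)"
    using sum_expo[of d _ n, OF d0(1)] d0 by (auto simp: expo_def)
  have "(\<Sum>m\<in>{1..<n}. ?i m) = sum d {1..<n}" "(\<Prod>m\<in>{1..<n}. fact (?i m) :: nat) = (\<Prod>m\<in>{1..<n}. fact (d m))"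
    "?i (n - 1) = d (n - 1)"
    using i by (auto intro!: sum.cong prod.cong)
  moreover have "foldr (\<lambda>m w. (E (m + 1) m ^^ ?i m) w) [1..<n] v = foldr (\<lambda>m w. (E (m + 1) m ^^ d m) w) [1..<n] v"
  proof (rule foldr_cong[OF refl refl])
    fix m w assume "m \<in> set [1..<n]"
    then have "?i m = d m" by (intro i) simp
    then show "(E (m + 1) m ^^ ?i m) w = (E (m + 1) m ^^ d m) w" by (simp only:)
  qed
  ultimately show ?thesis
    unfolding u_vec_def Let_def if_P[OF cond] u_coeff_def pbw_diag[OF order.refl] by (simp only:)
qed

text \<open>Partial sums of the exponents telescope to \<open>i_1, ..., i_(n-1)\<close>, so
  \<open>idx\<close> inverts \<open>expo\<close> on the support of the singular vector.\<close>

lemma u_vec_nonzero: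
  assumes "u_vec n scale E v \<mu> \<sigma> k \<noteq> 0"
  shows "k = expo n (idx n k)"
proof
  fix r
  have out: "\<And>r. r < 1 \<or> n < r \<Longrightarrow> k r = 0" and tot: "(\<Sum>r\<in>{1..n}. k r) = 0"
    and nonneg: "\<And>m. m \<in> {1..<n} \<Longrightarrow> (\<Sum>r\<in>{1..m}. k r) \<ge> 0"
    using assms unfolding u_vec_def by (auto split: if_splits)
  have idx: "int (idx n k m) = (\<Sum>r\<in>{1..m}. k r)" if "m \<le> n" for m
    using that tot nonneg[of m] by (cases "m = 0"; cases "m = n") (auto simp: idx_def)
  show "k r = expo n (idx n k) r"
  proof (cases "1 \<le> r \<and> r \<le> n")
    case True
    then obtain r' where "r = Suc r'" by (cases r) auto
    then show ?thesis using True idx[of r] idx[of r'] by (simp add: expo_def)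
  next
    case False
    then show ?thesis using out[of r] by (auto simp: expo_def)
  qed
qed

context verma
begin

lemma trace_local:
  "\<exists>K. finite K \<and> (\<forall>u u'. (\<forall>k\<in>K. u k = u' k) \<longrightarrow> trace u d = trace u' d)"
proof -
  obtain K where K: "\<And>\<beta>. finite (K \<beta>)"
    "\<And>\<beta> u u'. \<forall>k\<in>K \<beta>. u k = u' k \<Longrightarrow> pbw n tE \<beta> u (\<lambda>_. 0) = pbw n tE \<beta> u' (\<lambda>_. 0)"
    using tilde_pbw_local[of \<mu> _ "\<lambda>_. 0"] by metis
  have "trace u d = trace u' d" if "\<forall>k\<in>\<Union>\<beta>\<in>GammaW n d. K \<beta>. u k = u' k" for u u'
    unfolding trace_def
  proof (rule sum.cong[OF refl])
    fix \<beta> assume "\<beta> \<in> GammaW n d"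
    then have "pbw n tE \<beta> u (\<lambda>_. 0) = pbw n tE \<beta> u' (\<lambda>_. 0)" using that by (intro K(2)) blast
    then show "cf (pbw n tE \<beta> u (\<lambda>_. 0)) \<beta> = cf (pbw n tE \<beta> u' (\<lambda>_. 0)) \<beta>" by simp
  qed
  then show ?thesis using K(1) finite_GammaW by (intro exI[of _ "\<Union>\<beta>\<in>GammaW n d. K \<beta>"]) blast
qed

lemma trace_u_vec:
  assumes n: "1 \<le> n" and d: "\<And>s. d s \<noteq> 0 \<Longrightarrow> 1 \<le> s \<and> s < n"
  shows "trace (u_vec n scale E v \<mu> \<sigma>) d = rhs_series n \<mu> \<sigma> d"
proof -
  let ?u = "u_vec n scale E v \<mu> \<sigma>"
  let ?c = "coeffA n (\<lambda>s. if s < n then \<mu> + 1 else - \<mu>) (- \<sigma>)"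
  obtain K where K: "finite K" "\<And>u'. \<forall>k\<in>K. ?u k = u' k \<Longrightarrow> trace ?u d = trace u' d"
    using trace_local[of d] by metis
  \<comment> \<open>The first set supplies all weights that the hypergeometric coefficient at
    \<open>d\<close> can see; the second makes the truncated singular vector agree with the full one
    on \<open>K\<close>.\<close>
  define I where "I = {e. \<forall>s. e s \<le> d s} \<union> idx n ` K"
  have "finite {s. d s \<noteq> 0}" by (rule finite_subset[of _ "{..<n}"]) (use d in auto)
  then have finI: "finite I" unfolding I_def using K(1) finite_le_fun by blast
  have supp: "1 \<le> s \<and> s < n" if "e \<in> I" "e s \<noteq> 0" for e s
  proof (cases "\<forall>s. e s \<le> d s")
    case True
    then have "d s \<noteq> 0" using that(2) by (metis le_zero_eq)
    then show ?thesis by (rule d)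
  next
    case False
    then show ?thesis using that by (auto simp: I_def idx_def split: if_splits)
  qed
  have "trace ?u d = trace (\<Sum>e\<in>I. sgl (?u (expo n e)) (expo n e)) d"
  proof (rule K(2), rule ballI)
    fix k assume k: "k \<in> K"
    have "(\<Sum>e\<in>I. sgl (?u (expo n e)) (expo n e)) k = (\<Sum>e\<in>I. if k = expo n e then ?u k else 0)"
      unfolding sum_fun_apply by (rule sum.cong) (auto simp: sgl_def)
    also have "\<dots> = ?u k"
    proof (cases "?u k = 0")
      case True
      show ?thesis unfolding True if_cancel by (rule sum.neutral_const)
    next
      case False
      then have ek: "k = expo n (idx n k)" by (rule u_vec_nonzero)
      have "k = expo n e \<longleftrightarrow> e = idx n k" if "e \<in> I" for e
        using ek idx_expo[of e n] supp[OF that] by auto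
      then have "(\<Sum>e\<in>I. if k = expo n e then ?u k else 0) = (\<Sum>e\<in>I. if e = idx n k then ?u k else 0)"
        by (intro sum.cong) auto
      also have "\<dots> = ?u k" using k finI by (simp add: I_def sum.delta)
      finally show ?thesis .
    qed
    finally show "?u k = (\<Sum>e\<in>I. sgl (?u (expo n e)) (expo n e)) k" by simp
  qed
  also have "\<dots> = ps_nth (\<Sum>e\<in>I. trace_ps (sgl (?u (expo n e)) (expo n e))) d"
    by (simp only: trace_ps_sum[symmetric] trace_ps_nth)
  also have "(\<Sum>e\<in>I. trace_ps (sgl (?u (expo n e)) (expo n e))) =
      (\<Sum>e\<in>I. vander n * (\<Sum>\<beta>\<in>GammaW n e. ps_const (?c \<beta>) * xi_prod n \<beta>))"
  proof (rule sum.cong[OF refl])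
    fix e assume "e \<in> I"
    then have supp': "1 \<le> s \<and> s < n" if "e s \<noteq> 0" for s using supp that by blast
    let ?F = "ps_const (of_nat (\<Prod>s\<in>{1..<n}. fact (e s)))"
    have "trace_ps (sgl (?u (expo n e)) (expo n e)) = ps_const (u_coeff n \<mu> \<sigma> e) * btr (diag n e) (expo n e)"
      by (subst u_vec_expo[OF n]) (rule supp', assumption, simp only: btr_def sgl_scale trace_ps_scale)
    also have "\<dots> = ps_const (u_coeff n \<mu> \<sigma> e) * (?F * vander n * hyper_weight n \<mu> e)"
      by (subst btr_diag) (rule supp', assumption, rule refl)
    also have "\<dots> = vander n * (\<Sum>\<beta>\<in>GammaW n e. ps_const (u_coeff n \<mu> \<sigma> e) * ?F * hyper_term n \<mu> \<beta>)"
      unfolding hyper_weight_def sum_distrib_left[symmetric] by (simp only: mult_ac)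
    also have "\<dots> = vander n * (\<Sum>\<beta>\<in>GammaW n e. ps_const (?c \<beta>) * xi_prod n \<beta>)"
      by (intro arg_cong2[of _ _ _ _ "(*)"] sum.cong refl u_coeff_hyper_term[OF n])
    finally show "trace_ps (sgl (?u (expo n e)) (expo n e)) =
        vander n * (\<Sum>\<beta>\<in>GammaW n e. ps_const (?c \<beta>) * xi_prod n \<beta>)" .
  qed
  also have "\<dots> = vander n * (\<Sum>\<beta>\<in>(\<Union>e\<in>I. GammaW n e). ps_const (?c \<beta>) * xi_prod n \<beta>)"
    unfolding sum_distrib_left[symmetric]
    by (subst sum.UNION_disjoint) (auto simp: finI finite_GammaW, auto simp: GammaW_def)
  also have "ps_nth \<dots> d = rhs_series n \<mu> \<sigma> d"
  proof (rule rhs_series_eq[symmetric])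
    show "finite (\<Union>e\<in>I. GammaW n e)" using finI finite_GammaW by blast
    show "(\<Union>e\<in>I. GammaW n e) \<subseteq> GammaA n" by (auto simp: GammaW_def)
    show "{\<beta> \<in> GammaA n. \<forall>s. wt n \<beta> s \<le> d s} \<subseteq> (\<Union>e\<in>I. GammaW n e)"
      by (auto simp: GammaW_def I_def)
  qed
  finally show ?thesis .
qed

end

theorem theorem3p3:
  fixes n :: nat and \<mu> \<sigma> :: complex and lam :: "nat \<Rightarrow> complex"
    and scale :: "complex \<Rightarrow> 'v::ab_group_add \<Rightarrow> 'v"
    and E :: "nat \<Rightarrow> nat \<Rightarrow> 'v \<Rightarrow> 'v" and v :: 'v
    and \<Phi> :: "'v \<Rightarrow> (nat \<Rightarrow> int) \<Rightarrow> 'v"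
  assumes n3: "n \<ge> 3"
    and lam: "\<forall>r\<in>{1..n-2}. lam r - lam (r+1) = \<mu>"
    and sig: "\<sigma> = lam (n-1) - lam n" and sigN: "\<sigma> \<notin> \<nat>"
    and verma: "is_verma n lam scale E v"
    and Phi_lin: "\<forall>a w w' k. \<Phi> (scale a w + w') k = scale a (\<Phi> w k) + \<Phi> w' k"
    and Phi_hom: "\<forall>i\<in>{1..n}. \<forall>j\<in>{1..n}. \<forall>w.
                    \<Phi> (E i j w) = tilde_action scale E \<mu> i j (\<Phi> w)"
    and Phi_v: "\<Phi> v = u_vec n scale E v \<mu> \<sigma>"
  shows "\<forall>\<nu>. etingof_coeff n scale E v \<Phi> \<nu> =
           (\<Sum>d\<in>{d. (\<forall>i. d i \<noteq> 0 \<longrightarrow> 1 \<le> i \<and> i < n) \<and>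
                    (\<forall>r\<in>{1..n}. \<nu> r = lam r + of_nat (d (r-1)) - of_nat (d r))}.
              rhs_series n \<mu> \<sigma> d)"
proof
  fix \<nu>
  interpret V: verma n lam scale E v \<mu> by unfold_locales (rule verma)
  let ?W = "\<lambda>d. \<forall>r\<in>{1..n}. \<nu> r = lam r + of_nat (d (r-1)) - of_nat (d r)"
  let ?D = "{d. (\<forall>i. d i \<noteq> 0 \<longrightarrow> 1 \<le> i \<and> i < n) \<and> ?W d}"
  let ?G = "{\<beta> \<in> GammaA n. \<forall>k\<in>{1..n}. E k k (V.bas \<beta>) = scale (\<nu> k) (V.bas \<beta>)}"
  have Phi: "\<Phi> (V.bas \<beta>) = pbw n (tilde_action scale E \<mu>) \<beta> (u_vec n scale E v \<mu> \<sigma>)" for \<beta>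
    using pbw_hom[of n \<Phi> E "tilde_action scale E \<mu>" \<beta> v] Phi_hom by (simp add: Phi_v)
  have eig: "E k k (V.bas \<beta>) = scale (\<nu> k) (V.bas \<beta>) \<longleftrightarrow>
      \<nu> k = lam k + of_nat (wt n \<beta> (k - 1)) - of_nat (wt n \<beta> k)" if "\<beta> \<in> GammaA n" "k \<in> {1..n}" for \<beta> k
    unfolding V.E_diag_bas[OF that(2)] V.scale_cancel_right using V.bas_nonzero[OF that(1)] by auto
  have G: "\<beta> \<in> ?G \<longleftrightarrow> \<beta> \<in> GammaA n \<and> ?W (wt n \<beta>)" for \<beta>
    unfolding mem_Collect_eq by (intro conj_cong ball_cong refl eig)
  \<comment> \<open>\<open>\<nu>\<close> prescribes the successive differences of \<open>d\<close>,
    and \<open>d 0 = 0\<close>. The sum on the right therefore has at most one term, and none if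
    \<open>\<nu>\<close> is not a weight.\<close>
  have uniq: "d = d'" if "d \<in> ?D" "d' \<in> ?D" for d d'
  proof
    fix r
    have outside: "d s = 0 \<and> d' s = 0" if "\<not> (1 \<le> s \<and> s < n)" for s
      using \<open>d \<in> ?D\<close> \<open>d' \<in> ?D\<close> that by blast
    have "d r = d' r" if "r \<le> n" for r
      using that
    proof (induction r)
      case 0
      show ?case using outside[of 0] by simp
    next
      case (Suc r)
      have "\<nu> (Suc r) = lam (Suc r) + of_nat (x r) - of_nat (x (Suc r))" if "x \<in> ?D" for x
      proof -
        from that have "?W x" by blast
        then have "\<nu> (Suc r) = lam (Suc r) + of_nat (x (Suc r - 1)) - of_nat (x (Suc r))"
          by (rule bspec) (use Suc.prems in simp)
        then show ?thesis by simp
      qed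
      from this[OF \<open>d \<in> ?D\<close>] this[OF \<open>d' \<in> ?D\<close>] show ?case using Suc by simp
    qed
    then show "d r = d' r" using outside[of r] by (cases "r \<le> n") auto
  qed
  have wtD: "wt n \<beta> \<in> ?D" if "\<beta> \<in> ?G" for \<beta>
    using that wt_outside[of n \<beta>] unfolding G by blast
  show "etingof_coeff n scale E v \<Phi> \<nu> = (\<Sum>d\<in>?D. rhs_series n \<mu> \<sigma> d)"
  proof (cases "?D = {}")
    case True
    then have "?G = {}" using wtD by blast
    then show ?thesis unfolding etingof_coeff_def True by (simp only: sum.empty)
  next
    case False
    then obtain d where d: "d \<in> ?D" by blast
    then have D: "?D = {d}" using uniq by blast
    have "?G = GammaW n d"
    proof (intro equalityI subsetI)
      fix \<beta> assume "\<beta> \<in> ?G"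
      then show "\<beta> \<in> GammaW n d" using wtD[of \<beta>] uniq[OF d, of "wt n \<beta>"] by (simp add: GammaW_def)
    next
      fix \<beta> assume "\<beta> \<in> GammaW n d"
      then show "\<beta> \<in> ?G" using d unfolding G by (auto simp: GammaW_def)
    qed
    then have "etingof_coeff n scale E v \<Phi> \<nu> = V.trace (u_vec n scale E v \<mu> \<sigma>) d"
      unfolding etingof_coeff_def V.trace_def V.cf_def Phi by (simp only:)
    also have "\<dots> = rhs_series n \<mu> \<sigma> d"
      using d n3 by (intro V.trace_u_vec) auto
    finally show ?thesis unfolding D by simp
  qed
qed

end
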